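(* For every $n\ge 0$, the mapping $\Phi$ which sends a tree-rooted map $M_T$ to the ordered pair $(\varphi_0(\vec M^T),\varphi_1(\vec M^T))$, where $\vec M^T=\delta(M_T)$, is a bijection between the set of tree-rooted maps of size $n$ and the Cartesian product of the set of trees of size $n$ and the set of non-crossing partitions of size $n+1$. Consequently, the number of tree-rooted maps of size $n$ is $C_nC_{n+1}$, where $C_n=\frac{1}{n+1}\binom{2n}{n}$.
   Context: A (rooted planar) map is a 2-cell embedding of a connected planar graph (loops and multiple edges allowed) in the oriented sphere, considered up to orientation-preserving homeomorphism, together with a distinguished half-edge called the root; the vertex incident to the root is the root-vertex. A (planted plane) tree is a map with a single face. The size of a map or tree is its number of edges. A tree-rooted map $M_T$ is a map $M$ together with a distinguished spanning tree $T$ (which inherits the root of $M$). The tour of $T$ consists in following the border of $T$ counterclockwise, starting and finishing at the root; it induces a linear order ("precedes around $T$") on the vertices, on the edges of $T$, and on the half-edges of edges not in $T$ (each such half-edge is crossed once during the tour). In an oriented map each edge goes from its origin to its end; the half-edge at the origin is the tail, the one at the end is the head; the root is always considered as a head. The map $\delta(M_T)=\vec M^T$ is the oriented map obtained from $M$ by orienting the edges of $T$ away from the root-vertex (from the root to the leaves), and each edge not in $T$ so that its head precedes its tail around $T$. Vertex explosion: given an oriented map $\vec M$ in which every vertex is incident to at least one head, replace each vertex $v$ by as many vertices as heads incident to $v$, each new vertex carrying one head $h$ of $v$ together with the tails $t$ of $v$ for which $h$ is the first head met when turning counterclockwise around $v$ starting from $t$ (cyclic orders inherited, root kept). The resulting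 rooted object is $\varphi_0(\vec M)$ (it has the same number of edges as $\vec M$); its vertex set is linearly ordered by order of appearance in the tour of $\varphi_0(\vec M)$, and $\varphi_1(\vec M)$ is the equivalence relation on this vertex set in which two vertices are equivalent iff they come from the same vertex of $\vec M$. A non-crossing partition of a finite linearly ordered set $S$ is an equivalence relation $\sim$ on $S$ such that there are no $a<b<c<d$ in $S$ with $a\sim c$, $b\sim d$ and $a\not\sim b$; its size is $|S|$; non-crossing partitions are considered up to order-preserving relabelling of $S$. *)

theory Defs
  imports Complex_Main "HOL-Combinatorics.Orbits"
begin

section \<open>Rooted planar maps\<close>

text \<open>
  A 2-cell embedded graph in the oriented sphere, up to orientation-preserving homeomorphism, is
  encoded in the standard way by its half-edges: \<open>rot\<close> sends a half-edge to the next one in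
  counterclockwise order around its vertex, and \<open>opp\<close> exchanges the two halves of each edge.
  The root is a dangling half-edge (an arrow pointing at the root-vertex) that belongs to no edge;
  it is the only fixed point of \<open>opp\<close>.  Hence a map with \<open>n\<close> edges has \<open>2 n + 1\<close> half-edges, an
  oriented map with \<open>n\<close> edges has \<open>n + 1\<close> heads, and the map with no edge is
  covered too.
\<close>

record 'h rmap =
  half_edges :: "'h set"
  rot :: "'h \<Rightarrow> 'h"
  opp :: "'h \<Rightarrow> 'h"
  root_he :: 'h

definition vertex_of :: "('h, 'z) rmap_scheme \<Rightarrow> 'h \<Rightarrow> 'h set" where
  "vertex_of M x = orbit (rot M) x"

definition vertices :: "('h, 'z) rmap_scheme \<Rightarrow> 'h set set" where
  "vertices M = vertex_of M ` half_edges M"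

definition edges :: "('h, 'z) rmap_scheme \<Rightarrow> 'h set set" where
  "edges M = (\<lambda>x. {x, opp M x}) ` (half_edges M - {root_he M})"

definition faces :: "('h, 'z) rmap_scheme \<Rightarrow> 'h set set" where
  "faces M = orbit (rot M \<circ> opp M) ` half_edges M"

definition map_size :: "('h, 'z) rmap_scheme \<Rightarrow> nat" where
  "map_size M = card (edges M)"

definition connected_map :: "('h, 'z) rmap_scheme \<Rightarrow> bool" where
  "connected_map M \<longleftrightarrow> (\<forall>x \<in> half_edges M. \<forall>y \<in> half_edges M.
     (x, y) \<in> ({(u, rot M u) | u. u \<in> half_edges M} \<union> {(u, opp M u) | u. u \<in> half_edges M})\<^sup>*)"

text \<open>Euler's relation says that the surface of the embedding is the sphere.\<close>

definition planar_map :: "('h, 'z) rmap_scheme \<Rightarrow> bool" where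
  "planar_map M \<longleftrightarrow>
     finite (half_edges M) \<and> root_he M \<in> half_edges M \<and>
     rot M permutes half_edges M \<and> opp M permutes half_edges M \<and>
     (\<forall>x \<in> half_edges M. opp M (opp M x) = x) \<and>
     (\<forall>x \<in> half_edges M. opp M x = x \<longleftrightarrow> x = root_he M) \<and>
     connected_map M \<and>
     card (vertices M) + card (faces M) = card (edges M) + 2"

definition plane_tree :: "('h, 'z) rmap_scheme \<Rightarrow> bool" where
  "plane_tree M \<longleftrightarrow> planar_map M \<and> card (faces M) = 1"


section \<open>Tree-rooted maps\<close>

text \<open>Cyclic orders inherited by a set \<open>S\<close> of half-edges: the first return map to \<open>S\<close>.\<close>

definition first_return :: "('h \<Rightarrow> 'h) \<Rightarrow> 'h set \<Rightarrow> 'h \<Rightarrow> 'h" where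
  "first_return f S x =
     (if x \<in> S then (f ^^ (LEAST k. 0 < k \<and> (f ^^ k) x \<in> S)) x else x)"

text \<open>The submap formed by the edges whose half-edges are in \<open>S\<close>, with the root of \<open>M\<close>.\<close>

definition submap :: "('h, 'z) rmap_scheme \<Rightarrow> 'h set \<Rightarrow> 'h rmap" where
  "submap M S =
     \<lparr>half_edges = insert (root_he M) S,
      rot = first_return (rot M) (insert (root_he M) S),
      opp = (\<lambda>x. if x \<in> S then opp M x else x),
      root_he = root_he M\<rparr>"

record 'h tree_rmap = "'h rmap" +
  tree :: "'h set"

definition spanning_tree :: "('h, 'z) rmap_scheme \<Rightarrow> 'h set \<Rightarrow> bool" where
  "spanning_tree M S \<longleftrightarrow>
     S \<subseteq> half_edges M - {root_he M} \<and> opp M ` S = S \<and>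
     (\<forall>v \<in> vertices M. v \<inter> insert (root_he M) S \<noteq> {}) \<and>
     plane_tree (submap M S)"

definition tree_rooted_map :: "'h tree_rmap \<Rightarrow> bool" where
  "tree_rooted_map M \<longleftrightarrow> planar_map M \<and> spanning_tree M (tree M)"


section \<open>The tour of a tree\<close>

text \<open>
  Walking with the tree on the left, one turns counterclockwise around the current vertex; a
  half-edge of the tree \<open>S\<close> is followed to its other end, any other half-edge is crossed.
\<close>

definition tour_step :: "('h, 'z) rmap_scheme \<Rightarrow> 'h set \<Rightarrow> 'h \<Rightarrow> 'h" where
  "tour_step M S x = rot M (if x \<in> S then opp M x else x)"

definition tour_time :: "('h, 'z) rmap_scheme \<Rightarrow> 'h set \<Rightarrow> 'h \<Rightarrow> nat" where
  "tour_time M S x = (LEAST k. (tour_step M S ^^ k) (root_he M) = x)"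

text \<open>First time at which the tour of a tree \<open>A\<close> meets the vertex \<open>v\<close>, and rank of \<open>v\<close>
  (starting from 0) in the order of appearance.\<close>

definition appearance :: "('h, 'z) rmap_scheme \<Rightarrow> 'h set \<Rightarrow> nat" where
  "appearance A v =
     (LEAST k. (tour_step A (half_edges A - {root_he A}) ^^ k) (root_he A) \<in> v)"

definition vertex_rank :: "('h, 'z) rmap_scheme \<Rightarrow> 'h set \<Rightarrow> nat" where
  "vertex_rank A v = card {w \<in> vertices A. appearance A w < appearance A v}"


section \<open>Orientation\<close>

record 'h omap = "'h rmap" +
  heads :: "'h set"

definition tree_adjacent :: "'h tree_rmap \<Rightarrow> ('h set \<times> 'h set) set" where
  "tree_adjacent M = {(vertex_of M x, vertex_of M (opp M x)) | x. x \<in> tree M}"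

definition depth :: "'h tree_rmap \<Rightarrow> 'h set \<Rightarrow> nat" where
  "depth M v = (LEAST k. (vertex_of M (root_he M), v) \<in> tree_adjacent M ^^ k)"

definition delta :: "'h tree_rmap \<Rightarrow> 'h omap" where
  "delta M =
     \<lparr>half_edges = half_edges M, rot = rot M, opp = opp M, root_he = root_he M,
      heads = {root_he M} \<union>
        {x \<in> tree M. depth M (vertex_of M (opp M x)) < depth M (vertex_of M x)} \<union>
        {x \<in> half_edges M - tree M - {root_he M}.
           tour_time M (tree M) x < tour_time M (tree M) (opp M x)}\<rparr>"


section \<open>Vertex explosion\<close>

text \<open>The first head met when turning counterclockwise from \<open>x\<close>; it is \<open>x\<close> itself if \<open>x\<close> is a head.\<close>

definition first_head :: "'h omap \<Rightarrow> 'h \<Rightarrow> 'h" where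
  "first_head M x = (rot M ^^ (LEAST k. (rot M ^^ k) x \<in> heads M)) x"

definition phi0 :: "'h omap \<Rightarrow> 'h rmap" where
  "phi0 M =
     \<lparr>half_edges = half_edges M,
      rot = (\<lambda>x. first_return (rot M) {y \<in> half_edges M. first_head M y = first_head M x} x),
      opp = opp M,
      root_he = root_he M\<rparr>"

text \<open>A new vertex comes from the vertex of \<open>M\<close> that contains its half-edges.\<close>

definition same_origin :: "'h omap \<Rightarrow> ('h set \<times> 'h set) set" where
  "same_origin M =
     {(v, w). v \<in> vertices (phi0 M) \<and> w \<in> vertices (phi0 M) \<and>
        (\<exists>u \<in> vertices M. v \<subseteq> u \<and> w \<subseteq> u)}"

text \<open>Partitions are taken up to order-preserving relabelling, so a vertex is replaced by its rank.\<close>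

definition phi1 :: "'h omap \<Rightarrow> (nat \<times> nat) set" where
  "phi1 M = map_prod (vertex_rank (phi0 M)) (vertex_rank (phi0 M)) ` same_origin M"


section \<open>Non-crossing partitions\<close>

definition noncrossing_partition :: "'a::linorder set \<Rightarrow> ('a \<times> 'a) set \<Rightarrow> bool" where
  "noncrossing_partition S R \<longleftrightarrow> equiv S R \<and>
     \<not> (\<exists>a \<in> S. \<exists>b \<in> S. \<exists>c \<in> S. \<exists>d \<in> S.
          a < b \<and> b < c \<and> c < d \<and> (a, c) \<in> R \<and> (b, d) \<in> R \<and> (a, b) \<notin> R)"

text \<open>The standard representatives live on \<open>{..<m}\<close>.\<close>

definition noncrossing_partitions :: "nat \<Rightarrow> (nat \<times> nat) set set" where
  "noncrossing_partitions m = {R. noncrossing_partition {..<m} R}"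


section \<open>Isomorphism classes\<close>

definition map_iso :: "('h \<Rightarrow> 'k) \<Rightarrow> ('h, 'y) rmap_scheme \<Rightarrow> ('k, 'z) rmap_scheme \<Rightarrow> bool" where
  "map_iso f M N \<longleftrightarrow>
     bij_betw f (half_edges M) (half_edges N) \<and>
     (\<forall>x \<in> half_edges M. f (rot M x) = rot N (f x) \<and> f (opp M x) = opp N (f x)) \<and>
     f (root_he M) = root_he N"

definition tree_rooted_iso :: "('h \<Rightarrow> 'k) \<Rightarrow> 'h tree_rmap \<Rightarrow> 'k tree_rmap \<Rightarrow> bool" where
  "tree_rooted_iso f M N \<longleftrightarrow> map_iso f M N \<and> f ` tree M = tree N"

text \<open>Natural numbers suffice as names of the half-edges, since maps are finite.\<close>

definition map_equiv :: "(nat rmap \<times> nat rmap) set" where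
  "map_equiv = {(M, N). planar_map M \<and> planar_map N \<and> (\<exists>f. map_iso f M N)}"

definition tree_rooted_equiv :: "(nat tree_rmap \<times> nat tree_rmap) set" where
  "tree_rooted_equiv =
     {(M, N). tree_rooted_map M \<and> tree_rooted_map N \<and> (\<exists>f. tree_rooted_iso f M N)}"

definition plane_trees :: "nat \<Rightarrow> nat rmap set set" where
  "plane_trees n = {A. plane_tree A \<and> map_size A = n} // map_equiv"

definition tree_rooted_maps :: "nat \<Rightarrow> nat tree_rmap set set" where
  "tree_rooted_maps n = {M. tree_rooted_map M \<and> map_size M = n} // tree_rooted_equiv"


section \<open>The mapping on isomorphism classes\<close>

text \<open>Defined through an arbitrary representative of the class \<open>X\<close>.\<close>

definition Phi :: "nat tree_rmap set \<Rightarrow> nat rmap set \<times> (nat \<times> nat) set" where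
  "Phi X = (let M = (SOME M. M \<in> X) in (map_equiv `` {phi0 (delta M)}, phi1 (delta M)))"

definition catalan :: "nat \<Rightarrow> real" where
  "catalan n = 1 / (real n + 1) * real ((2 * n) choose n)"

end

(*
  Everything is expressed by permutations of the half-edges.  For a permutation s and a full
  cycle c of a finite set H, the numbers of orbits of c o s and of s add up to at most |H| + 1;
  in the case of equality ("genus zero") the orbits of s are non-crossing for the cyclic order c,
  and s runs through each of them in decreasing order (genus_zero).

  Well-definedness.  The tour of a spanning tree T is a full cycle c, and rot = c o t, where t flips
  the edges of T; this is a genus zero situation, from which one reads off the depths in T and hence
  the heads.  The head that follows the tail of a head h around its vertex comes after h in the
  tour, so that the exploded map is connected by parent edges without a cycle and has a single
  face f.  If p maps each head to the next head around its vertex and a flips all edges, then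
  f o (a p a) is the face permutation of the map.  Euler's relation makes this a genus zero
  situation as well, so the vertices of the map induce a non-crossing partition of those of the
  tree.

  Injectivity.  The tree determines the heads, and the partition determines p, because p is
  monotone on its orbits.  This gives back the oriented map; the spanning tree is recovered along its
  tour, since an edge is in the tree iff its tail is visited before its head.

  Surjectivity.  Trees and non-crossing partitions are injected into Dyck words, and walks in the
  quadrant (shuffles of two Dyck words) into tree-rooted maps.  By the reflection principle the
  bounds coincide, so that all of these injections are bijections.
*)
theory Submission
  imports Defs
begin

section \<open>Orbits of permutations of a finite set\<close>

text \<open>Time along \<open>c\<close>, counted from a root, linearises the cyclic order, and the
  orbit inequality is a double count of descents, the points that \<open>s\<close> moves back in
  time: an orbit of \<open>c \<circ> s\<close> avoiding the root has a descent, an orbit of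
  \<open>s\<close> has a non-descent. Equality leaves no freedom: each descent is the one chosen in
  its orbit of \<open>c \<circ> s\<close>, each non-descent the one chosen in its orbit of
  \<open>s\<close>, and all rigidity comes from this. The same count serves the tour of a spanning
  tree, the contour of a plane tree and the arc diagrams of the counting part. The conjugation of
  \<open>p\<close> by \<open>a\<close> is forced by the order on the tree vertices: a vertex is
  discovered one step after the tail of its head, so blocks have to be compared at tails. An inverse
  of \<open>Phi\<close> would have to produce a spanning tree out of a tree and a partition.
  Counting avoids this and asks only for one-sided bounds: none of the codings by words has to be
  shown surjective.\<close>

definition orbits :: "('a \<Rightarrow> 'a) \<Rightarrow> 'a set \<Rightarrow> 'a set set" where
  "orbits p H = orbit p ` H"

lemma permutes_orbit_self: "p permutes H \<Longrightarrow> finite H \<Longrightarrow> x \<in> orbit p x"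
  by (rule permutation_self_in_orbit) (auto simp: permutation_permutes)

lemma permutes_orbit_eq:
  assumes "p permutes H" "finite H" "y \<in> orbit p x"
  shows "orbit p y = orbit p x"
  by (rule orbit_cyclic_eq3[OF cyclic_on_orbit[OF assms(1,2)] assms(3)])

lemma permutes_orbit_iff:
  assumes "p permutes H" "finite H"
  shows "y \<in> orbit p x \<longleftrightarrow> orbit p y = orbit p x"
proof
  show "y \<in> orbit p x \<Longrightarrow> orbit p y = orbit p x" by (rule permutes_orbit_eq[OF assms])
  show "orbit p y = orbit p x \<Longrightarrow> y \<in> orbit p x" using permutes_orbit_self[OF assms, of y] by simp
qed

lemma permutes_orbit_step: "p permutes H \<Longrightarrow> finite H \<Longrightarrow> orbit p (p x) = orbit p x"
  by (simp add: permutes_orbit_eq orbit.base)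

lemma permutes_orbit_preimage:
  assumes "p permutes H" "finite H" "p z \<in> orbit p x"
  shows "z \<in> orbit p x"
proof -
  have "orbit p z = orbit p (p z)" by (rule permutes_orbit_step[OF assms(1,2), symmetric])
  also have "\<dots> = orbit p x" by (rule permutes_orbit_eq[OF assms])
  finally show ?thesis by (simp add: permutes_orbit_iff[OF assms(1,2)])
qed

lemma permutes_orbit_funpow:
  assumes "p permutes H" "finite H"
  shows "y \<in> orbit p x \<longleftrightarrow> (\<exists>k. (p ^^ k) x = y)"
proof -
  have "permutation p" using assms by (auto simp: permutation_permutes)
  then have "orbit p x = {(p ^^ k) x | k. True}" by (rule orbit_altdef_permutation)
  then show ?thesis by auto
qed

lemma permutes_funpow_in: "p permutes H \<Longrightarrow> x \<in> H \<Longrightarrow> (p ^^ k) x \<in> H"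
  by (induction k) (auto simp: permutes_in_image)

lemma permutes_orbit_closed:
  assumes "p permutes H" "finite H" "x \<in> A" "p ` A \<subseteq> A"
  shows "orbit p x \<subseteq> A"
proof
  fix y assume "y \<in> orbit p x"
  then show "y \<in> A" using assms by induct auto
qed

lemma orbits_Int_disjoint:
  assumes "p permutes H" "finite H" "O1 \<in> orbits p H" "O2 \<in> orbits p H" "x \<in> O1" "x \<in> O2"
  shows "O1 = O2"
proof -
  obtain a b where "O1 = orbit p a" "O2 = orbit p b" using assms by (auto simp: orbits_def)
  then show ?thesis using permutes_orbit_eq[OF assms(1,2)] assms(5,6) by blast
qed

lemma finite_orbits [simp]: "finite H \<Longrightarrow> finite (orbits p H)"
  by (simp add: orbits_def)

lemma arg_min_setE:
  fixes T :: "'a \<Rightarrow> nat"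
  assumes "A \<noteq> {}"
  obtains m where "m \<in> A" "\<And>y. y \<in> A \<Longrightarrow> T m \<le> T y"
  using assms ex_has_least_nat[of "\<lambda>x. x \<in> A" _ T] by blast

lemma arg_max_setE:
  fixes T :: "'a \<Rightarrow> nat"
  assumes "finite A" "A \<noteq> {}"
  obtains m where "m \<in> A" "\<And>y. y \<in> A \<Longrightarrow> T y \<le> T m"
proof -
  have "Max (T ` A) \<in> T ` A" using assms by simp
  then obtain m where "m \<in> A" "T m = Max (T ` A)" by force
  then show thesis using that assms by (metis Max_ge finite_imageI imageI)
qed

section \<open>Products with a full cycle\<close>

locale full_cycle =
  fixes H :: "'a set" and c :: "'a \<Rightarrow> 'a" and r :: 'a
  assumes fin: "finite H" and perm: "c permutes H" and root: "r \<in> H"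
    and full: "H \<subseteq> orbit c r"
begin

definition time :: "'a \<Rightarrow> nat" where
  "time x = (LEAST k. (c ^^ k) r = x)"

lemma funpow_time: "x \<in> H \<Longrightarrow> (c ^^ time x) r = x"
  unfolding time_def using full permutes_orbit_funpow[OF perm fin, of x r] by (auto intro: LeastI)

lemma time_le: "(c ^^ k) r = x \<Longrightarrow> time x \<le> k"
  unfolding time_def by (rule Least_le)

lemma time_inj: "x \<in> H \<Longrightarrow> y \<in> H \<Longrightarrow> time x = time y \<longleftrightarrow> x = y"
  using funpow_time by metis

lemma time_root [simp]: "time r = 0"
  using time_le[of 0 r] by simp

lemma time_eq_0: "x \<in> H \<Longrightarrow> time x = 0 \<longleftrightarrow> x = r"
  using time_inj[OF _ root] by simp

lemma c_in: "c x \<in> H \<longleftrightarrow> x \<in> H"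
  by (rule permutes_in_image[OF perm])

lemma time_step:
  assumes "x \<in> H" "c x \<noteq> r"
  shows "time (c x) = Suc (time x)"
proof (rule antisym)
  show "time (c x) \<le> Suc (time x)"
    by (rule time_le) (simp add: funpow_time assms)
  show "Suc (time x) \<le> time (c x)"
  proof (cases "time (c x)")
    case 0
    then show ?thesis using assms time_eq_0 c_in by auto
  next
    case (Suc k)
    have "(c ^^ Suc k) r = c x" using funpow_time[of "c x"] assms c_in Suc by simp
    then have "(c ^^ k) r = x" using permutes_inj[OF perm] by (simp add: inj_eq)
    then show ?thesis using time_le[of k x] Suc by simp
  qed
qed

lemma orbit_root: "x \<in> H \<Longrightarrow> orbit c x = H"
  using full permutes_orbit_eq[OF perm fin, of x r] permutes_orbit_subset[OF perm root] by blast

text \<open>Were the \<open>m\<close>-th point of the cycle met already at some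
  \<open>l < m\<close>, cutting out the steps between \<open>l\<close> and \<open>m\<close> would
  lead to \<open>x\<close> before \<open>time x\<close>.\<close>

lemma time_funpow:
  assumes "m \<le> time x" "x \<in> H"
  shows "time ((c ^^ m) r) = m"
proof (rule antisym)
  show "time ((c ^^ m) r) \<le> m" by (rule time_le) simp
  define l where "l = time ((c ^^ m) r)"
  have "(c ^^ (time x - m + l)) r = (c ^^ (time x - m)) ((c ^^ l) r)" by (simp add: funpow_add)
  also have "(c ^^ l) r = (c ^^ m) r"
    unfolding l_def by (rule funpow_time) (rule permutes_funpow_in[OF perm root])
  also have "(c ^^ (time x - m)) ((c ^^ m) r) = (c ^^ (time x - m + m)) r" by (simp add: funpow_add)
  also have "\<dots> = x" using funpow_time assms by simp
  finally have "time x \<le> time x - m + l" by (rule time_le)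
  then show "m \<le> time ((c ^^ m) r)" using assms(1) by (simp add: l_def)
qed

lemma time_less_card:
  assumes "x \<in> H"
  shows "time x < card H"
proof -
  let ?f = "\<lambda>k. (c ^^ k) r"
  have "inj_on ?f {..time x}"
  proof (rule inj_onI)
    fix k l assume kl: "k \<in> {..time x}" "l \<in> {..time x}" and eq: "?f k = ?f l"
    have "time (?f k) = k" "time (?f l) = l" using kl time_funpow[OF _ assms] by simp_all
    then show "k = l" using eq by metis
  qed
  moreover have "?f ` {..time x} \<subseteq> H" using permutes_funpow_in[OF perm root] by blast
  ultimately have "card {..time x} \<le> card H" using card_inj_on_le fin by blast
  then show ?thesis by simp
qed

lemma inj_time: "inj_on time H"
  by (rule inj_onI) (simp add: time_inj)

lemma time_image: "time ` H = {..<card H}"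
  by (rule card_subset_eq) (use time_less_card card_image[OF inj_time] in auto)

lemma time_c:
  assumes "x \<in> H"
  shows "time (c x) = (if Suc (time x) < card H then Suc (time x) else 0)"
proof (cases "c x = r")
  case True
  have "\<not> Suc (time x) < card H"
  proof
    assume "Suc (time x) < card H"
    then have "Suc (time x) \<in> time ` H" by (simp add: time_image)
    then obtain z where z: "z \<in> H" "Suc (time x) = time z" by blast
    have "(c ^^ Suc (time x)) r = c x" using funpow_time[OF assms] by simp
    then have "z = r" using funpow_time[OF z(1)] True unfolding z(2) by simp
    then show False using z(2) by simp
  qed
  then show ?thesis using True by simp
next
  case False
  then show ?thesis using time_step[OF assms] time_less_card[of "c x"] c_in assms by simp
qed

end

section \<open>Descents and the orbit inequality\<close>

locale full_cycle_perm = full_cycle +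
  fixes s :: "'a \<Rightarrow> 'a"
  assumes sperm: "s permutes H"
begin

lemma s_in: "s x \<in> H \<longleftrightarrow> x \<in> H"
  by (rule permutes_in_image[OF sperm])

lemma cs_perm: "(c \<circ> s) permutes H"
  by (rule permutes_compose[OF sperm perm])

definition Desc where "Desc = {x \<in> H. time (s x) < time x}"

lemma Desc_H: "x \<in> Desc \<Longrightarrow> x \<in> H" by (simp add: Desc_def)

text \<open>The earliest point of \<open>Q\<close> is \<open>c (s x)\<close> for some
  \<open>x\<close> in \<open>Q\<close>. As it is not \<open>r\<close>, the step of \<open>c\<close>
  adds one to the time, so \<open>s x\<close> lies before all of \<open>Q\<close> and in particular
  before \<open>x\<close>.\<close>

lemma orbit_has_descent:
  assumes "Q \<in> orbits (c \<circ> s) H" "r \<notin> Q"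
  obtains x where "x \<in> Q" "x \<in> Desc" "\<And>y. y \<in> Q \<Longrightarrow> time (c (s x)) \<le> time y"
proof -
  obtain z where z: "z \<in> H" "Q = orbit (c \<circ> s) z" using assms by (auto simp: orbits_def)
  have QH: "Q \<subseteq> H" using z permutes_orbit_subset[OF cs_perm] by simp
  obtain m where m: "m \<in> Q" "\<And>y. y \<in> Q \<Longrightarrow> time m \<le> time y"
    using arg_min_setE[of Q time] z permutes_orbit_self[OF cs_perm fin] by blast
  obtain x where x: "m = (c \<circ> s) x" by (metis permutes_surj[OF cs_perm] surjD)
  have xQ: "x \<in> Q" using m(1) permutes_orbit_preimage[OF cs_perm fin] unfolding z(2) x by blast
  then have xH: "x \<in> H" using QH by blast
  have "time m = Suc (time (s x))" using x m assms time_step[of "s x"] xH s_in by auto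
  then have "x \<in> Desc" using m(2)[OF xQ] xH by (simp add: Desc_def)
  then show thesis using that xQ m x by simp
qed

definition desc_of where
  "desc_of Q = (SOME x. x \<in> Q \<and> x \<in> Desc \<and> (\<forall>y\<in>Q. time (c (s x)) \<le> time y))"

lemma desc_of:
  assumes "Q \<in> orbits (c \<circ> s) H" "r \<notin> Q"
  shows "desc_of Q \<in> Q" "desc_of Q \<in> Desc" "\<And>y. y \<in> Q \<Longrightarrow> time (c (s (desc_of Q))) \<le> time y"
proof -
  obtain x where "x \<in> Q" "x \<in> Desc" "\<And>y. y \<in> Q \<Longrightarrow> time (c (s x)) \<le> time y"
    by (rule orbit_has_descent[OF assms]) (rule that)
  then have "x \<in> Q \<and> x \<in> Desc \<and> (\<forall>y\<in>Q. time (c (s x)) \<le> time y)" by simp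
  then have "desc_of Q \<in> Q \<and> desc_of Q \<in> Desc \<and> (\<forall>y\<in>Q. time (c (s (desc_of Q))) \<le> time y)"
    unfolding desc_of_def by (rule someI)
  then show "desc_of Q \<in> Q" "desc_of Q \<in> Desc" "\<And>y. y \<in> Q \<Longrightarrow> time (c (s (desc_of Q))) \<le> time y"
    by auto
qed

definition nonroot_orbits where
  "nonroot_orbits = orbits (c \<circ> s) H - {orbit (c \<circ> s) r}"

lemma nonroot_orbitsD:
  assumes "Q \<in> nonroot_orbits"
  shows "Q \<in> orbits (c \<circ> s) H" "r \<notin> Q"
  using assms permutes_orbit_eq[OF cs_perm fin] unfolding nonroot_orbits_def orbits_def by auto

lemma inj_desc_of: "inj_on desc_of nonroot_orbits"
proof (rule inj_onI)
  fix P Q assume "P \<in> nonroot_orbits" "Q \<in> nonroot_orbits" "desc_of P = desc_of Q"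
  then show "P = Q"
    using desc_of(1)[OF nonroot_orbitsD] orbits_Int_disjoint[OF cs_perm fin] nonroot_orbitsD(1) by metis
qed

lemma card_nonroot_orbits: "Suc (card nonroot_orbits) = card (orbits (c \<circ> s) H)"
proof -
  have "orbit (c \<circ> s) r \<in> orbits (c \<circ> s) H" using root by (simp add: orbits_def)
  then show ?thesis unfolding nonroot_orbits_def using card_Suc_Diff1[of "orbits (c \<circ> s) H"] fin by simp
qed

lemma finite_Desc: "finite Desc"
  using fin by (simp add: Desc_def)

lemma card_nonroot_le: "card nonroot_orbits \<le> card Desc"
  by (rule card_inj_on_le[OF inj_desc_of _ finite_Desc]) (auto intro: desc_of(2) dest: nonroot_orbitsD)

text \<open>The earliest point of an orbit of \<open>s\<close> cannot be moved back.\<close>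

lemma orbit_min_nondescent:
  assumes "P \<in> orbits s H"
  obtains m where "m \<in> P" "m \<in> H - Desc" "\<And>y. y \<in> P \<Longrightarrow> time m \<le> time y"
proof -
  obtain z where z: "z \<in> H" "P = orbit s z" using assms by (auto simp: orbits_def)
  have PH: "P \<subseteq> H" using z permutes_orbit_subset[OF sperm] by simp
  obtain m where m: "m \<in> P" "\<And>y. y \<in> P \<Longrightarrow> time m \<le> time y"
    using arg_min_setE[of P time] z permutes_orbit_self[OF sperm fin] by blast
  have "s m \<in> P" using m z by (simp add: orbit.step)
  then have "m \<in> H - Desc" using m PH by (auto simp: Desc_def not_less)
  then show thesis using that m by blast
qed

definition min_of where
  "min_of P = (SOME x. x \<in> P \<and> x \<in> H - Desc \<and> (\<forall>y\<in>P. time x \<le> time y))"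

lemma min_of:
  assumes "P \<in> orbits s H"
  shows "min_of P \<in> P" "min_of P \<in> H - Desc" "\<And>y. y \<in> P \<Longrightarrow> time (min_of P) \<le> time y"
proof -
  obtain x where "x \<in> P" "x \<in> H - Desc" "\<And>y. y \<in> P \<Longrightarrow> time x \<le> time y"
    by (rule orbit_min_nondescent[OF assms]) (rule that)
  then have "x \<in> P \<and> x \<in> H - Desc \<and> (\<forall>y\<in>P. time x \<le> time y)" by simp
  then have "min_of P \<in> P \<and> min_of P \<in> H - Desc \<and> (\<forall>y\<in>P. time (min_of P) \<le> time y)"
    unfolding min_of_def by (rule someI)
  then show "min_of P \<in> P" "min_of P \<in> H - Desc" "\<And>y. y \<in> P \<Longrightarrow> time (min_of P) \<le> time y"
    by auto
qed

lemma inj_min_of: "inj_on min_of (orbits s H)"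
proof (rule inj_onI)
  fix P Q assume PQ: "P \<in> orbits s H" "Q \<in> orbits s H" "min_of P = min_of Q"
  then show "P = Q"
    using min_of(1)[OF PQ(1)] min_of(1)[OF PQ(2)] orbits_Int_disjoint[OF sperm fin PQ(1,2)] by metis
qed

lemma card_orbits_le: "card (orbits s H) \<le> card (H - Desc)"
  by (rule card_inj_on_le[OF inj_min_of]) (use min_of fin in auto)

lemma card_Desc_split: "card Desc + card (H - Desc) = card H"
proof -
  have "Desc \<subseteq> H" using Desc_H by blast
  then show ?thesis using fin card_Diff_subset[of Desc H] card_mono[of H Desc] finite_Desc by simp
qed

text \<open>Choosing descents injects the orbits of \<open>c \<circ> s\<close> other than that of
  \<open>r\<close> into \<open>Desc\<close>; choosing minima injects the orbits of \<open>s\<close>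
  into the complement. The orbit of \<open>r\<close> accounts for the \<open>Suc\<close>.\<close>

theorem card_orbits_genus: "card (orbits (c \<circ> s) H) + card (orbits s H) \<le> Suc (card H)"
  using card_nonroot_orbits card_nonroot_le card_orbits_le card_Desc_split by linarith

end

section \<open>Rigidity in the case of equality\<close>

locale genus_zero = full_cycle_perm +
  assumes genus0: "card (orbits (c \<circ> s) H) + card (orbits s H) = Suc (card H)"
begin

text \<open>Equality of the sums turns both cardinality bounds into equalities, so the two injective
  choices are also onto.\<close>

lemma desc_of_onto: "desc_of ` nonroot_orbits = Desc"
proof (rule card_subset_eq[OF finite_Desc])
  show "desc_of ` nonroot_orbits \<subseteq> Desc" using desc_of nonroot_orbitsD by blast
  show "card (desc_of ` nonroot_orbits) = card Desc"
    using card_image[OF inj_desc_of] card_nonroot_orbits card_nonroot_le card_orbits_le card_Desc_split genus0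
    by linarith
qed

lemma min_of_onto: "min_of ` orbits s H = H - Desc"
proof (rule card_subset_eq)
  show "finite (H - Desc)" using fin by simp
  show "min_of ` orbits s H \<subseteq> H - Desc" using min_of by blast
  show "card (min_of ` orbits s H) = card (H - Desc)"
    using card_image[OF inj_min_of] card_nonroot_orbits card_nonroot_le card_orbits_le card_Desc_split genus0
    by linarith
qed

lemma nondescent_min:
  assumes "x \<in> H" "x \<notin> Desc" "y \<in> orbit s x"
  shows "time x \<le> time y"
proof -
  obtain P where P: "P \<in> orbits s H" "x = min_of P" using assms min_of_onto by blast
  have "P = orbit s x" using P min_of(1)[OF P(1)] permutes_orbit_eq[OF sperm fin] unfolding orbits_def by auto
  then show ?thesis using min_of(3)[OF P(1), of y] P(2) assms(3) by simp
qed

lemma nondescent_unique: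
  assumes "x \<in> H" "y \<in> H" "x \<notin> Desc" "y \<notin> Desc" "y \<in> orbit s x"
  shows "x = y"
proof -
  have "x \<in> orbit s y" using assms permutes_orbit_iff[OF sperm fin] by blast
  then have "time y \<le> time x" by (rule nondescent_min[OF assms(2,4)])
  moreover have "time x \<le> time y" by (rule nondescent_min[OF assms(1,3,5)])
  ultimately show ?thesis using time_inj[OF assms(1,2)] by simp
qed

text \<open>The latest point of the orbit is the image of a point that is not moved back, and an
  orbit contains only one such point.\<close>

lemma nondescent_image_max:
  assumes "x \<in> H" "x \<notin> Desc" "y \<in> orbit s x"
  shows "time y \<le> time (s x)"
proof -
  have oH: "orbit s x \<subseteq> H" by (rule permutes_orbit_subset[OF sperm assms(1)])
  obtain m where m: "m \<in> orbit s x" "\<And>y. y \<in> orbit s x \<Longrightarrow> time y \<le> time m"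
    using arg_max_setE[of "orbit s x" time] finite_subset[OF oH fin] orbit_nonempty[of s x] by blast
  obtain z where z: "m = s z" by (metis permutes_surj[OF sperm] surjD)
  have zo: "z \<in> orbit s x" using m(1) unfolding z by (rule permutes_orbit_preimage[OF sperm fin])
  have "z \<notin> Desc" using m(2)[OF zo] z by (simp add: Desc_def)
  then have "x = z" using nondescent_unique assms zo oH by blast
  then show ?thesis using m z assms by simp
qed

text \<open>Among the descents that jump over a point of the orbit take the latest,
  \<open>u\<close>, and let \<open>v\<close> be the latest point that it skips. The preimage
  \<open>z\<close> of \<open>v\<close> lies after \<open>u\<close>, so it jumps over
  \<open>u\<close> and is a later descent of the same kind.\<close>

lemma descent_next:
  assumes "x \<in> Desc" "y \<in> orbit s x" "time y < time x"
  shows "time y \<le> time (s x)"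
proof (rule ccontr)
  assume neg: "\<not> time y \<le> time (s x)"
  define P where "P = orbit s x"
  have xH: "x \<in> H" using assms Desc_H by blast
  have PH: "P \<subseteq> H" unfolding P_def by (rule permutes_orbit_subset[OF sperm xH])
  have finP: "finite P" using finite_subset[OF PH fin] .
  have Po: "\<And>u. u \<in> P \<Longrightarrow> orbit s u = P" unfolding P_def using permutes_orbit_eq[OF sperm fin] by blast
  have xP: "x \<in> P" unfolding P_def using permutes_orbit_self[OF sperm fin] .
  define B where "B = {u \<in> P. u \<in> Desc \<and> (\<exists>v\<in>P. time (s u) < time v \<and> time v < time u)}"
  have "x \<in> B" using assms neg xP unfolding B_def P_def by force
  moreover have "finite B" using finP by (simp add: B_def)
  ultimately obtain u where u: "u \<in> B" "\<And>w. w \<in> B \<Longrightarrow> time w \<le> time u"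
    using arg_max_setE[of B time] by blast
  have uP: "u \<in> P" using u by (simp add: B_def)
  define Y where "Y = {v \<in> P. time (s u) < time v \<and> time v < time u}"
  have "Y \<noteq> {}" "finite Y" using u finP by (auto simp: B_def Y_def)
  then obtain v where v: "v \<in> Y" "\<And>w. w \<in> Y \<Longrightarrow> time w \<le> time v"
    using arg_max_setE[of Y time] by blast
  have vP: "v \<in> P" using v by (simp add: Y_def)
  obtain z where z: "v = s z" by (metis permutes_surj[OF sperm] surjD)
  have zP: "z \<in> P" using vP unfolding z P_def by (rule permutes_orbit_preimage[OF sperm fin])
  have zD: "z \<in> Desc"
  proof (rule ccontr)
    assume "z \<notin> Desc"
    then have "time u \<le> time v" using nondescent_image_max[of z u] z zP Po uP PH by blast
    then show False using v by (simp add: Y_def)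
  qed
  then have zv: "time v < time z" using z by (simp add: Desc_def)
  have "z \<noteq> u" using z v by (auto simp: Y_def)
  moreover have "\<not> time z < time u"
  proof
    assume "time z < time u"
    then have "z \<in> Y" using zP zv v by (auto simp: Y_def)
    then show False using v(2) zv by fastforce
  qed
  ultimately have uz: "time u < time z" using time_inj[of z u] zP uP PH by (meson linorder_neqE_nat subsetD)
  have "time (s z) < time u" using v z by (simp add: Y_def)
  then have "z \<in> B" using zP zD uP uz by (auto simp: B_def)
  then show False using u(2) uz by fastforce
qed

text \<open>Every descent is the chosen one of some orbit of \<open>c \<circ> s\<close> that avoids
  \<open>r\<close>. So an orbit contains at most one descent and the orbit of \<open>r\<close> none;
  the time bound is inherited from the choice.\<close>

lemma descent_in_orbit:
  assumes "x \<in> Desc"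
  shows "r \<notin> orbit (c \<circ> s) x" "\<And>y. y \<in> orbit (c \<circ> s) x \<Longrightarrow> time (c (s x)) \<le> time y"
    "\<And>y. y \<in> orbit (c \<circ> s) x \<Longrightarrow> y \<in> Desc \<Longrightarrow> y = x"
proof -
  have *: "\<exists>Q. Q \<in> nonroot_orbits \<and> x = desc_of Q \<and> Q = orbit (c \<circ> s) x" if xd: "x \<in> Desc" for x
  proof -
    obtain Q where Q: "Q \<in> nonroot_orbits" "x = desc_of Q" using xd desc_of_onto by blast
    have "Q = orbit (c \<circ> s) x"
      using Q desc_of(1) nonroot_orbitsD[OF Q(1)] permutes_orbit_eq[OF cs_perm fin]
      unfolding orbits_def by auto
    then show ?thesis using Q by blast
  qed
  obtain Q where Q: "Q \<in> nonroot_orbits" "x = desc_of Q" "Q = orbit (c \<circ> s) x" using *[OF assms] by blast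
  show "r \<notin> orbit (c \<circ> s) x" using nonroot_orbitsD Q by blast
  show "\<And>y. y \<in> orbit (c \<circ> s) x \<Longrightarrow> time (c (s x)) \<le> time y"
    using desc_of(3)[of Q] nonroot_orbitsD[OF Q(1)] Q by metis
  fix y assume y: "y \<in> orbit (c \<circ> s) x" "y \<in> Desc"
  obtain Q' where Q': "y = desc_of Q'" "Q' = orbit (c \<circ> s) y" using *[OF y(2)] by blast
  have "Q' = Q" unfolding Q'(2) Q(3) by (rule permutes_orbit_eq[OF cs_perm fin y(1)])
  then show "y = x" using Q(2) Q'(1) by metis
qed

text \<open>Of all arcs \<open>(s l, l)\<close> that cross \<open>(s j, j)\<close> in this way take
  the one with the latest \<open>s l\<close>. The orbit \<open>Q\<close> of \<open>l\<close> under
  \<open>c \<circ> s\<close> has its earliest point right after \<open>s l\<close> and must jump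
  over \<open>j\<close>. It does so through a non-descent \<open>x\<close>, whose orbit under
  \<open>s\<close> lies after \<open>s l\<close> and on both sides of \<open>j\<close>; its arc over
  \<open>j\<close> crosses \<open>(s j, j)\<close> too, with a later starting point.\<close>

lemma noncrossing_arcs:
  assumes "j \<in> Desc" "l \<in> Desc"
    and "time (s j) < time (s l)" "time (s l) < time j" "time j < time l"
  shows False
proof -
  define L where "L = {l \<in> Desc. time (s j) < time (s l) \<and> time (s l) < time j \<and> time j < time l}"
  have "finite L" "L \<noteq> {}" using assms finite_Desc by (auto simp: L_def)
  then obtain l where l: "l \<in> L" "\<And>z. z \<in> L \<Longrightarrow> time (s z) \<le> time (s l)"
    using arg_max_setE[of L "\<lambda>z. time (s z)"] by blast
  have lD: "l \<in> Desc" and lH: "l \<in> H" and jH: "j \<in> H" using l assms Desc_H by (auto simp: L_def)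
  define Q where "Q = orbit (c \<circ> s) l"
  have lQ: "l \<in> Q" unfolding Q_def by (rule permutes_orbit_self[OF cs_perm fin])
  have QH: "Q \<subseteq> H" unfolding Q_def by (rule permutes_orbit_subset[OF cs_perm lH])
  have Qstep: "c (s x) \<in> Q" if "x \<in> Q" for x
    using orbit.step[of x "c \<circ> s" l] that by (simp add: Q_def)
  have rQ: "r \<notin> Q" and Qmin: "\<And>y. y \<in> Q \<Longrightarrow> time (c (s l)) \<le> time y"
    and Quniq: "\<And>y. y \<in> Q \<Longrightarrow> y \<in> Desc \<Longrightarrow> y = l"
    using descent_in_orbit[OF lD] by (auto simp: Q_def)
  have time_next: "time (c (s x)) = Suc (time (s x))" if "x \<in> Q" for x
  proof (rule time_step)
    show "s x \<in> H" using that QH s_in by blast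
    show "c (s x) \<noteq> r" using Qstep[OF that] rQ by blast
  qed
  have jQ: "j \<notin> Q" using Quniq[of j] assms l by (auto simp: L_def)
  have "time (c (s l)) \<le> time j" using time_next[OF lQ] l by (auto simp: L_def)
  then have clj: "time (c (s l)) < time j" using time_inj[of "c (s l)" j] Qstep[OF lQ] QH jQ jH
    by (metis le_neq_implies_less subsetD)
  \<comment> \<open>The last point \<open>x\<close> of \<open>Q\<close> before \<open>j\<close>: a
    non-descent does not lead back, so the next point of the orbit is beyond
    \<open>j\<close>.\<close>
  define X where "X = {x \<in> Q. time x < time j}"
  have "finite X" "X \<noteq> {}" using clj Qstep[OF lQ] finite_subset[OF QH fin] by (auto simp: X_def)
  then obtain x where x: "x \<in> X" "\<And>z. z \<in> X \<Longrightarrow> time z \<le> time x"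
    using arg_max_setE[of X time] by blast
  have xQ: "x \<in> Q" and xj: "time x < time j" and xH: "x \<in> H" using x QH by (auto simp: X_def)
  have "x \<noteq> l" using xj l by (auto simp: L_def)
  then have xD: "x \<notin> Desc" using Quniq xQ by blast
  have kx: "time (s l) < time x" using Qmin[OF xQ] time_next[OF lQ] by simp
  have "time x \<le> time (s x)" using xD xH by (simp add: Desc_def)
  then have "c (s x) \<notin> X" using x(2)[of "c (s x)"] time_next[OF xQ] by auto
  then have "time j \<le> time (c (s x))" using Qstep[OF xQ] by (auto simp: X_def)
  moreover have "time j \<noteq> time (c (s x))" using time_inj[of j "c (s x)"] jH jQ Qstep[OF xQ] QH by blast
  ultimately have jx: "time j \<le> time (s x)" using time_next[OF xQ] by simp
  define C where "C = orbit s x"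
  have CH: "C \<subseteq> H" unfolding C_def by (rule permutes_orbit_subset[OF sperm xH])
  have minC: "\<And>y. y \<in> C \<Longrightarrow> time x \<le> time y" unfolding C_def using nondescent_min[OF xH xD] .
  have jC: "j \<notin> C"
  proof
    assume "j \<in> C"
    then have "s j \<in> C" by (simp add: C_def orbit.step)
    then have "time x \<le> time (s j)" by (rule minC)
    then show False using kx l by (auto simp: L_def)
  qed
  have sxC: "s x \<in> C" by (simp add: C_def orbit.base)
  then have "s x \<noteq> j" using jC by blast
  then have "time j < time (s x)" using jx time_inj[of j "s x"] jH sxC CH by (metis le_neq_implies_less subsetD)
  \<comment> \<open>The first point of \<open>C\<close> after \<open>j\<close> is a descent whose
    image falls back before \<open>j\<close>: this is the new crossing arc.\<close>
  then have "{z \<in> C. time j < time z} \<noteq> {}" using sxC by blast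
  then obtain l' where "l' \<in> {z \<in> C. time j < time z}"
    "\<And>z. z \<in> {z \<in> C. time j < time z} \<Longrightarrow> time l' \<le> time z"
    by (rule arg_min_setE[where T = time]) (rule that)
  then have l': "l' \<in> C" "time j < time l'"
    "\<And>z. z \<in> C \<Longrightarrow> time j < time z \<Longrightarrow> time l' \<le> time z" by auto
  have l'D: "l' \<in> Desc" using nondescent_unique[OF xH _ xD, of l'] l' CH xj by (force simp: C_def)
  have sl'C: "s l' \<in> C" using l' by (simp add: C_def orbit.step)
  have "time (s l') \<le> time j" using l'(3)[OF sl'C] l'D by (force simp: Desc_def)
  moreover have "time (s l') \<noteq> time j" using time_inj[of "s l'" j] sl'C CH jC jH by blast
  ultimately have "time (s l') < time j" by simp
  moreover have kk: "time (s l) < time (s l')" using minC[OF sl'C] kx by simp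
  moreover have "time (s j) < time (s l)" using l by (simp add: L_def)
  ultimately have "l' \<in> L" using l'D l' by (auto simp: L_def)
  then show False using l(2) kk by fastforce
qed

text \<open>Crossing orbits contain crossing arcs: the first point \<open>j\<close> of the orbit of
  \<open>a\<close> after \<open>b\<close> has its image before \<open>b\<close>, and the first point
  \<open>l\<close> of the orbit of \<open>b\<close> after \<open>j\<close> has its image between
  \<open>b\<close> and \<open>j\<close>.\<close>

theorem noncrossing_orbits:
  assumes H: "a \<in> H" "b \<in> H" "x \<in> H" "d \<in> H"
    and lt: "time a < time b" "time b < time x" "time x < time d"
    and "x \<in> orbit s a" "d \<in> orbit s b"
  shows "b \<in> orbit s a"
proof (rule ccontr)
  assume ba: "b \<notin> orbit s a"
  have disj: "u \<noteq> v" if "u \<in> orbit s a" "v \<in> orbit s b" for u v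
    using that ba permutes_orbit_eq[OF sperm fin] permutes_orbit_self[OF sperm fin] by metis
  have aH: "orbit s a \<subseteq> H" and bH: "orbit s b \<subseteq> H" using permutes_orbit_subset[OF sperm] H by auto
  have self: "a \<in> orbit s a" "b \<in> orbit s b" using permutes_orbit_self[OF sperm fin] by auto
  have "{z \<in> orbit s a. time b < time z} \<noteq> {}" using assms by blast
  then obtain j where "j \<in> {z \<in> orbit s a. time b < time z}"
    "\<And>z. z \<in> {z \<in> orbit s a. time b < time z} \<Longrightarrow> time j \<le> time z"
    by (rule arg_min_setE[where T = time]) (rule that)
  then have j: "j \<in> orbit s a" "time b < time j"
    "\<And>z. z \<in> orbit s a \<Longrightarrow> time b < time z \<Longrightarrow> time j \<le> time z" by auto
  have jx: "time j \<le> time x" using j(3) assms by blast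
  have "{z \<in> orbit s b. time j < time z} \<noteq> {}" using jx assms by fastforce
  then obtain l where "l \<in> {z \<in> orbit s b. time j < time z}"
    "\<And>z. z \<in> {z \<in> orbit s b. time j < time z} \<Longrightarrow> time l \<le> time z"
    by (rule arg_min_setE[where T = time]) (rule that)
  then have l: "l \<in> orbit s b" "time j < time l"
    "\<And>z. z \<in> orbit s b \<Longrightarrow> time j < time z \<Longrightarrow> time l \<le> time z" by auto
  have jo: "orbit s j = orbit s a" and lo: "orbit s l = orbit s b"
    using permutes_orbit_eq[OF sperm fin] j l by auto
  have jD: "j \<in> Desc" using nondescent_min[of j a] j lt self jo aH by fastforce
  have lD: "l \<in> Desc" using nondescent_min[of l b] j l self lo bH by fastforce
  have sj: "s j \<in> orbit s a" and sl: "s l \<in> orbit s b" using j l by (auto intro: orbit.step)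
  have "time (s j) \<le> time b" using j(3)[OF sj] jD by (force simp: Desc_def)
  moreover have "time (s j) \<noteq> time b" using disj[OF sj self(2)] time_inj sj aH H by blast
  ultimately have 1: "time (s j) < time b" by simp
  have 2: "time b \<le> time (s l)" using descent_next[OF lD, of b] lo self j l by fastforce
  have "time (s l) \<le> time j" using l(3)[OF sl] lD by (force simp: Desc_def)
  moreover have "time (s l) \<noteq> time j" using disj[OF j(1) sl] time_inj sl bH aH j(1) by (metis subsetD)
  ultimately show False using noncrossing_arcs[OF jD lD] 1 2 l by linarith
qed

end

section \<open>First return maps\<close>

lemma first_return_spec:
  assumes "p permutes H" "finite H" "x \<in> S"
  obtains k where "0 < k" "first_return p S x = (p ^^ k) x" "(p ^^ k) x \<in> S"
    "\<And>i. 0 < i \<Longrightarrow> i < k \<Longrightarrow> (p ^^ i) x \<notin> S"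
proof -
  define P where "P k \<longleftrightarrow> 0 < k \<and> (p ^^ k) x \<in> S" for k
  have "x \<in> orbit p x" by (rule permutes_orbit_self[OF assms(1,2)])
  then obtain n where "0 < n" "(p ^^ n) x = x" unfolding orbit_altdef by auto
  then have "P n" using assms by (simp add: P_def)
  then have "P (LEAST k. P k)" by (rule LeastI)
  moreover have "first_return p S x = (p ^^ (LEAST k. P k)) x"
    using assms by (simp add: first_return_def P_def)
  moreover have "\<not> P i" if "i < (LEAST k. P k)" for i using not_less_Least[OF that] .
  ultimately show thesis using that[of "LEAST k. P k"] by (auto simp: P_def)
qed

lemma first_return_eq:
  assumes "x \<in> S" "0 < k" "(p ^^ k) x \<in> S" "\<And>i. 0 < i \<Longrightarrow> i < k \<Longrightarrow> (p ^^ i) x \<notin> S"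
  shows "first_return p S x = (p ^^ k) x"
proof -
  have "(LEAST k. 0 < k \<and> (p ^^ k) x \<in> S) = k"
    by (rule Least_equality) (use assms in \<open>auto simp: not_less[symmetric]\<close>)
  then show ?thesis using assms by (simp add: first_return_def)
qed

lemma first_return_step: "x \<in> S \<Longrightarrow> p x \<in> S \<Longrightarrow> first_return p S x = p x"
  using first_return_eq[of x S 1 p] by simp

lemma first_return_notin: "x \<notin> S \<Longrightarrow> first_return p S x = x"
  by (simp add: first_return_def)

lemma first_return_in:
  assumes "p permutes H" "finite H" "x \<in> S"
  shows "first_return p S x \<in> S"
  by (rule first_return_spec[OF assms]) simp

lemma first_return_in_orbit:
  assumes "p permutes H" "finite H" "x \<in> S"
  shows "first_return p S x \<in> orbit p x"
  by (rule first_return_spec[OF assms]) (auto simp: orbit_altdef)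

lemma first_return_inj:
  assumes p: "p permutes H" "finite H" and x: "x \<in> S" and y: "y \<in> S"
    and eq: "first_return p S x = first_return p S y"
  shows "x = y"
proof -
  \<comment> \<open>Cancelling \<open>p ^^ k\<close> gives \<open>u = (p ^^ (l - k)) v\<close>, a
    return of \<open>v\<close> to \<open>S\<close> before step \<open>l\<close> unless
    \<open>k = l\<close>.\<close>
  have *: "u = v" if u: "u \<in> S" and v: "v \<in> S" and k: "0 < k" "k \<le> l"
    and e: "(p ^^ k) u = (p ^^ l) v" and m: "\<And>i. 0 < i \<Longrightarrow> i < l \<Longrightarrow> (p ^^ i) v \<notin> S" for u v k l
  proof -
    have "(p ^^ k) u = (p ^^ k) ((p ^^ (l - k)) v)"
      using e k by (simp flip: funpow_add[THEN fun_cong, unfolded comp_def])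
    then have "u = (p ^^ (l - k)) v"
      using inj_fn[OF permutes_inj[OF p(1)], of k] by (simp add: inj_eq)
    then show ?thesis using m[of "l - k"] k u by (cases "l = k") auto
  qed
  obtain k where k: "0 < k" "first_return p S x = (p ^^ k) x"
    "\<And>i. 0 < i \<Longrightarrow> i < k \<Longrightarrow> (p ^^ i) x \<notin> S" by (rule first_return_spec[OF p x]) (rule that)
  obtain l where l: "0 < l" "first_return p S y = (p ^^ l) y"
    "\<And>i. 0 < i \<Longrightarrow> i < l \<Longrightarrow> (p ^^ i) y \<notin> S" by (rule first_return_spec[OF p y]) (rule that)
  show ?thesis
  proof (cases "k \<le> l")
    case True
    then show ?thesis using *[OF x y k(1) True _ l(3)] k l eq by metis
  next
    case False
    then have "l \<le> k" by simp
    then show ?thesis using *[OF y x l(1) _ _ k(3)] k l eq by metis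
  qed
qed

lemma first_return_permutes:
  assumes p: "p permutes H" "finite H" and S: "S \<subseteq> H"
  shows "first_return p S permutes S"
proof (rule bij_imp_permutes)
  have "inj_on (first_return p S) S"
    by (rule inj_onI) (rule first_return_inj[OF p])
  moreover have "first_return p S ` S \<subseteq> S" using first_return_in[OF p] by blast
  ultimately show "bij_betw (first_return p S) S S"
    using endo_inj_surj[OF finite_subset[OF S p(2)]] by (simp add: bij_betw_def)
qed (rule first_return_notin)

lemma orbit_first_return:
  assumes p: "p permutes H" "finite H" and x: "x \<in> S"
  shows "orbit (first_return p S) x = orbit p x \<inter> S"
proof
  show "orbit (first_return p S) x \<subseteq> orbit p x \<inter> S"
  proof
    fix y assume "y \<in> orbit (first_return p S) x"
    then show "y \<in> orbit p x \<inter> S"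
    proof induct
      case base
      then show ?case using first_return_in[OF p x] first_return_in_orbit[OF p x] by blast
    next
      case (step y)
      then have y: "y \<in> orbit p x" "y \<in> S" by auto
      then show ?case using first_return_in[OF p y(2)] orbit_trans[OF first_return_in_orbit[OF p y(2)]] by blast
    qed
  qed
  have "y \<in> orbit (first_return p S) x" if "0 < k" "(p ^^ k) x = y" "y \<in> S" for k y
    using that x
  proof (induction k arbitrary: x rule: less_induct)
    case (less k)
    obtain l where l: "0 < l" "first_return p S x = (p ^^ l) x"
      "\<And>i. 0 < i \<Longrightarrow> i < l \<Longrightarrow> (p ^^ i) x \<notin> S" by (rule first_return_spec[OF p less.prems(4)]) (rule that)
    have "l \<le> k" using l(3)[of k] less.prems by (meson leI)
    show ?case
    proof (cases "l = k")
      case True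
      then show ?thesis using l(2) less.prems orbit.base[of "first_return p S" x] by simp
    next
      case False
      have "(p ^^ (k - l)) (first_return p S x) = (p ^^ (k - l + l)) x"
        unfolding l(2) by (simp add: funpow_add)
      also have "\<dots> = y" using \<open>l \<le> k\<close> less.prems by simp
      finally have "y \<in> orbit (first_return p S) (first_return p S x)"
        using less.IH[of "k - l" "first_return p S x"] False \<open>l \<le> k\<close> l(1) less.prems
          first_return_in[OF p less.prems(4)] by simp
      then show ?thesis by (rule orbit_subset)
    qed
  qed
  then show "orbit p x \<inter> S \<subseteq> orbit (first_return p S) x" by (auto simp: orbit_altdef[of p x])
qed

lemma card_orbits_first_return:
  assumes p: "p permutes H" "finite H" and S: "S \<subseteq> H"
    and meet: "\<And>Q. Q \<in> orbits p H \<Longrightarrow> Q \<inter> S \<noteq> {}"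
  shows "card (orbits (first_return p S) S) = card (orbits p H)"
proof -
  have "orbits (first_return p S) S = (\<lambda>Q. Q \<inter> S) ` orbits p H"
  proof
    show "orbits (first_return p S) S \<subseteq> (\<lambda>Q. Q \<inter> S) ` orbits p H"
    proof
      fix Q assume "Q \<in> orbits (first_return p S) S"
      then obtain x where x: "x \<in> S" "Q = orbit (first_return p S) x" by (auto simp: orbits_def)
      then have "Q = orbit p x \<inter> S" using orbit_first_return[OF p x(1)] by simp
      then show "Q \<in> (\<lambda>Q. Q \<inter> S) ` orbits p H" using x(1) S by (auto simp: orbits_def)
    qed
    show "(\<lambda>Q. Q \<inter> S) ` orbits p H \<subseteq> orbits (first_return p S) S"
    proof clarify
      fix Q assume Q: "Q \<in> orbits p H"
      then obtain z where z: "z \<in> Q" "z \<in> S" using meet by blast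
      have "Q = orbit p z" using Q z permutes_orbit_eq[OF p] unfolding orbits_def by auto
      then show "Q \<inter> S \<in> orbits (first_return p S) S"
        using orbit_first_return[OF p z(2)] z by (auto simp: orbits_def)
    qed
  qed
  moreover have "inj_on (\<lambda>Q. Q \<inter> S) (orbits p H)"
  proof (rule inj_onI)
    fix P Q assume PQ: "P \<in> orbits p H" "Q \<in> orbits p H" "P \<inter> S = Q \<inter> S"
    then obtain z where "z \<in> P" "z \<in> Q" using meet by blast
    then show "P = Q" using orbits_Int_disjoint[OF p PQ(1,2)] by blast
  qed
  ultimately show ?thesis by (simp add: card_image)
qed

text \<open>With \<open>p\<close> the rotation and \<open>a\<close> the edge flips of a tree, the tour restricted to the tree
  is the tour of the submap.\<close>

lemma first_return_comp:
  assumes p: "p permutes H" "finite H"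
    and c: "\<And>z. c z = p (a z)"
    and x: "x \<in> S" and a: "a x \<in> S" "\<And>z. z \<notin> S \<Longrightarrow> a z = z"
  shows "first_return c S x = first_return p S (a x)"
proof -
  obtain k where k: "0 < k" "first_return p S (a x) = (p ^^ k) (a x)" "(p ^^ k) (a x) \<in> S"
    "\<And>i. 0 < i \<Longrightarrow> i < k \<Longrightarrow> (p ^^ i) (a x) \<notin> S" by (rule first_return_spec[OF p a(1)]) (rule that)
  have eq: "(c ^^ i) x = (p ^^ i) (a x)" if "0 < i" "i \<le> k" for i
    using that
  proof (induction i)
    case (Suc i)
    show ?case
    proof (cases "i = 0")
      case False
      have "(c ^^ i) x = (p ^^ i) (a x)" by (rule Suc.IH) (use False Suc.prems in auto)
      moreover have "(p ^^ i) (a x) \<notin> S" by (rule k(4)) (use False Suc.prems in auto)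
      ultimately show ?thesis using a(2) c[of "(c ^^ i) x"] by simp
    qed (simp add: c)
  qed simp
  have "first_return c S x = (c ^^ k) x"
    by (rule first_return_eq[OF x k(1)]) (use eq k in auto)
  then show ?thesis using eq[of k] k by simp
qed

section \<open>Involutions\<close>

lemma orbit_involution:
  assumes "a (a x) = x"
  shows "orbit a x = {x, a x}"
proof
  show "orbit a x \<subseteq> {x, a x}"
  proof
    fix y assume "y \<in> orbit a x"
    then show "y \<in> {x, a x}" using assms by induct auto
  qed
  show "{x, a x} \<subseteq> orbit a x" using assms orbit.base[of a x] orbit.step[of "a x" a x] by simp
qed

text \<open>\<open>Y\<close> holds exactly one point of each two-point orbit and no fixed point, so
  \<open>H - Y\<close> is a system of representatives of the orbits.\<close>

lemma card_orbits_involution: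
  assumes "finite H" "\<And>x. x \<in> H \<Longrightarrow> a x \<in> H \<and> a (a x) = x"
    and Y: "Y \<subseteq> H" "\<And>y. y \<in> Y \<Longrightarrow> a y \<notin> Y" "\<And>x. x \<in> H - Y \<Longrightarrow> a x = x \<or> a x \<in> Y"
  shows "card (orbits a H) + card Y = card H"
proof -
  have o: "orbit a x = {x, a x}" if "x \<in> H" for x using that assms orbit_involution[of a x] by blast
  have "orbits a H = orbit a ` (H - Y)"
  proof
    show "orbits a H \<subseteq> orbit a ` (H - Y)"
    proof
      fix Q assume "Q \<in> orbits a H"
      then obtain x where x: "x \<in> H" "Q = orbit a x" by (auto simp: orbits_def)
      show "Q \<in> orbit a ` (H - Y)"
      proof (cases "x \<in> Y")
        case True
        then have "a x \<in> H - Y" "Q = orbit a (a x)" using x assms(2)[of x] Y o by auto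
        then show ?thesis by blast
      qed (use x in blast)
    qed
  qed (auto simp: orbits_def)
  moreover have "inj_on (orbit a) (H - Y)"
  proof (rule inj_onI)
    fix x y assume xy: "x \<in> H - Y" "y \<in> H - Y" "orbit a x = orbit a y"
    then have "x = y \<or> x = a y" using o[of x] o[of y] by auto
    then show "x = y" using xy Y(3)[OF xy(2)] by auto
  qed
  ultimately have "card (orbits a H) = card (H - Y)" by (simp add: card_image)
  then show ?thesis using Y(1) assms(1) by (simp add: card_Diff_subset finite_subset card_mono)
qed

lemma card_pairs_involution:
  assumes "finite X" "\<And>x. x \<in> X \<Longrightarrow> a x \<in> X \<and> a (a x) = x"
    and Y: "Y \<subseteq> X" "\<And>x. x \<in> X \<Longrightarrow> a x \<in> Y \<longleftrightarrow> x \<notin> Y"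
  shows "card ((\<lambda>x. {x, a x}) ` X) = card Y" "card X = 2 * card Y"
proof -
  have "orbits a X = (\<lambda>x. {x, a x}) ` X"
    unfolding orbits_def by (rule image_cong) (use assms orbit_involution[of a] in auto)
  moreover have 1: "card (orbits a X) + card Y = card X"
    by (rule card_orbits_involution) (use assms in auto)
  have "a ` Y = X - Y"
  proof
    show "X - Y \<subseteq> a ` Y" using assms by (metis DiffE image_eqI subsetI)
  qed (use assms in auto)
  moreover have "inj_on a Y" by (rule inj_on_inverseI[of _ a]) (use assms in auto)
  ultimately have 2: "card (X - Y) = card Y" using card_image by metis
  moreover have "card (X - Y) + card Y = card X"
    using Y(1) assms(1) by (simp add: card_Diff_subset finite_subset card_mono)
  ultimately show "card X = 2 * card Y" by simp
  then show "card ((\<lambda>x. {x, a x}) ` X) = card Y" using 1 \<open>orbits a X = _\<close> by simp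
qed

text \<open>The choice is made from the unordered pair \<open>{x, a x}\<close>, hence is the same
  for both of its points.\<close>

lemma involution_representatives:
  assumes "\<And>x. x \<in> X \<Longrightarrow> a x \<in> X \<and> a (a x) = x \<and> a x \<noteq> x"
  obtains Y where "Y \<subseteq> X" "\<And>x. x \<in> X \<Longrightarrow> a x \<in> Y \<longleftrightarrow> x \<notin> Y"
proof
  define rep where "rep P = (SOME y. y \<in> P)" for P :: "'a set"
  define Y where "Y = {x \<in> X. rep {x, a x} = x}"
  show "Y \<subseteq> X" by (auto simp: Y_def)
  fix x assume x: "x \<in> X"
  have e: "{a x, a (a x)} = {x, a x}" using assms[OF x] by auto
  have "rep {x, a x} \<in> {x, a x}" unfolding rep_def by (rule someI[of _ x]) simp
  then show "a x \<in> Y \<longleftrightarrow> x \<notin> Y" using assms[OF x] x unfolding Y_def mem_Collect_eq e by auto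
qed

lemma card_pairs_free_involution:
  assumes "finite X" "\<And>x. x \<in> X \<Longrightarrow> a x \<in> X \<and> a (a x) = x \<and> a x \<noteq> x"
  shows "card X = 2 * card ((\<lambda>x. {x, a x}) ` X)"
proof -
  obtain Y where Y: "Y \<subseteq> X" "\<And>x. x \<in> X \<Longrightarrow> a x \<in> Y \<longleftrightarrow> x \<notin> Y"
    by (rule involution_representatives[of X a, OF assms(2)]) (auto intro: that)
  show ?thesis using card_pairs_involution[of X a Y] assms Y by auto
qed

section \<open>Transport along bijections\<close>

lemma transport_funpow:
  assumes "p permutes H" "\<And>x. x \<in> H \<Longrightarrow> g (p x) = q (g x)" "x \<in> H"
  shows "g ((p ^^ k) x) = (q ^^ k) (g x)"
proof (induction k)
  case (Suc k)
  then show ?case using assms permutes_funpow_in[OF assms(1,3), of k] by simp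
qed simp

lemma transport_orbit:
  assumes "p permutes H" "finite H" "\<And>x. x \<in> H \<Longrightarrow> g (p x) = q (g x)" "x \<in> H"
  shows "g ` orbit p x = orbit q (g x)"
proof (rule orbit_inverse)
  show "x \<in> orbit p x" by (rule permutes_orbit_self[OF assms(1,2)])
  fix y assume "y \<in> orbit p x"
  then show "q (g y) = g (p y)" using permutes_orbit_subset[OF assms(1,4)] assms(3) by force
qed

lemma transport_orbits:
  assumes "p permutes H" "finite H" "\<And>x. x \<in> H \<Longrightarrow> g (p x) = q (g x)"
  shows "orbits q (g ` H) = (`) g ` orbits p H"
proof -
  have "g ` orbit p x = orbit q (g x)" if "x \<in> H" for x
    by (rule transport_orbit[where H = H and q = q]) (use assms that in auto)
  then show ?thesis by (auto simp: orbits_def image_image)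
qed

lemma card_transport_orbits:
  assumes "p permutes H" "finite H" "\<And>x. x \<in> H \<Longrightarrow> g (p x) = q (g x)" "inj_on g H"
  shows "card (orbits q (g ` H)) = card (orbits p H)"
proof -
  have "inj_on ((`) g) (orbits p H)"
  proof (rule inj_on_image)
    have "\<Union> (orbits p H) \<subseteq> H" unfolding orbits_def using permutes_orbit_subset[OF assms(1)] by blast
    then show "inj_on g (\<Union> (orbits p H))" using assms(4) inj_on_subset by blast
  qed
  moreover have "orbits q (g ` H) = (`) g ` orbits p H"
    by (rule transport_orbits) (use assms in auto)
  ultimately show ?thesis by (simp add: card_image)
qed

lemma transport_first_return:
  assumes "p permutes H" "\<And>x. x \<in> H \<Longrightarrow> g (p x) = q (g x)" "inj_on g H" "S \<subseteq> H" "x \<in> H"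
  shows "g (first_return p S x) = first_return q (g ` S) (g x)"
proof -
  have 1: "g ((p ^^ k) x) = (q ^^ k) (g x)" for k
    by (rule transport_funpow[where H = H and q = q]) (use assms in auto)
  have "(q ^^ k) (g x) \<in> g ` S \<longleftrightarrow> (p ^^ k) x \<in> S" for k
    using inj_on_image_mem_iff[OF assms(3) permutes_funpow_in[OF assms(1,5)] assms(4)] 1 by simp
  moreover have "g x \<in> g ` S \<longleftrightarrow> x \<in> S" by (rule inj_on_image_mem_iff[OF assms(3,5,4)])
  ultimately show ?thesis unfolding first_return_def using 1 by auto
qed

section \<open>The tour of a tree-rooted map\<close>

lemma planar_mapD:
  assumes "planar_map M"
  shows "finite (half_edges M)" "root_he M \<in> half_edges M"
    "rot M permutes half_edges M" "opp M permutes half_edges M"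
    "\<And>x. opp M (opp M x) = x"
    "\<And>x. x \<in> half_edges M \<Longrightarrow> opp M x = x \<longleftrightarrow> x = root_he M"
    "opp M (root_he M) = root_he M"
    "\<And>x. opp M x \<in> half_edges M \<longleftrightarrow> x \<in> half_edges M"
    "card (vertices M) + card (faces M) = card (edges M) + 2"
    "vertices M = orbits (rot M) (half_edges M)"
    "faces M = orbits (rot M \<circ> opp M) (half_edges M)"
    "connected_map M"
    "card (half_edges M) = Suc (2 * card (edges M))"
proof -
  show *: "finite (half_edges M)" "root_he M \<in> half_edges M"
    "rot M permutes half_edges M" "opp M permutes half_edges M"
    "\<And>x. x \<in> half_edges M \<Longrightarrow> opp M x = x \<longleftrightarrow> x = root_he M"
    "opp M (root_he M) = root_he M" "connected_map M"
    "card (vertices M) + card (faces M) = card (edges M) + 2"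
    using assms unfolding planar_map_def by auto
  show invol: "opp M (opp M x) = x" for x
    using assms permutes_not_in[OF *(4)] unfolding planar_map_def by (cases "x \<in> half_edges M") auto
  show inH: "opp M x \<in> half_edges M \<longleftrightarrow> x \<in> half_edges M" for x by (rule permutes_in_image[OF *(4)])
  show "vertices M = orbits (rot M) (half_edges M)" by (auto simp: vertices_def orbits_def vertex_of_def)
  show "faces M = orbits (rot M \<circ> opp M) (half_edges M)" by (simp add: faces_def orbits_def)
  have "card (half_edges M - {root_he M}) = 2 * card (edges M)"
    unfolding edges_def
  proof (rule card_pairs_free_involution)
    fix x assume x: "x \<in> half_edges M - {root_he M}"
    then have "opp M x \<noteq> root_he M" using invol[of x] *(6) by force
    then show "opp M x \<in> half_edges M - {root_he M} \<and> opp M (opp M x) = x \<and> opp M x \<noteq> x"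
      using x invol[of x] *(5)[of x] inH by auto
  qed (use * in auto)
  then show "card (half_edges M) = Suc (2 * card (edges M))"
    using card_Suc_Diff1[OF *(1,2)] by simp
qed

definition tree_flip :: "('h, 'z) rmap_scheme \<Rightarrow> 'h set \<Rightarrow> 'h \<Rightarrow> 'h" where
  "tree_flip M S x = (if x \<in> S then opp M x else x)"

locale tree_map =
  fixes M :: "'h tree_rmap"
  assumes tree_rooted: "tree_rooted_map M"
begin

lemma planar: "planar_map M"
  using tree_rooted by (simp add: tree_rooted_map_def)

lemmas M = planar_mapD[OF planar]

lemma tree_sub: "tree M \<subseteq> half_edges M" and root_notin_tree: "root_he M \<notin> tree M"
  using tree_rooted by (auto simp: tree_rooted_map_def spanning_tree_def)

lemma opp_tree: "opp M x \<in> tree M \<longleftrightarrow> x \<in> tree M"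
proof -
  have "opp M ` tree M = tree M" using tree_rooted by (auto simp: tree_rooted_map_def spanning_tree_def)
  then show ?thesis using M(5) by (metis image_eqI)
qed

abbreviation "flip \<equiv> tree_flip M (tree M)"
abbreviation "tour \<equiv> tour_step M (tree M)"
abbreviation "core \<equiv> insert (root_he M) (tree M)"

lemma flip_flip: "flip (flip x) = x"
  by (simp add: tree_flip_def opp_tree M(5))

lemma flip_in: "flip x \<in> half_edges M \<longleftrightarrow> x \<in> half_edges M"
  by (simp add: tree_flip_def M(8))

lemma flip_permutes: "flip permutes half_edges M"
proof (rule bij_imp_permutes)
  show "bij_betw flip (half_edges M) (half_edges M)"
    by (rule bij_betw_byWitness[of _ flip]) (use flip_flip flip_in in auto)
  show "flip x = x" if "x \<notin> half_edges M" for x using that tree_sub by (auto simp: tree_flip_def)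
qed

lemma tour_eq: "tour x = rot M (flip x)"
  by (simp add: tour_step_def tree_flip_def)

lemma tour_permutes: "tour permutes half_edges M"
proof -
  have "tour = rot M \<circ> flip" using tour_eq by auto
  then show ?thesis using permutes_compose[OF flip_permutes M(3)] by simp
qed

lemma tour_flip: "tour \<circ> flip = rot M"
  using tour_eq flip_flip by auto

lemma core_sub: "core \<subseteq> half_edges M" using tree_sub M(2) by simp

lemma core_meets: "Q \<in> vertices M \<Longrightarrow> Q \<inter> core \<noteq> {}"
  using tree_rooted by (auto simp: tree_rooted_map_def spanning_tree_def)

lemma plane_submap: "plane_tree (submap M (tree M))"
  using tree_rooted by (auto simp: tree_rooted_map_def spanning_tree_def)

lemma flip_core: "x \<in> core \<Longrightarrow> flip x \<in> core"
  by (auto simp: tree_flip_def opp_tree)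

lemma flip_notin: "z \<notin> core \<Longrightarrow> flip z = z"
  by (simp add: tree_flip_def)

lemma first_return_tour:
  "x \<in> core \<Longrightarrow> first_return tour core x = first_return (rot M) core (flip x)"
  by (rule first_return_comp[OF M(3,1) tour_eq]) (assumption, erule flip_core, erule flip_notin)

text \<open>The tour, observed only at the half-edges of the submap, is the face permutation of the
  submap, which has a single face.\<close>

lemma core_orbit: "core \<subseteq> orbit tour (root_he M)"
proof -
  let ?N = "submap M (tree M)"
  have N: "card (faces ?N) = 1" "half_edges ?N = core" using plane_submap
    by (auto simp: plane_tree_def submap_def)
  have eq: "(rot ?N \<circ> opp ?N) x = first_return tour core x" if "x \<in> core" for x
    using first_return_tour[OF that] by (simp add: submap_def tree_flip_def)
  have o: "orbit (rot ?N \<circ> opp ?N) x = orbit tour x \<inter> core" if x: "x \<in> core" for x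
  proof -
    have "orbit (first_return tour core) x = orbit (rot ?N \<circ> opp ?N) x"
    proof (rule orbit_cong0[OF x])
      show "first_return tour core \<in> core \<rightarrow> core" using first_return_in[OF tour_permutes M(1)] by blast
      show "\<And>y. y \<in> core \<Longrightarrow> first_return tour core y = (rot ?N \<circ> opp ?N) y" using eq by simp
    qed
    then show ?thesis using orbit_first_return[OF tour_permutes M(1) x] by simp
  qed
  obtain F where F: "faces ?N = {F}" using N(1) card_1_singletonE by blast
  have all: "orbit tour x \<inter> core = F" if "x \<in> core" for x
    using o[OF that] F N(2) that unfolding faces_def by auto
  have "x \<in> orbit tour (root_he M)" if "x \<in> core" for x
    using all[OF that] all[of "root_he M"] permutes_orbit_self[OF tour_permutes M(1), of x] that by blast
  then show ?thesis by blast
qed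

text \<open>Since the tree spans, every half-edge is reached by \<open>rot\<close> from one of
  \<open>core\<close>. A step of \<open>rot\<close> is a flip followed by a step of the tour, and a
  flip either fixes its argument or stays within \<open>core\<close>.\<close>

lemma tour_full: "half_edges M \<subseteq> orbit tour (root_he M)"
proof
  fix x assume x: "x \<in> half_edges M"
  then have "orbit (rot M) x \<in> vertices M" by (auto simp: M(10) orbits_def)
  then obtain y where y: "y \<in> orbit (rot M) x" "y \<in> core" using core_meets by blast
  have "x \<in> orbit (rot M) y" using y permutes_orbit_eq[OF M(3,1)] permutes_orbit_self[OF M(3,1)] by blast
  then obtain k where k: "(rot M ^^ k) y = x" using permutes_orbit_funpow[OF M(3,1)] by blast
  have "(rot M ^^ k) y \<in> orbit tour (root_he M)"
  proof (induction k)
    case 0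
    then show ?case using y core_orbit by auto
  next
    case (Suc k)
    let ?z = "(rot M ^^ k) y"
    have "flip ?z \<in> orbit tour (root_he M)"
      using Suc flip_core[of ?z] flip_notin[of ?z] core_orbit by (cases "?z \<in> core") auto
    then have "tour (flip ?z) \<in> orbit tour (root_he M)" by (rule orbit.step)
    then show ?case using flip_flip[of ?z] tour_eq[of "flip ?z"] by simp
  qed
  then show "x \<in> orbit tour (root_he M)" using k by simp
qed

sublocale T: full_cycle_perm "half_edges M" tour "root_he M" flip
  by unfold_locales (use M(1,2) tour_permutes tour_full flip_permutes in auto)

lemma time_eq: "tour_time M (tree M) x = T.time x"
  by (simp add: tour_time_def T.time_def)

lemma Desc_iff: "x \<in> T.Desc \<longleftrightarrow> x \<in> tree M \<and> T.time (opp M x) < T.time x"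
  using tree_sub by (auto simp: T.Desc_def tree_flip_def)

lemma opp_neq: "x \<in> half_edges M \<Longrightarrow> x \<noteq> root_he M \<Longrightarrow> opp M x \<noteq> x"
  using M(6) by simp

lemma opp_Desc: "x \<in> tree M \<Longrightarrow> opp M x \<in> T.Desc \<longleftrightarrow> x \<notin> T.Desc"
  using T.time_inj[of x "opp M x"] tree_sub M(8) opp_neq root_notin_tree opp_tree M(5)
  unfolding Desc_iff by (metis linorder_neqE_nat order_less_asym subsetD)

text \<open>Euler's relation for the submap with its single face gives one vertex more than edges;
  the submap has a vertex for each vertex of \<open>M\<close>, and \<open>Desc\<close> holds one
  half of each tree edge.\<close>

lemma card_vertices: "card (vertices M) = Suc (card T.Desc)"
proof -
  let ?N = "submap M (tree M)"
  have "card (vertices ?N) + card (faces ?N) = card (edges ?N) + 2" "card (faces ?N) = 1"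
    using plane_submap by (auto simp: plane_tree_def planar_map_def)
  moreover have "card (vertices ?N) = card (vertices M)"
  proof -
    have "vertices ?N = orbits (first_return (rot M) core) core"
      by (auto simp: vertices_def orbits_def vertex_of_def submap_def)
    then show ?thesis
      using card_orbits_first_return[OF M(3,1) core_sub] core_meets by (simp add: M(10))
  qed
  moreover have "card (edges ?N) = card T.Desc"
  proof -
    have "edges ?N = (\<lambda>x. {x, opp M x}) ` tree M"
      unfolding edges_def by (rule image_cong) (use root_notin_tree in \<open>auto simp: submap_def\<close>)
    also have "card \<dots> = card T.Desc"
      by (rule card_pairs_involution) (use opp_tree M(5) opp_Desc Desc_iff finite_subset[OF tree_sub M(1)] in auto)
    finally show ?thesis .
  qed
  ultimately show ?thesis by simp
qed

lemma card_flip_orbits: "card (orbits flip (half_edges M)) + card T.Desc = card (half_edges M)"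
proof (rule card_orbits_involution[OF M(1)])
  show "flip x \<in> half_edges M \<and> flip (flip x) = x" if "x \<in> half_edges M" for x
    using that by (simp add: flip_in flip_flip)
  show "T.Desc \<subseteq> half_edges M" using T.Desc_H by blast
  show "flip y \<notin> T.Desc" if "y \<in> T.Desc" for y
    using that opp_Desc[of y] Desc_iff by (auto simp: tree_flip_def)
  show "flip x = x \<or> flip x \<in> T.Desc" if "x \<in> half_edges M - T.Desc" for x
    using that opp_Desc[of x] by (auto simp: tree_flip_def)
qed

text \<open>The vertices of \<open>M\<close> are the orbits of \<open>tour \<circ> flip\<close>; in
  the sum with the orbits of \<open>flip\<close> the number of descents cancels.\<close>

sublocale T: genus_zero "half_edges M" tour "root_he M" flip
  by unfold_locales (use card_vertices card_flip_orbits in \<open>simp add: tour_flip M(10)\<close>)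

section \<open>Heads of the oriented map\<close>

abbreviation "vx \<equiv> orbit (rot M)"
abbreviation "root_vx \<equiv> vx (root_he M)"

text \<open>\<open>T.desc_of Q\<close> is the half-edge at \<open>Q\<close> of the tree edge towards
  the root, so its opposite lies at the parent. The value at the root vertex is arbitrary;
  \<open>level\<close> stops at the first arrival there.\<close>

definition parent where "parent Q = vx (opp M (T.desc_of Q))"

definition level where "level Q = (LEAST k. (parent ^^ k) Q = root_vx)"

lemma vx_eq: "y \<in> vx x \<Longrightarrow> vx y = vx x"
  by (rule permutes_orbit_eq[OF M(3,1)])

lemma vx_self: "x \<in> vx x"
  by (rule permutes_orbit_self[OF M(3,1)])

lemma desc_of_vertex:
  assumes "x \<in> half_edges M" "vx x \<noteq> root_vx"
  shows "T.desc_of (vx x) \<in> vx x" "T.desc_of (vx x) \<in> T.Desc"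
proof -
  have "vx x \<in> orbits (tour \<circ> flip) (half_edges M)" "root_he M \<notin> vx x"
    using assms vx_eq by (auto simp: tour_flip orbits_def)
  then show "T.desc_of (vx x) \<in> vx x" "T.desc_of (vx x) \<in> T.Desc" by (rule T.desc_of)+
qed

text \<open>The tour enters the vertex of \<open>j\<close> along the edge from
  \<open>opp M j\<close>, and the half-edge that comes next, \<open>rot M j\<close>, is the earliest
  one of that vertex.\<close>

lemma desc_vertex:
  assumes "j \<in> T.Desc"
  shows "vx j \<noteq> root_vx" "T.desc_of (vx j) = j" "\<And>y. y \<in> vx j \<Longrightarrow> T.time (opp M j) < T.time y"
proof -
  note d = T.descent_in_orbit[OF assms, unfolded tour_flip]
  have jH: "j \<in> half_edges M" using assms T.Desc_H by blast
  show ne: "vx j \<noteq> root_vx" using d(1) vx_self[of "root_he M"] by auto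
  show "T.desc_of (vx j) = j" using desc_of_vertex[OF jH ne] d(3) by blast
  fix y assume y: "y \<in> vx j"
  have "rot M j \<noteq> root_he M" using d(1) orbit.base[of "rot M" j] by auto
  then have "T.time (tour (flip j)) = Suc (T.time (flip j))"
    using T.time_step[of "flip j"] jH flip_in flip_flip tour_eq by simp
  moreover have "flip j = opp M j" using assms Desc_iff by (simp add: tree_flip_def)
  ultimately show "T.time (opp M j) < T.time y" using d(2)[OF y] by simp
qed

lemma parent_desc: "j \<in> T.Desc \<Longrightarrow> parent (vx j) = vx (opp M j)"
  by (simp add: parent_def desc_vertex)

lemma level_root: "level root_vx = 0"
  by (simp add: level_def)

lemma level_desc:
  assumes "j \<in> T.Desc"
  shows "level (vx j) = Suc (level (vx (opp M j)))"
proof -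
  \<comment> \<open>The parent is met earlier, at \<open>opp M j\<close>, so iterating
    \<open>parent\<close> ends at the root vertex.\<close>
  have ex: "\<exists>k. (parent ^^ k) (vx x) = root_vx" if "x \<in> half_edges M" for x
    using that
  proof (induction "T.time x" arbitrary: x rule: less_induct)
    case less
    show ?case
    proof (cases "vx x = root_vx")
      case True
      then show ?thesis by (intro exI[of _ 0]) simp
    next
      case False
      define j where "j = T.desc_of (vx x)"
      have j: "j \<in> T.Desc" "vx j = vx x" using desc_of_vertex[OF less.prems False] vx_eq by (auto simp: j_def)
      have "T.time (opp M j) < T.time x" using desc_vertex(3)[OF j(1)] j(2) vx_self by auto
      moreover have "opp M j \<in> half_edges M" using j(1) T.Desc_H M(8) by blast
      ultimately obtain k where "(parent ^^ k) (vx (opp M j)) = root_vx" using less.hyps by blast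
      then have "(parent ^^ Suc k) (vx x) = root_vx"
        using parent_desc[OF j(1)] j(2) by (simp add: funpow_Suc_right del: funpow.simps)
      then show ?thesis by blast
    qed
  qed
  have "j \<in> half_edges M" using assms T.Desc_H by blast
  then obtain k where k: "(parent ^^ k) (vx j) = root_vx" using ex by blast
  have "level (vx j) = Suc (LEAST m. (parent ^^ Suc m) (vx j) = root_vx)"
    unfolding level_def by (rule Least_Suc[where P = "\<lambda>k. (parent ^^ k) (vx j) = root_vx", OF k])
      (use desc_vertex(1)[OF assms] in simp)
  also have "\<dots> = Suc (level (vx (opp M j)))"
    using parent_desc[OF assms] by (simp add: level_def funpow_Suc_right del: funpow.simps)
  finally show ?thesis .
qed

lemma adjacent_level:
  assumes "(v, w) \<in> tree_adjacent M"
  shows "level w \<le> Suc (level v)"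
proof -
  obtain x where x: "x \<in> tree M" "v = vx x" "w = vx (opp M x)"
    using assms by (auto simp: tree_adjacent_def vertex_of_def)
  show ?thesis
  proof (cases "x \<in> T.Desc")
    case True
    then show ?thesis using level_desc[of x] x by simp
  next
    case False
    then have "opp M x \<in> T.Desc" using opp_Desc x by blast
    then show ?thesis using level_desc[of "opp M x"] x M(5) by simp
  qed
qed

text \<open>Following parents gives a path of length \<open>level\<close>; no path is shorter,
  because along a tree edge the level grows by at most one.\<close>

lemma depth_eq_level:
  assumes "x \<in> half_edges M"
  shows "depth M (vx x) = level (vx x)"
  unfolding depth_def vertex_of_def
proof (rule Least_equality)
  show "(root_vx, vx x) \<in> tree_adjacent M ^^ level (vx x)"
    using assms
  proof (induction "T.time x" arbitrary: x rule: less_induct)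
    case less
    show ?case
    proof (cases "vx x = root_vx")
      case True
      then show ?thesis by (simp add: level_root)
    next
      case False
      define j where "j = T.desc_of (vx x)"
      have j: "j \<in> T.Desc" "vx j = vx x" using desc_of_vertex[OF less.prems False] vx_eq by (auto simp: j_def)
      have "T.time (opp M j) < T.time x" using desc_vertex(3)[OF j(1)] j(2) vx_self by auto
      moreover have "opp M j \<in> half_edges M" using j(1) T.Desc_H M(8) by blast
      ultimately have "(root_vx, vx (opp M j)) \<in> tree_adjacent M ^^ level (vx (opp M j))"
        using less.hyps by blast
      moreover have "(vx (opp M j), vx j) \<in> tree_adjacent M"
        unfolding tree_adjacent_def vertex_of_def
        using j(1) Desc_iff opp_tree M(5) by (auto intro!: exI[of _ "opp M j"])
      ultimately have "(root_vx, vx j) \<in> tree_adjacent M ^^ Suc (level (vx (opp M j)))" by auto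
      then show ?thesis using level_desc[OF j(1)] j(2) by simp
    qed
  qed
  fix k assume "(root_vx, vx x) \<in> tree_adjacent M ^^ k"
  moreover have "level v \<le> k" if "(root_vx, v) \<in> tree_adjacent M ^^ k" for v
    using that
  proof (induction k arbitrary: v)
    case 0
    then show ?case using level_root by auto
  next
    case (Suc k)
    then obtain u where "(root_vx, u) \<in> tree_adjacent M ^^ k" "(u, v) \<in> tree_adjacent M" by auto
    then show ?case using Suc.IH adjacent_level by fastforce
  qed
  ultimately show "level (vx x) \<le> k" by blast
qed

text \<open>Of the two halves of a tree edge exactly one is a descent, and its vertex lies one level
  deeper; so the orientation by depth can be read off the tour times.\<close>

lemma heads_delta:
  "heads (delta M) = {root_he M} \<union> T.Desc \<union>
     {x \<in> half_edges M - tree M - {root_he M}. T.time x < T.time (opp M x)}"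
proof -
  have "depth M (vertex_of M (opp M x)) < depth M (vertex_of M x) \<longleftrightarrow> x \<in> T.Desc" if x: "x \<in> tree M" for x
  proof -
    have xH: "x \<in> half_edges M" "opp M x \<in> half_edges M" using x tree_sub M(8) by auto
    show ?thesis
    proof (cases "x \<in> T.Desc")
      case True
      then show ?thesis using level_desc[of x] depth_eq_level xH by (simp add: vertex_of_def)
    next
      case False
      then have "opp M x \<in> T.Desc" using opp_Desc x by blast
      then show ?thesis using level_desc[of "opp M x"] depth_eq_level xH False M(5) by (simp add: vertex_of_def)
    qed
  qed
  then show ?thesis using Desc_iff by (auto simp: delta_def time_eq)
qed

lemma heads_sub: "heads (delta M) \<subseteq> half_edges M"
  using heads_delta T.Desc_H M(2) by auto

lemma opp_heads:
  assumes "x \<in> half_edges M" "x \<noteq> root_he M"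
  shows "opp M x \<in> heads (delta M) \<longleftrightarrow> x \<notin> heads (delta M)"
proof (cases "x \<in> tree M")
  case True
  have "y \<in> heads (delta M) \<longleftrightarrow> y \<in> T.Desc" if "y \<in> tree M" for y
    using that root_notin_tree by (auto simp: heads_delta)
  then show ?thesis using opp_Desc[OF True] opp_tree[of x] True by simp
next
  case False
  have 1: "opp M x \<noteq> root_he M" using assms M(5)[of x] M(7) by metis
  have 2: "T.time x \<noteq> T.time (opp M x)" using T.time_inj[of x "opp M x"] assms M(8)[of x] opp_neq[of x] by simp
  have 3: "x \<notin> T.Desc" "opp M x \<notin> T.Desc" "opp M x \<notin> tree M" using False opp_tree[of x] Desc_iff by auto
  have "opp M x \<in> heads (delta M) \<longleftrightarrow> T.time (opp M x) < T.time x"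
    using 1 3 M(8)[of x] M(5)[of x] assms by (simp add: heads_delta)
  moreover have "x \<in> heads (delta M) \<longleftrightarrow> T.time x < T.time (opp M x)"
    using 3 False assms by (simp add: heads_delta)
  ultimately show ?thesis using 2 by auto
qed

lemma vertex_has_head:
  assumes "x \<in> half_edges M"
  shows "vx x \<inter> heads (delta M) \<noteq> {}"
proof (cases "vx x = root_vx")
  case True
  then show ?thesis using vx_self[of "root_he M"] by (auto simp: heads_delta)
next
  case False
  then show ?thesis using desc_of_vertex[OF assms] by (auto simp: heads_delta)
qed

text \<open>\<open>rot M x\<close> follows \<open>flip x\<close> in the tour, and a tail is not a
  descent, so \<open>flip x\<close> is not earlier than \<open>x\<close>. At the root the time drops
  to 0, hence the last assumption.\<close>

lemma tail_step:
  assumes "x \<in> half_edges M" "x \<notin> heads (delta M)" "rot M x \<noteq> root_he M"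
  shows "T.time x < T.time (rot M x)" "x \<in> tree M \<Longrightarrow> T.time (opp M x) < T.time (rot M x)"
proof -
  have r: "rot M x = tour (flip x)" using flip_flip tour_eq by simp
  have "T.time (rot M x) = Suc (T.time (flip x))"
    using T.time_step[of "flip x"] assms flip_in r by simp
  moreover have "x \<notin> T.Desc" using assms heads_delta by auto
  ultimately show "T.time x < T.time (rot M x)" using assms by (simp add: T.Desc_def)
  show "x \<in> tree M \<Longrightarrow> T.time (opp M x) < T.time (rot M x)"
    using \<open>T.time (rot M x) = Suc (T.time (flip x))\<close> by (simp add: tree_flip_def)
qed

end

section \<open>Exploding the vertices of an oriented map\<close>

text \<open>It suffices to imitate single steps of some full cycle by \<open>rot\<close> and
  \<open>opp\<close>.\<close>

lemma connected_mapI: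
  assumes "c permutes half_edges M" "finite (half_edges M)" "half_edges M \<subseteq> orbit c r" "r \<in> half_edges M"
    and step: "\<And>x. x \<in> half_edges M \<Longrightarrow>
      (x, c x) \<in> ({(u, rot M u) | u. u \<in> half_edges M} \<union> {(u, opp M u) | u. u \<in> half_edges M})\<^sup>*"
  shows "connected_map M"
  unfolding connected_map_def
proof (intro ballI)
  let ?G = "({(u, rot M u) | u. u \<in> half_edges M} \<union> {(u, opp M u) | u. u \<in> half_edges M})\<^sup>*"
  fix x y assume x: "x \<in> half_edges M" and y: "y \<in> half_edges M"
  have "orbit c x = orbit c r" using permutes_orbit_eq[OF assms(1,2)] assms(3) x by blast
  then obtain k where k: "(c ^^ k) x = y" using assms(3) y permutes_orbit_funpow[OF assms(1,2)] by blast
  have "(x, (c ^^ k) x) \<in> ?G"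
  proof (induction k)
    case (Suc k)
    have "((c ^^ k) x, c ((c ^^ k) x)) \<in> ?G" by (rule step) (rule permutes_funpow_in[OF assms(1) x])
    then show ?case using Suc by (simp add: rtrancl_trans)
  qed simp
  then show "(x, y) \<in> ?G" using k by simp
qed

lemma card_less_rank:
  fixes t :: "'a \<Rightarrow> nat"
  assumes "finite D" "inj_on t D"
  defines "rk \<equiv> \<lambda>h. card {h' \<in> D. t h' < t h}"
  shows "\<And>h h'. h \<in> D \<Longrightarrow> h' \<in> D \<Longrightarrow> rk h < rk h' \<longleftrightarrow> t h < t h'"
    and "bij_betw rk D {..<card D}"
proof -
  have mono: "rk h < rk h'" if "h \<in> D" "t h < t h'" for h h'
    unfolding rk_def by (rule psubset_card_mono) (use that assms in auto)
  show lt: "rk h < rk h' \<longleftrightarrow> t h < t h'" if h: "h \<in> D" "h' \<in> D" for h h'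
  proof (cases "t h = t h'")
    case True
    then show ?thesis by (simp add: rk_def)
  next
    case False
    then show ?thesis using mono[of h h'] mono[of h' h] h by linarith
  qed
  have inj: "inj_on rk D"
  proof (rule inj_onI)
    fix h h' assume h: "h \<in> D" "h' \<in> D" "rk h = rk h'"
    then have "t h = t h'" using lt[of h h'] lt[of h' h] by linarith
    then show "h = h'" using assms(2) h by (simp add: inj_on_def)
  qed
  have "rk ` D \<subseteq> {..<card D}"
  proof clarify
    fix h assume "h \<in> D"
    then show "rk h < card D" unfolding rk_def by (intro psubset_card_mono assms) auto
  qed
  then have "rk ` D = {..<card D}" by (rule card_subset_eq[rotated]) (use card_image[OF inj] in auto)
  then show "bij_betw rk D {..<card D}" using inj by (simp add: bij_betw_def)
qed

text \<open>After the explosion the tail \<open>opp N h\<close> of a head \<open>h\<close> sits at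
  the new vertex of \<open>first_head N (opp N h)\<close>, the parent of the new vertex of
  \<open>h\<close>. The rank \<open>K\<close> grows towards the root and so excludes cycles of
  parents; it is all that remains here of the tour of the spanning tree.\<close>

locale explosion =
  fixes N :: "'h omap" and K :: "'h \<Rightarrow> nat"
  assumes fin: "finite (half_edges N)" and root: "root_he N \<in> half_edges N"
    and rot: "rot N permutes half_edges N" and opp: "opp N permutes half_edges N"
    and opp_opp: "\<And>x. opp N (opp N x) = x"
    and opp_fix: "\<And>x. x \<in> half_edges N \<Longrightarrow> opp N x = x \<longleftrightarrow> x = root_he N"
    and heads_sub: "heads N \<subseteq> half_edges N" and root_head: "root_he N \<in> heads N"
    and opp_heads: "\<And>x. x \<in> half_edges N \<Longrightarrow> x \<noteq> root_he N \<Longrightarrow> opp N x \<in> heads N \<longleftrightarrow> x \<notin> heads N"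
    and has_head: "\<And>x. x \<in> half_edges N \<Longrightarrow> orbit (rot N) x \<inter> heads N \<noteq> {}"
    and K: "\<And>h. h \<in> heads N \<Longrightarrow> h \<noteq> root_he N \<Longrightarrow> K h < K (first_head N (opp N h))"
begin

abbreviation "H \<equiv> half_edges N"
abbreviation "D \<equiv> heads N"
abbreviation "r \<equiv> root_he N"
abbreviation "nh \<equiv> first_head N"
abbreviation "pe \<equiv> rot (phi0 N)"
abbreviation "\<rho> \<equiv> first_return (rot N) D"

definition face where "face x = pe (opp N x)"

lemma phi0_simps: "half_edges (phi0 N) = H" "opp (phi0 N) = opp N" "root_he (phi0 N) = r"
  by (simp_all add: phi0_def)

lemma rot_in: "rot N x \<in> H \<longleftrightarrow> x \<in> H" by (rule permutes_in_image[OF rot])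
lemma opp_in: "opp N x \<in> H \<longleftrightarrow> x \<in> H" by (rule permutes_in_image[OF opp])
lemma opp_root: "opp N r = r" using opp_fix root by blast
lemma opp_eq_root: "opp N x = r \<longleftrightarrow> x = r" using opp_root opp_opp by metis

lemma head_in: "h \<in> D \<Longrightarrow> h \<in> H" using heads_sub by blast

lemma ex_head: "x \<in> H \<Longrightarrow> \<exists>k. (rot N ^^ k) x \<in> D"
proof -
  assume "x \<in> H"
  then obtain y where y: "y \<in> orbit (rot N) x" "y \<in> D" using has_head by blast
  then obtain k where "(rot N ^^ k) x = y" using permutes_orbit_funpow[OF rot fin] by blast
  then show "\<exists>k. (rot N ^^ k) x \<in> D" using y by blast
qed

lemma nh_head: "h \<in> D \<Longrightarrow> nh h = h"
proof -
  assume "h \<in> D"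
  then have "(LEAST k. (rot N ^^ k) h \<in> D) = 0" by (intro Least_eq_0) simp
  then show ?thesis by (simp add: first_head_def)
qed

lemma nh_in: "x \<in> H \<Longrightarrow> nh x \<in> D"
  unfolding first_head_def by (rule LeastI_ex) (rule ex_head)

lemma nh_orbit: "nh x \<in> orbit (rot N) x"
  unfolding first_head_def using permutes_orbit_funpow[OF rot fin] by blast

lemma nh_tail:
  assumes "x \<in> H" "x \<notin> D"
  shows "nh (rot N x) = nh x"
proof -
  obtain k where "(rot N ^^ k) x \<in> D" using ex_head[OF assms(1)] by blast
  then have "(LEAST k. (rot N ^^ k) x \<in> D) = Suc (LEAST m. (rot N ^^ Suc m) x \<in> D)"
    by (rule Least_Suc) (use assms in simp)
  then show ?thesis unfolding first_head_def by (simp add: funpow_Suc_right del: funpow.simps)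
qed

lemma next_head:
  assumes "h \<in> D"
  shows "\<rho> h = nh (rot N h)"
proof -
  define m where "m = (LEAST m. (rot N ^^ m) (rot N h) \<in> D)"
  have shift: "(rot N ^^ Suc m) h = (rot N ^^ m) (rot N h)" for m
    by (simp add: funpow_Suc_right del: funpow.simps)
  have "\<rho> h = (rot N ^^ Suc m) h"
  proof (rule first_return_eq[OF assms])
    have "rot N h \<in> H" using assms head_in rot_in by blast
    then show "(rot N ^^ Suc m) h \<in> D" unfolding shift m_def by (rule LeastI_ex[OF ex_head])
    fix i assume i: "0 < i" "i < Suc m"
    then obtain i' where i': "i = Suc i'" "i' < m" by (cases i) auto
    then show "(rot N ^^ i) h \<notin> D" unfolding i'(1) shift using not_less_Least m_def by blast
  qed simp
  then show ?thesis by (simp only: shift first_head_def m_def)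
qed

lemma \<rho>_in: "h \<in> D \<Longrightarrow> \<rho> h \<in> D" by (rule first_return_in[OF rot fin])
lemma \<rho>_tail: "x \<notin> D \<Longrightarrow> \<rho> x = x" by (rule first_return_notin)
lemma \<rho>_permutes: "\<rho> permutes D" by (rule first_return_permutes[OF rot fin heads_sub])
lemma \<rho>_permutes_H: "\<rho> permutes H" by (rule permutes_subset[OF \<rho>_permutes heads_sub])

definition grp where "grp h = {y \<in> H. nh y = h}"

lemma pe_eq: "pe x = first_return (rot N) (grp (nh x)) x"
  by (simp add: phi0_def grp_def)

lemma grp_self: "x \<in> H \<Longrightarrow> x \<in> grp (nh x)" by (simp add: grp_def)

lemma grp_head: "h \<in> D \<Longrightarrow> h \<in> grp h" by (simp add: grp_def nh_head head_in)

lemma pe_grp: "x \<in> H \<Longrightarrow> pe x \<in> grp (nh x)"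
  unfolding pe_eq by (rule first_return_in[OF rot fin]) (rule grp_self)

lemma pe_tail: "x \<in> H \<Longrightarrow> x \<notin> D \<Longrightarrow> pe x = rot N x"
  unfolding pe_eq by (rule first_return_step) (auto simp: grp_def rot_in nh_tail)

text \<open>Let \<open>z\<close> be the half-edge just before the point where the group of
  \<open>\<rho> h\<close> is re-entered. A tail belongs to the group of its successor, so
  \<open>z\<close> must be a head; the head after it is \<open>\<rho> h\<close>, and
  \<open>\<rho>\<close> is injective.\<close>

lemma pe_next:
  assumes h: "h \<in> D"
  shows "pe (\<rho> h) = rot N h"
proof -
  have h': "\<rho> h \<in> D" "\<rho> h \<in> H" using \<rho>_in[OF h] head_in by auto
  then have nh': "nh (\<rho> h) = \<rho> h" by (simp add: nh_head)
  obtain k where k: "0 < k" "pe (\<rho> h) = (rot N ^^ k) (\<rho> h)" "(rot N ^^ k) (\<rho> h) \<in> grp (\<rho> h)"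
    "\<And>i. 0 < i \<Longrightarrow> i < k \<Longrightarrow> (rot N ^^ i) (\<rho> h) \<notin> grp (\<rho> h)"
    using first_return_spec[OF rot fin grp_head[OF h'(1)]] pe_eq nh' by metis
  obtain m where m: "k = Suc m" using k(1) by (cases k) auto
  define z where "z = (rot N ^^ m) (\<rho> h)"
  have zH: "z \<in> H" unfolding z_def by (rule permutes_funpow_in[OF rot h'(2)])
  have rz: "rot N z = pe (\<rho> h)" "nh (rot N z) = \<rho> h" using k m by (auto simp: z_def grp_def)
  have "z \<in> D"
  proof (rule ccontr)
    assume nz: "z \<notin> D"
    then have "z \<in> grp (\<rho> h)" using nh_tail[OF zH] rz zH by (simp add: grp_def)
    then have "m = 0" using k(4)[of m] m by (auto simp: z_def)
    then show False using nz h' by (simp add: z_def)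
  qed
  then have "\<rho> z = \<rho> h" using next_head rz by simp
  then have "z = h" using first_return_inj[OF rot fin \<open>z \<in> D\<close> h] by simp
  then show ?thesis using rz by simp
qed

text \<open>At tails nothing is cut and \<open>\<rho>\<close> is the identity. The factorisation
  shows that \<open>pe\<close> is a permutation, and later rebuilds \<open>rot\<close> from the tree
  and the partition.\<close>

lemma pe_\<rho>: "pe (\<rho> x) = rot N x"
proof -
  consider "x \<in> D" | "x \<notin> D" "x \<in> H" | "x \<notin> H" by blast
  then show ?thesis
  proof cases
    case 3
    then have "x \<notin> D" using head_in by blast
    then show ?thesis using 3 \<rho>_tail permutes_not_in[OF rot] pe_eq[of x]
      first_return_notin[of x "grp (nh x)" "rot N"] by (simp add: grp_def)
  qed (auto simp: pe_next pe_tail \<rho>_tail)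
qed

lemma pe_permutes: "pe permutes H"
proof -
  have "pe = rot N \<circ> inv \<rho>"
  proof
    fix x
    show "pe x = (rot N \<circ> inv \<rho>) x"
      using pe_\<rho>[of "inv \<rho> x"] permutes_inverses(1)[OF \<rho>_permutes_H] by simp
  qed
  then show ?thesis using permutes_compose[OF permutes_inv[OF \<rho>_permutes_H] rot] by simp
qed

lemma grp_sub_orbit: "h \<in> D \<Longrightarrow> grp h \<subseteq> orbit (rot N) h"
proof
  fix y assume "h \<in> D" "y \<in> grp h"
  then have "h \<in> orbit (rot N) y" using nh_orbit[of y] by (simp add: grp_def)
  then have "orbit (rot N) h = orbit (rot N) y" by (rule permutes_orbit_eq[OF rot fin])
  then show "y \<in> orbit (rot N) h" using permutes_orbit_self[OF rot fin, of y] by simp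
qed

lemma pe_orbit:
  assumes h: "h \<in> D"
  shows "orbit pe h = grp h"
proof -
  have eq: "first_return (rot N) (grp h) y = pe y" if "y \<in> grp h" for y
    using that by (simp add: pe_eq grp_def)
  have "orbit (first_return (rot N) (grp h)) h = orbit pe h"
    by (rule orbit_cong0[OF grp_head[OF h]]) (use eq first_return_in[OF rot fin] in auto)
  then show ?thesis using orbit_first_return[OF rot fin grp_head[OF h]] grp_sub_orbit[OF h] by auto
qed

lemma vertices_phi0: "vertices (phi0 N) = grp ` D"
proof -
  have "orbit pe x = grp (nh x)" if "x \<in> H" for x
  proof -
    have "x \<in> orbit pe (nh x)" using that pe_orbit[OF nh_in] grp_self by simp
    then have "orbit pe x = orbit pe (nh x)" by (rule permutes_orbit_eq[OF pe_permutes fin])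
    then show ?thesis using pe_orbit[OF nh_in[OF that]] by simp
  qed
  then have "vertices (phi0 N) = (\<lambda>x. grp (nh x)) ` H"
    by (simp add: vertices_def vertex_of_def phi0_def)
  also have "\<dots> = grp ` D"
  proof
    show "(\<lambda>x. grp (nh x)) ` H \<subseteq> grp ` D" using nh_in by blast
    show "grp ` D \<subseteq> (\<lambda>x. grp (nh x)) ` H" using nh_head head_in by force
  qed
  finally show ?thesis .
qed

lemma inj_grp: "inj_on grp D"
proof (rule inj_onI)
  fix h h' assume "h \<in> D" "h' \<in> D" "grp h = grp h'"
  then have "h \<in> grp h'" using grp_head by blast
  then show "h = h'" using nh_head[OF \<open>h \<in> D\<close>] by (simp add: grp_def)
qed

subsection \<open>The exploded map has one face\<close>

text \<open>Steps ending at \<open>r\<close> are left out so that a path never wraps around: times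
  grow along \<open>reach\<close>.\<close>

definition "reach = {(x, face x) | x. x \<in> H \<and> face x \<noteq> r}\<^sup>*"

lemma reach_step: "x \<in> H \<Longrightarrow> face x \<noteq> r \<Longrightarrow> (x, face x) \<in> reach"
  unfolding reach_def by blast

lemma reach_trans: "(x, y) \<in> reach \<Longrightarrow> (y, z) \<in> reach \<Longrightarrow> (x, z) \<in> reach"
  unfolding reach_def by (rule rtrancl_trans)

lemma reach_refl: "(x, x) \<in> reach" unfolding reach_def by simp

lemma face_comp: "face = pe \<circ> opp N" by (auto simp: face_def)

lemma face_permutes: "face permutes H"
  unfolding face_comp by (rule permutes_compose[OF opp pe_permutes])

lemma root_notin_grp: "h \<noteq> r \<Longrightarrow> r \<notin> grp h"
  using nh_head[OF root_head] by (simp add: grp_def)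

text \<open>Contour walk around the new vertex of \<open>h\<close>: at each tail \<open>y\<close> it
  goes into the subtree behind \<open>y\<close>, comes back at \<open>opp N y\<close> by
  \<open>sub\<close>, and continues with \<open>pe y\<close>. It starts at \<open>pe h\<close>,
  where it arrives from the tail of \<open>h\<close>, or at \<open>r\<close> itself for the root,
  which \<open>opp\<close> fixes.\<close>

lemma walk_group:
  assumes h: "h \<in> D"
    and sub: "\<And>h'. h' \<in> D \<Longrightarrow> h' \<noteq> r \<Longrightarrow> nh (opp N h') = h \<Longrightarrow> (opp N h', h') \<in> reach"
    and k: "0 < k" "\<And>i. 0 < i \<Longrightarrow> i < k \<Longrightarrow> (pe ^^ i) h \<noteq> h" "h = r \<Longrightarrow> (pe ^^ k) h \<noteq> r"
  shows "(if h = r then r else pe h, (pe ^^ k) h) \<in> reach"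
  using k
proof (induction k)
  case (Suc k)
  have grp: "(pe ^^ i) h \<in> grp h" for i
    using permutes_orbit_funpow[OF pe_permutes fin, of _ h] pe_orbit[OF h] by blast
  show ?case
  proof (cases "k = 0")
    case True
    show ?thesis
    proof (cases "h = r")
      case hr: True
      then have "face r \<noteq> r" using Suc.prems(3) True opp_root by (simp add: face_def)
      then show ?thesis using reach_step[OF root] True opp_root hr by (simp add: face_def)
    qed (simp add: reach_refl True)
  next
    case False
    define y where "y = (pe ^^ k) h"
    have IH: "(if h = r then r else pe h, y) \<in> reach"
      unfolding y_def by (rule Suc.IH) (use Suc.prems False in auto)
    have yg: "y \<in> grp h" "y \<noteq> h" using grp Suc.prems(2)[of k] False by (auto simp: y_def)
    then have yH: "y \<in> H" and yD: "y \<notin> D" using nh_head by (auto simp: grp_def)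
    have yr: "y \<noteq> r" using yD root_head by blast
    have oD: "opp N y \<in> D" using opp_heads[OF yH yr] yD by simp
    have "(y, opp N y) \<in> reach"
      using sub[OF oD] yg(1) opp_opp[of y] opp_eq_root[of y] yr by (simp add: grp_def)
    moreover have "(opp N y, pe y) \<in> reach"
    proof -
      have "pe y = (pe ^^ Suc k) h" by (simp add: y_def)
      then have "pe y \<noteq> r" using Suc.prems(3) grp[of "Suc k"] root_notin_grp[of h] by metis
      then show ?thesis using reach_step[of "opp N y"] opp_in yH opp_opp by (simp add: face_def)
    qed
    ultimately show ?thesis using IH reach_trans unfolding y_def funpow.simps comp_apply by blast
  qed
qed simp

lemma walk_group_all:
  assumes h: "h \<in> D"
    and sub: "\<And>h'. h' \<in> D \<Longrightarrow> h' \<noteq> r \<Longrightarrow> nh (opp N h') = h \<Longrightarrow> (opp N h', h') \<in> reach"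
    and y: "y \<in> grp h" "h = r \<Longrightarrow> y \<noteq> r"
  shows "(if h = r then r else pe h, y) \<in> reach"
proof -
  \<comment> \<open>The least positive \<open>k\<close> keeps \<open>h\<close> from being passed on
    the way; for \<open>y = h\<close> the walk goes once around the vertex.\<close>
  define P where "P k \<longleftrightarrow> 0 < k \<and> (pe ^^ k) h = y" for k
  have "y \<in> orbit pe h" using y pe_orbit[OF h] by simp
  then have "\<exists>k. P k" unfolding P_def orbit_altdef by auto
  then have P: "P (LEAST k. P k)" by (rule LeastI_ex)
  define k where "k = (LEAST k. P k)"
  have k: "0 < k" "(pe ^^ k) h = y" using P by (auto simp: P_def k_def)
  have "(pe ^^ i) h \<noteq> h" if i: "0 < i" "i < k" for i
  proof
    assume e: "(pe ^^ i) h = h"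
    have "(pe ^^ (k - i)) ((pe ^^ i) h) = (pe ^^ (k - i + i)) h" by (simp add: funpow_add)
    then have "P (k - i)" using e k i by (simp add: P_def)
    then show False using not_less_Least[of "k - i" P] i by (simp add: k_def)
  qed
  then show ?thesis using walk_group[OF h sub k(1)] k(2) y(2) by blast
qed

text \<open>Induction on \<open>K\<close>: the heads whose tails sit at the new vertex of
  \<open>h\<close> have smaller \<open>K\<close>, so the walks through their subtrees are available
  for the contour of \<open>h\<close>.\<close>

lemma reach_head: "h \<in> D \<Longrightarrow> h \<noteq> r \<Longrightarrow> (opp N h, h) \<in> reach"
proof (induction "K h" arbitrary: h rule: less_induct)
  case less
  have "(if h = r then r else pe h, h) \<in> reach"
    by (rule walk_group_all[OF less.prems(1) _ grp_head[OF less.prems(1)]]) (use less K in auto)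
  moreover have "pe h \<noteq> r"
    using pe_grp[of h] nh_head[OF less.prems(1)] root_notin_grp less.prems head_in by auto
  then have "(opp N h, pe h) \<in> reach"
    using reach_step[of "opp N h"] opp_in head_in[OF less.prems(1)] opp_opp by (simp add: face_def)
  ultimately show ?case using less.prems(2) reach_trans by auto
qed

lemma reach_group:
  "h \<in> D \<Longrightarrow> y \<in> grp h \<Longrightarrow> (h = r \<Longrightarrow> y \<noteq> r) \<Longrightarrow> (if h = r then r else pe h, y) \<in> reach"
  using walk_group_all reach_head by blast

lemma pe_head_neq: "h \<in> D \<Longrightarrow> h \<noteq> r \<Longrightarrow> pe h \<noteq> r"
  using pe_grp[of h] nh_head root_notin_grp head_in by force

lemma face_opp: "face (opp N h) = pe h" by (simp add: face_def opp_opp)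

text \<open>Induction in the other direction, towards the root: the tail of \<open>nh x\<close>
  belongs to a group of larger \<open>K\<close>, and from this tail the contour walk leads to
  \<open>x\<close>.\<close>

lemma reach_all: "x \<in> H \<Longrightarrow> (r, x) \<in> reach"
proof (induction "Max (K ` H) - K (nh x)" arbitrary: x rule: less_induct)
  case less
  let ?h = "nh x"
  have hD: "?h \<in> D" and hH: "?h \<in> H" using nh_in head_in less.prems by auto
  show ?case
  proof (cases "?h = r")
    case True
    show ?thesis
    proof (cases "x = r")
      case False
      then show ?thesis using reach_group[OF hD grp_self] less.prems True by simp
    qed (simp add: reach_refl)
  next
    case False
    have p: "nh (opp N ?h) \<in> H" "opp N ?h \<in> H" using nh_in head_in opp_in hH by auto
    have "K ?h < K (nh (opp N ?h))" by (rule K[OF hD False])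
    moreover have "K (nh (opp N ?h)) \<le> Max (K ` H)" using fin p by (intro Max_ge) auto
    ultimately have "(r, opp N ?h) \<in> reach" using less.hyps[of "opp N ?h"] p by linarith
    moreover have "(opp N ?h, pe ?h) \<in> reach"
      using reach_step[OF p(2)] pe_head_neq[OF hD False] face_opp by simp
    moreover have "(pe ?h, x) \<in> reach"
      using reach_group[OF hD grp_self] less.prems False by simp
    ultimately show ?thesis using reach_trans by blast
  qed
qed

lemma reach_orbit: "(x, y) \<in> reach \<Longrightarrow> y \<in> orbit face x"
  unfolding reach_def
proof (induction rule: rtrancl_induct)
  case base
  then show ?case by (rule permutes_orbit_self[OF face_permutes fin])
next
  case (step y z)
  then have "z = face y" by blast
  then show ?case using orbit.step[OF step.IH] by simp
qed

sublocale A: full_cycle H face r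
  by unfold_locales (use fin face_permutes root reach_all reach_orbit in auto)

lemma reach_time: "(x, y) \<in> reach \<Longrightarrow> A.time x \<le> A.time y"
  unfolding reach_def
proof (induction rule: rtrancl_induct)
  case (step y z)
  then have "z = face y" "y \<in> H" "face y \<noteq> r" by auto
  then have "A.time z = Suc (A.time y)" using A.time_step[of y] by metis
  then show ?case using step.IH by simp
qed simp

section \<open>Heads and order of appearance along the contour of the tree\<close>

lemma head_time: "h \<in> D \<Longrightarrow> h \<noteq> r \<Longrightarrow> A.time (opp N h) < A.time h"
  using reach_time[OF reach_head] A.time_inj[of "opp N h" h] opp_in[of h] opp_fix[of h] head_in[of h] by force

text \<open>The contour follows each edge first from its tail, so the heads can be recovered from
  the exploded tree alone.\<close>

lemma head_iff_time: "x \<in> H \<Longrightarrow> x \<noteq> r \<Longrightarrow> x \<in> D \<longleftrightarrow> A.time (opp N x) < A.time x"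
  using head_time[of x] head_time[of "opp N x"] opp_heads[of x] opp_opp[of x] opp_eq_root[of x] by force

text \<open>The contour enters the new vertex of \<open>h\<close> one step after the tail of
  \<open>h\<close>, so the times of tails carry the order of appearance. The root fits in, since
  \<open>opp N r = r\<close> has time 0.\<close>

definition tm where "tm h = A.time (opp N h)"

lemma tm_inj: "inj_on tm D"
proof (rule inj_onI)
  fix h h' assume h: "h \<in> D" "h' \<in> D" "tm h = tm h'"
  then have "opp N h = opp N h'" using A.time_inj opp_in head_in unfolding tm_def by blast
  then show "h = h'" using opp_opp by metis
qed

lemma appearance_eq:
  assumes "y \<in> v" "v \<subseteq> H" "\<And>z. z \<in> v \<Longrightarrow> A.time y \<le> A.time z"
  shows "appearance (phi0 N) v = A.time y"
proof -
  have step: "tour_step (phi0 N) (half_edges (phi0 N) - {root_he (phi0 N)}) = face"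
  proof
    fix x
    have e: "(if x \<in> H - {r} then opp N x else x) = opp N x"
      using permutes_not_in[OF opp, of x] opp_root by auto
    show "tour_step (phi0 N) (half_edges (phi0 N) - {root_he (phi0 N)}) x = face x"
      by (simp only: tour_step_def phi0_simps face_def e)
  qed
  have root: "root_he (phi0 N) = r" by (simp add: phi0_def)
  show ?thesis unfolding appearance_def step unfolding root
  proof (rule Least_equality)
    show "(face ^^ A.time y) r \<in> v" using A.funpow_time[of y] assms by auto
    fix k assume "(face ^^ k) r \<in> v"
    then have "A.time y \<le> A.time ((face ^^ k) r)" by (rule assms(3))
    also have "\<dots> \<le> k" by (rule A.time_le) simp
    finally show "A.time y \<le> k" .
  qed
qed

lemma appearance_grp:
  assumes "h \<in> D"
  shows "appearance (phi0 N) (grp h) = (if h = r then 0 else Suc (tm h))"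
proof (cases "h = r")
  case True
  have "appearance (phi0 N) (grp r) = A.time r"
    by (rule appearance_eq) (use grp_head[OF root_head] in \<open>auto simp: grp_def\<close>)
  then show ?thesis using True by simp
next
  case False
  have "appearance (phi0 N) (grp h) = A.time (pe h)"
  proof (rule appearance_eq)
    show "pe h \<in> grp h" using pe_grp[of h] nh_head[OF assms] head_in[OF assms] by simp
    show "grp h \<subseteq> H" by (auto simp: grp_def)
    fix z assume "z \<in> grp h"
    then show "A.time (pe h) \<le> A.time z" using reach_group[OF assms, of z] reach_time False by simp
  qed
  also have "\<dots> = Suc (tm h)"
    using A.time_step[of "opp N h"] face_opp[of h] pe_head_neq[OF assms False] opp_in head_in[OF assms]
    by (simp add: tm_def)
  finally show ?thesis using False by simp
qed

lemma tm_root: "tm r = 0" by (simp add: tm_def opp_root)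

lemma appearance_less:
  assumes "h \<in> D" "h' \<in> D"
  shows "appearance (phi0 N) (grp h) < appearance (phi0 N) (grp h') \<longleftrightarrow> tm h < tm h'"
proof -
  \<comment> \<open>Only \<open>r\<close> has \<open>tm\<close> equal to 0, so the shift by one in
    \<open>appearance_grp\<close> does not affect comparisons.\<close>
  have "tm h' \<noteq> 0" if "h' \<noteq> r"
    using inj_onD[OF tm_inj _ assms(2) root_head] tm_root that by auto
  then show ?thesis using assms by (cases "h = r"; cases "h' = r") (simp_all add: appearance_grp tm_root)
qed

definition rk where "rk h = card {h' \<in> D. tm h' < tm h}"

lemma vertex_rank: "h \<in> D \<Longrightarrow> vertex_rank (phi0 N) (grp h) = rk h"
proof -
  assume h: "h \<in> D"
  have "{w \<in> vertices (phi0 N). appearance (phi0 N) w < appearance (phi0 N) (grp h)}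
     = grp ` {h' \<in> D. tm h' < tm h}"
    unfolding vertices_phi0 using appearance_less[OF _ h] by auto
  moreover have "inj_on grp {h' \<in> D. tm h' < tm h}" using inj_grp by (rule inj_on_subset) auto
  ultimately show ?thesis by (simp add: vertex_rank_def rk_def card_image)
qed

lemma finD: "finite D" using finite_subset[OF heads_sub fin] .

lemma rk_less: "h \<in> D \<Longrightarrow> h' \<in> D \<Longrightarrow> rk h < rk h' \<longleftrightarrow> tm h < tm h'"
  unfolding rk_def by (rule card_less_rank(1)[OF finD tm_inj])

lemma rk_bij: "bij_betw rk D {..<card D}"
  unfolding rk_def by (rule card_less_rank(2)[OF finD tm_inj])

lemma rk_inj: "inj_on rk D" using rk_bij by (simp add: bij_betw_def)

lemma same_origin_eq:
  "same_origin N = {(grp h, grp h') | h h'. h \<in> D \<and> h' \<in> D \<and> orbit (rot N) h = orbit (rot N) h'}"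
proof -
  have "(\<exists>u\<in>vertices N. grp h \<subseteq> u \<and> grp h' \<subseteq> u) \<longleftrightarrow> orbit (rot N) h = orbit (rot N) h'"
    if h: "h \<in> D" "h' \<in> D" for h h'
  proof
    assume "\<exists>u\<in>vertices N. grp h \<subseteq> u \<and> grp h' \<subseteq> u"
    then obtain x where "h \<in> orbit (rot N) x" "h' \<in> orbit (rot N) x"
      using grp_head h unfolding vertices_def vertex_of_def by blast
    then show "orbit (rot N) h = orbit (rot N) h'" using permutes_orbit_eq[OF rot fin] by metis
  next
    assume "orbit (rot N) h = orbit (rot N) h'"
    then have "grp h \<subseteq> orbit (rot N) h \<and> grp h' \<subseteq> orbit (rot N) h" using grp_sub_orbit h by blast
    then show "\<exists>u\<in>vertices N. grp h \<subseteq> u \<and> grp h' \<subseteq> u"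
      using head_in[OF h(1)] unfolding vertices_def vertex_of_def by blast
  qed
  note * = this
  show ?thesis
  proof (rule set_eqI)
    fix z :: "'h set \<times> 'h set"
    obtain v w where z: "z = (v, w)" by (cases z)
    have "z \<in> same_origin N \<longleftrightarrow>
        (\<exists>h\<in>D. \<exists>h'\<in>D. v = grp h \<and> w = grp h' \<and> (\<exists>u\<in>vertices N. v \<subseteq> u \<and> w \<subseteq> u))"
      unfolding same_origin_def vertices_phi0 z by blast
    also have "\<dots> \<longleftrightarrow> (\<exists>h\<in>D. \<exists>h'\<in>D. v = grp h \<and> w = grp h' \<and> orbit (rot N) h = orbit (rot N) h')"
      using * by metis
    finally show "z \<in> same_origin N \<longleftrightarrow>
        z \<in> {(grp h, grp h') | h h'. h \<in> D \<and> h' \<in> D \<and> orbit (rot N) h = orbit (rot N) h'}"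
      unfolding z by blast
  qed
qed

lemma phi1_eq:
  "phi1 N = {(rk h, rk h') | h h'. h \<in> D \<and> h' \<in> D \<and> orbit (rot N) h = orbit (rot N) h'}"
proof -
  define E where "E = {(h, h'). h \<in> D \<and> h' \<in> D \<and> orbit (rot N) h = orbit (rot N) h'}"
  have "same_origin N = map_prod grp grp ` E" unfolding same_origin_eq E_def by auto
  then have "phi1 N = (\<lambda>z. map_prod (vertex_rank (phi0 N)) (vertex_rank (phi0 N)) (map_prod grp grp z)) ` E"
    unfolding phi1_def by (simp add: image_image)
  also have "\<dots> = map_prod rk rk ` E"
    by (rule image_cong) (auto simp: E_def vertex_rank)
  finally show ?thesis unfolding E_def by auto
qed

lemma phi1_iff:
  assumes "h \<in> D" "h' \<in> D"
  shows "(rk h, rk h') \<in> phi1 N \<longleftrightarrow> orbit (rot N) h = orbit (rot N) h'"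
proof
  assume "(rk h, rk h') \<in> phi1 N"
  then obtain u u' where "rk h = rk u" "rk h' = rk u'" "u \<in> D" "u' \<in> D" "orbit (rot N) u = orbit (rot N) u'"
    unfolding phi1_eq by auto
  then show "orbit (rot N) h = orbit (rot N) h'" using rk_inj assms by (metis inj_onD)
qed (use assms in \<open>auto simp: phi1_eq\<close>)

lemma card_edges: "card (edges N) = card (D - {r})" "card (H - {r}) = 2 * card (D - {r})"
proof -
  have *: "opp N x \<in> D - {r} \<longleftrightarrow> x \<notin> D - {r}" if "x \<in> H - {r}" for x
    using that opp_heads[of x] opp_eq_root[of x] by auto
  have **: "opp N x \<in> H - {r} \<and> opp N (opp N x) = x" if "x \<in> H - {r}" for x
    using that opp_in opp_eq_root opp_opp by auto
  show "card (edges N) = card (D - {r})" unfolding edges_def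
    by (rule card_pairs_involution(1)[OF _ ** _ *]) (use fin heads_sub in auto)
  show "card (H - {r}) = 2 * card (D - {r})"
    by (rule card_pairs_involution(2)[OF _ ** _ *]) (use fin heads_sub in auto)
qed

lemma card_heads: "card D = Suc (card (edges N))" "card H = Suc (2 * card (edges N))"
  using card_Suc_Diff1[OF finD root_head] card_Suc_Diff1[OF fin root] card_edges by auto

lemma edges_phi0: "edges (phi0 N) = edges N"
  by (simp add: edges_def phi0_def)

text \<open>There is one new vertex per head, hence one more than edges, and \<open>face\<close> is
  a full cycle: this is Euler's relation with a single face.\<close>

lemma plane_tree_phi0: "plane_tree (phi0 N)"
proof -
  have "faces (phi0 N) = {H}"
    using A.orbit_root root by (auto simp: faces_def phi0_simps face_comp)
  moreover have "card (vertices (phi0 N)) = Suc (card (edges N))"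
    using vertices_phi0 card_image[OF inj_grp] card_heads by simp
  moreover have "connected_map (phi0 N)"
  proof (rule connected_mapI)
    show "face permutes half_edges (phi0 N)" "half_edges (phi0 N) \<subseteq> orbit face r" "r \<in> half_edges (phi0 N)"
      "finite (half_edges (phi0 N))"
      using A.perm A.full root fin by (auto simp: phi0_simps)
    fix x assume x: "x \<in> half_edges (phi0 N)"
    let ?R = "{(u, pe u) | u. u \<in> half_edges (phi0 N)} \<union> {(u, opp (phi0 N) u) | u. u \<in> half_edges (phi0 N)}"
    have "(x, opp N x) \<in> ?R" "(opp N x, face x) \<in> ?R" using x opp_in by (auto simp: phi0_simps face_def)
    then show "(x, face x) \<in> ?R\<^sup>*" by (meson r_into_rtrancl rtrancl_into_rtrancl)
  qed
  ultimately show ?thesis unfolding plane_tree_def planar_map_def edges_phi0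
    using fin root pe_permutes opp opp_opp opp_fix by (simp add: phi0_simps)
qed

end

section \<open>Gluing back: the vertices of the map as a non-crossing partition\<close>

locale planar_explosion = explosion +
  assumes euler: "card (vertices N) + card (faces N) = card (edges N) + 2"
begin

text \<open>This is \<open>\<rho>\<close> moved from heads to tails, where the times of
  \<open>face\<close> order the new vertices (\<open>tm\<close>). In
  \<open>face \<circ> \<sigma>\<close> two copies of \<open>opp N\<close> cancel, which leaves the
  face permutation of \<open>N\<close>.\<close>

definition \<sigma> where "\<sigma> x = opp N (\<rho> (opp N x))"

lemma \<sigma>_comp: "\<sigma> = opp N \<circ> (\<rho> \<circ> opp N)" by (auto simp: \<sigma>_def)

lemma \<sigma>_permutes: "\<sigma> permutes H"
  unfolding \<sigma>_comp by (intro permutes_compose opp \<rho>_permutes_H)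

lemma \<sigma>_opp: "\<sigma> (opp N x) = opp N (\<rho> x)"
  by (simp add: \<sigma>_def opp_opp)

lemma face_\<sigma>: "face \<circ> \<sigma> = rot N \<circ> opp N"
  by (auto simp: face_def \<sigma>_def opp_opp pe_\<rho>)

lemma opp_image: "opp N ` H = H" by (rule permutes_image[OF opp])

lemma inj_opp: "inj_on (opp N) A" by (rule inj_on_inverseI[of _ "opp N"]) (rule opp_opp)

lemma orbit_\<sigma>: "x \<in> H \<Longrightarrow> orbit \<sigma> (opp N x) = opp N ` orbit \<rho> x"
  by (rule transport_orbit[symmetric, OF \<rho>_permutes_H fin]) (simp_all add: \<sigma>_opp)

lemma orbit_\<rho>: "h \<in> D \<Longrightarrow> orbit \<rho> h = orbit (rot N) h \<inter> D"
  by (rule orbit_first_return[OF rot fin])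

lemma orbit_\<rho>_tail: "x \<notin> D \<Longrightarrow> orbit \<rho> x = {x}"
  by (simp add: orbit_eq_singleton_iff \<rho>_tail)

lemma vertices_orbits: "vertices N = orbits (rot N) H"
  by (auto simp: vertices_def orbits_def vertex_of_def)

text \<open>Conjugation preserves the number of orbits. On heads \<open>\<rho>\<close> has one orbit
  per vertex of \<open>N\<close>, and the tails, as many as edges, are fixed points.\<close>

lemma card_orbits_\<sigma>: "card (orbits \<sigma> H) = card (vertices N) + card (edges N)"
proof -
  have "card (orbits \<sigma> (opp N ` H)) = card (orbits \<rho> H)"
    by (rule card_transport_orbits[OF \<rho>_permutes_H fin]) (simp_all add: \<sigma>_opp inj_opp)
  moreover have "orbits \<rho> H = orbits \<rho> D \<union> (\<lambda>x. {x}) ` (H - D)"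
    using orbit_\<rho>_tail heads_sub unfolding orbits_def by (auto simp: image_iff) blast
  moreover have "orbits \<rho> D \<inter> (\<lambda>x. {x}) ` (H - D) = {}"
    using orbit_\<rho> unfolding orbits_def by auto
  moreover have "card (orbits \<rho> D) = card (orbits (rot N) H)"
    by (rule card_orbits_first_return[OF rot fin heads_sub]) (use has_head in \<open>auto simp: orbits_def\<close>)
  moreover have "card ((\<lambda>x. {x}) ` (H - D)) = card (edges N)"
  proof -
    have "card ((\<lambda>x. {x}) ` (H - D)) = card (H - D)" by (rule card_image) simp
    also have "\<dots> = card H - card D" by (rule card_Diff_subset[OF finD heads_sub])
    finally show ?thesis using card_heads by simp
  qed
  ultimately show ?thesis
    using fin finD by (simp add: opp_image vertices_orbits card_Un_disjoint)
qed

text \<open>The orbit counts are \<open>card (faces N)\<close> and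
  \<open>card (vertices N) + card (edges N)\<close>. By Euler's relation their sum is
  \<open>2 * card (edges N) + 2\<close>, one more than the number of half-edges.\<close>

sublocale A: genus_zero H face r \<sigma>
proof unfold_locales
  show "\<sigma> permutes H" by (rule \<sigma>_permutes)
  have "card (orbits (rot N \<circ> opp N) H) = card (faces N)" by (simp add: orbits_def faces_def)
  then show "card (orbits (face \<circ> \<sigma>) H) + card (orbits \<sigma> H) = Suc (card H)"
    using euler card_orbits_\<sigma> card_heads(2) by (simp add: face_\<sigma>)
qed

lemma same_vertex_iff:
  assumes "h \<in> D" "h' \<in> D"
  shows "opp N h' \<in> orbit \<sigma> (opp N h) \<longleftrightarrow> orbit (rot N) h = orbit (rot N) h'"
proof -
  have "opp N h' \<in> orbit \<sigma> (opp N h) \<longleftrightarrow> h' \<in> orbit \<rho> h"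
    unfolding orbit_\<sigma>[OF head_in[OF assms(1)]]
    by (rule inj_image_mem_iff[OF inj_opp])
  also have "\<dots> \<longleftrightarrow> h' \<in> orbit (rot N) h" using orbit_\<rho> assms by simp
  also have "\<dots> \<longleftrightarrow> orbit (rot N) h = orbit (rot N) h'"
    using permutes_orbit_iff[OF rot fin, of h' h] by auto
  finally show ?thesis .
qed

text \<open>Ranks compare like the times of tails, and heads at one vertex of \<open>N\<close> have
  their tails in one orbit of \<open>\<sigma>\<close>; crossing blocks would be crossing
  orbits.\<close>

theorem phi1_noncrossing: "phi1 N \<in> noncrossing_partitions (card (edges N) + 1)"
proof -
  let ?I = "{..<card (edges N) + 1}"
  have I: "rk ` D = ?I" using rk_bij card_heads by (simp add: bij_betw_def)
  have "equiv ?I (phi1 N)"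
  proof (rule equivI)
    show "phi1 N \<subseteq> ?I \<times> ?I" unfolding phi1_eq I[symmetric] by blast
    show "refl_on ?I (phi1 N)" unfolding refl_on_def I[symmetric] using phi1_iff by auto
    show "sym (phi1 N)" unfolding phi1_eq by (rule symI) force
    show "trans (phi1 N)"
    proof (rule transI)
      fix x y z assume xy: "(x, y) \<in> phi1 N" and yz: "(y, z) \<in> phi1 N"
      obtain a b where a: "a \<in> D" "b \<in> D" "x = rk a" "y = rk b" using xy unfolding phi1_eq by auto
      obtain c where c: "c \<in> D" "z = rk c" using yz unfolding phi1_eq by auto
      show "(x, z) \<in> phi1 N" using xy yz phi1_iff a c by metis
    qed
  qed
  moreover have False
    if *: "a \<in> ?I" "b \<in> ?I" "c \<in> ?I" "d \<in> ?I" "a < b" "b < c" "c < d"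
      "(a, c) \<in> phi1 N" "(b, d) \<in> phi1 N" "(a, b) \<notin> phi1 N" for a b c d
  proof -
    obtain ha hb hc hd where h: "ha \<in> D" "hb \<in> D" "hc \<in> D" "hd \<in> D"
      "a = rk ha" "b = rk hb" "c = rk hc" "d = rk hd"
      using *(1-4) unfolding I[symmetric] by blast
    have lt: "tm ha < tm hb" "tm hb < tm hc" "tm hc < tm hd" using * h rk_less by auto
    have "opp N hb \<in> orbit \<sigma> (opp N ha)"
    proof (rule A.noncrossing_orbits)
      show "opp N hc \<in> orbit \<sigma> (opp N ha)" "opp N hd \<in> orbit \<sigma> (opp N hb)"
        using * h by (simp_all add: same_vertex_iff phi1_iff)
    qed (use lt h head_in opp_in in \<open>auto simp: tm_def\<close>)
    then show False using *(10) h by (simp add: same_vertex_iff phi1_iff)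
  qed
  ultimately show ?thesis unfolding noncrossing_partitions_def noncrossing_partition_def by blast
qed

end

text \<open>In genus zero the earliest point of an orbit goes to the latest and any other to the
  next earlier one, so orbits and times leave only one choice for the image.\<close>

lemma genus_zero_transport:
  assumes "genus_zero H c r s" "genus_zero H' c' r' s'"
    and g: "g ` H = H'" "\<And>x. x \<in> H \<Longrightarrow> full_cycle.time c' r' (g x) = full_cycle.time c r x"
    and o: "\<And>x. x \<in> H \<Longrightarrow> orbit s' (g x) = g ` orbit s x" and x: "x \<in> H"
  shows "g (s x) = s' (g x)"
proof -
  interpret X: genus_zero H c r s by fact
  interpret Y: genus_zero H' c' r' s' by fact
  have oH: "orbit s x \<subseteq> H" by (rule permutes_orbit_subset[OF X.sperm x])
  have g_in: "g y \<in> H'" if "y \<in> H" for y using that g(1) by blast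
  have t: "Y.time (g y) = X.time y" if "y \<in> orbit s x" for y using that oH g(2) by blast
  have self: "x \<in> orbit s x" by (rule permutes_orbit_self[OF X.sperm X.fin])
  have sx: "s x \<in> orbit s x" by (rule orbit.base)
  have "s' (g x) \<in> orbit s' (g x)" by (rule orbit.base)
  then obtain y where y: "y \<in> orbit s x" "s' (g x) = g y" unfolding o[OF x] by blast
  have Desc: "g x \<in> Y.Desc \<longleftrightarrow> x \<in> X.Desc"
  proof
    assume d: "g x \<in> Y.Desc"
    then have "X.time y < X.time x" using y t[OF y(1)] t[OF self] by (simp add: Y.Desc_def)
    then show "x \<in> X.Desc" using X.nondescent_min[OF x _ y(1)] by force
  next
    assume d: "x \<in> X.Desc"
    then have "Y.time (g (s x)) < Y.time (g x)" using t[OF sx] t[OF self] by (simp add: X.Desc_def)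
    moreover have "g (s x) \<in> orbit s' (g x)" using o[OF x] sx by blast
    ultimately show "g x \<in> Y.Desc" using Y.nondescent_min[OF g_in[OF x]] by force
  qed
  have gs: "g (s x) \<in> orbit s' (g x)" using o[OF x] sx by blast
  have "X.time y = X.time (s x)"
  proof (cases "x \<in> X.Desc")
    case False
    have "X.time y \<le> X.time (s x)" by (rule X.nondescent_image_max[OF x False y(1)])
    moreover have "Y.time (g (s x)) \<le> Y.time (s' (g x))"
      by (rule Y.nondescent_image_max[OF g_in[OF x] _ gs]) (use Desc False in simp)
    ultimately show ?thesis using y t[OF y(1)] t[OF sx] by simp
  next
    case True
    then have True': "g x \<in> Y.Desc" using Desc by simp
    have "X.time y < X.time x" using True' y t[OF y(1)] t[OF self] by (simp add: Y.Desc_def)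
    then have "X.time y \<le> X.time (s x)" by (rule X.descent_next[OF True y(1)])
    moreover have "Y.time (g (s x)) < Y.time (g x)" using True t[OF sx] t[OF self] by (simp add: X.Desc_def)
    then have "Y.time (g (s x)) \<le> Y.time (s' (g x))" by (rule Y.descent_next[OF True' gs])
    ultimately show ?thesis using y t[OF y(1)] t[OF sx] by simp
  qed
  then have "y = s x" using X.time_inj[of y "s x"] y(1) sx oH by blast
  then show ?thesis using y by simp
qed

lemma full_cycle_transport:
  assumes "full_cycle H c r" "full_cycle H' c' r'"
    and g: "inj_on g H" "\<And>x. x \<in> H \<Longrightarrow> g (c x) = c' (g x)" "g r = r'" and x: "x \<in> H"
  shows "full_cycle.time c' r' (g x) = full_cycle.time c r x"
proof -
  interpret X: full_cycle H c r by fact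
  interpret Y: full_cycle H' c' r' by fact
  have "g ((c ^^ k) r) = (c' ^^ k) r'" for k
    using transport_funpow[where g = g and q = c', OF X.perm g(2) X.root] g(3) by simp
  then have "(c' ^^ k) r' = g x \<longleftrightarrow> (c ^^ k) r = x" for k
    using g(1) permutes_funpow_in[OF X.perm X.root, of k] x by (metis inj_onD)
  then show ?thesis unfolding X.time_def Y.time_def by simp
qed

section \<open>Isomorphisms between exploded trees\<close>

locale phi0_iso = X: planar_explosion N K + Y: planar_explosion N' K'
  for N :: "'h omap" and K and N' :: "'k omap" and K' +
  fixes g :: "'h \<Rightarrow> 'k"
  assumes iso: "map_iso g (phi0 N) (phi0 N')"
begin

lemma g_bij: "bij_betw g X.H Y.H" and g_opp: "x \<in> X.H \<Longrightarrow> g (opp N x) = opp N' (g x)"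
  and g_pe: "x \<in> X.H \<Longrightarrow> g (X.pe x) = Y.pe (g x)" and g_root: "g X.r = Y.r"
  using iso by (auto simp: map_iso_def X.phi0_simps Y.phi0_simps)

lemma g_inj: "inj_on g X.H" and g_image: "g ` X.H = Y.H"
  using g_bij by (auto simp: bij_betw_def)

lemma g_in: "x \<in> X.H \<Longrightarrow> g x \<in> Y.H" using g_image by blast

lemma g_eq: "x \<in> X.H \<Longrightarrow> y \<in> X.H \<Longrightarrow> g x = g y \<longleftrightarrow> x = y" using g_inj by (simp add: inj_on_eq_iff)

lemma g_time: "x \<in> X.H \<Longrightarrow> Y.A.time (g x) = X.A.time x"
  by (rule full_cycle_transport[OF X.A.full_cycle_axioms Y.A.full_cycle_axioms g_inj])
    (simp_all add: X.face_def Y.face_def g_pe g_opp g_root X.opp_in)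

lemma g_head: "x \<in> X.H \<Longrightarrow> g x \<in> Y.D \<longleftrightarrow> x \<in> X.D"
proof (cases "x = X.r")
  case True
  then show ?thesis using X.root_head Y.root_head g_root by simp
next
  assume x: "x \<in> X.H"
  case False
  then have "g x \<noteq> Y.r" using g_eq[OF x X.root] g_root by simp
  then show ?thesis
    using X.head_iff_time[OF x False] Y.head_iff_time[OF g_in[OF x]] g_time[OF x] g_time[of "opp N x"]
      g_opp[OF x] X.opp_in[of x] x by simp
qed

lemma g_heads: "g ` X.D = Y.D"
proof
  show "g ` X.D \<subseteq> Y.D" using g_head X.head_in by blast
  show "Y.D \<subseteq> g ` X.D"
  proof
    fix y assume y: "y \<in> Y.D"
    then obtain x where "x \<in> X.H" "y = g x" using g_image Y.head_in by blast
    then show "y \<in> g ` X.D" using g_head y by blast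
  qed
qed

lemma g_tm: "h \<in> X.D \<Longrightarrow> Y.tm (g h) = X.tm h"
  using g_time[of "opp N h"] g_opp[of h] X.head_in[of h] X.opp_in[of h] by (simp add: X.tm_def Y.tm_def)

lemma g_rk: "h \<in> X.D \<Longrightarrow> Y.rk (g h) = X.rk h"
proof -
  assume h: "h \<in> X.D"
  have "{h' \<in> Y.D. Y.tm h' < Y.tm (g h)} = g ` {h' \<in> X.D. X.tm h' < X.tm h}"
    unfolding g_heads[symmetric] using g_tm h by auto
  moreover have "inj_on g {h' \<in> X.D. X.tm h' < X.tm h}"
    using g_inj by (rule inj_on_subset) (use X.head_in in blast)
  ultimately show ?thesis by (simp add: X.rk_def Y.rk_def card_image)
qed

lemma phi1_eq_iff:
  "phi1 N = phi1 N' \<longleftrightarrow> (\<forall>h\<in>X.D. \<forall>h'\<in>X.D.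
     orbit (rot N) h = orbit (rot N) h' \<longleftrightarrow> orbit (rot N') (g h) = orbit (rot N') (g h'))"
  (is "?L \<longleftrightarrow> ?R")
proof
  assume L: ?L
  show ?R
  proof (intro ballI)
    fix h h' assume h: "h \<in> X.D" "h' \<in> X.D"
    then show "orbit (rot N) h = orbit (rot N) h' \<longleftrightarrow> orbit (rot N') (g h) = orbit (rot N') (g h')"
      using X.phi1_iff[OF h] Y.phi1_iff[of "g h" "g h'"] g_heads g_rk L by auto
  qed
next
  assume R: ?R
  have "phi1 N' = {(Y.rk (g h), Y.rk (g h')) | h h'. h \<in> X.D \<and> h' \<in> X.D \<and>
      orbit (rot N') (g h) = orbit (rot N') (g h')}"
    unfolding Y.phi1_eq g_heads[symmetric] by blast
  also have "\<dots> = {(X.rk h, X.rk h') | h h'. h \<in> X.D \<and> h' \<in> X.D \<and>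
      orbit (rot N) h = orbit (rot N) h'}"
    using R g_rk by (auto; metis)
  finally show ?L unfolding X.phi1_eq by simp
qed

text \<open>Equal partitions make \<open>g\<close> match the orbits of the two permutations
  \<open>\<sigma>\<close>, hence the permutations themselves by \<open>genus_zero_transport\<close>.
  Undoing the conjugation gives \<open>\<rho>\<close>, and then \<open>rot\<close> as
  \<open>pe \<circ> \<rho>\<close>.\<close>

lemma glue_iso:
  assumes phi1: "phi1 N = phi1 N'"
  shows "map_iso g N N'"
proof -
  have \<rho>: "g (X.\<rho> x) = Y.\<rho> (g x)" if x: "x \<in> X.H" for x
  proof -
    have orb: "orbit Y.\<sigma> (g z) = g ` orbit X.\<sigma> z" if z: "z \<in> X.H" for z
    proof -
      define y where "y = opp N z"
      have y: "y \<in> X.H" "z = opp N y" using z X.opp_in X.opp_opp by (auto simp: y_def)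
      have sub: "orbit X.\<rho> y \<subseteq> X.H" by (rule permutes_orbit_subset[OF X.\<rho>_permutes_H y(1)])
      have "orbit Y.\<rho> (g y) = g ` orbit X.\<rho> y"
      proof (cases "y \<in> X.D")
        case False
        then show ?thesis using g_head[OF y(1)] by (simp add: X.orbit_\<rho>_tail Y.orbit_\<rho>_tail)
      next
        case True
        have "g h \<in> orbit (rot N') (g y) \<longleftrightarrow> h \<in> orbit (rot N) y" if "h \<in> X.D" for h
          using phi1[unfolded phi1_eq_iff] True that permutes_orbit_iff[OF X.rot X.fin, of h y]
            permutes_orbit_iff[OF Y.rot Y.fin, of "g h" "g y"] by blast
        then have "orbit (rot N') (g y) \<inter> g ` X.D = g ` (orbit (rot N) y \<inter> X.D)" by blast
        then show ?thesis
          using True g_heads g_head[OF y(1)] by (simp add: X.orbit_\<rho> Y.orbit_\<rho>)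
      qed
      then have "orbit Y.\<sigma> (opp N' (g y)) = opp N' ` g ` orbit X.\<rho> y"
        using Y.orbit_\<sigma>[OF g_in[OF y(1)]] by simp
      also have "\<dots> = g ` opp N ` orbit X.\<rho> y" using g_opp sub by (force simp: image_iff)
      finally show ?thesis using X.orbit_\<sigma>[OF y(1)] g_opp[OF y(1)] y(2) by simp
    qed
    have oH: "opp N x \<in> X.H" and pH: "X.\<rho> x \<in> X.H"
      using x X.opp_in permutes_in_image[OF X.\<rho>_permutes_H] by auto
    have "g (X.\<sigma> (opp N x)) = Y.\<sigma> (g (opp N x))"
      by (rule genus_zero_transport[OF X.A.genus_zero_axioms Y.A.genus_zero_axioms g_image _ orb oH])
        (use g_time in auto)
    then have "opp N' (g (X.\<rho> x)) = opp N' (Y.\<rho> (g x))"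
      by (simp add: X.\<sigma>_opp Y.\<sigma>_opp g_opp[OF x] g_opp[OF pH])
    then show ?thesis using Y.opp_opp by metis
  qed
  have "g (rot N x) = rot N' (g x)" if x: "x \<in> X.H" for x
    using g_pe[of "X.\<rho> x"] \<rho>[OF x] x permutes_in_image[OF X.\<rho>_permutes_H] by (simp add: X.pe_\<rho> Y.pe_\<rho>)
  then show ?thesis using g_bij g_opp g_root by (simp add: map_iso_def)
qed

end

lemma first_head_transport:
  assumes "map_iso g N N'" "g ` heads N = heads N'" "heads N \<subseteq> half_edges N"
    "rot N permutes half_edges N" "x \<in> half_edges N"
    and ex: "\<exists>k. (rot N ^^ k) x \<in> heads N"
  shows "g (first_head N x) = first_head N' (g x)"
proof -
  have inj: "inj_on g (half_edges N)" and step: "\<And>x. x \<in> half_edges N \<Longrightarrow> g (rot N x) = rot N' (g x)"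
    using assms(1) by (auto simp: map_iso_def bij_betw_def)
  have pow: "g ((rot N ^^ k) x) = (rot N' ^^ k) (g x)" for k
    by (rule transport_funpow[where q = "rot N'" and H = "half_edges N"]) (use assms step in auto)
  have "(rot N' ^^ k) (g x) \<in> heads N' \<longleftrightarrow> (rot N ^^ k) x \<in> heads N" for k
    unfolding pow[symmetric] assms(2)[symmetric]
    by (rule inj_on_image_mem_iff[OF inj permutes_funpow_in[OF assms(4,5)] assms(3)])
  then show ?thesis by (simp add: first_head_def pow)
qed

lemma phi0_transport:
  assumes "explosion N K" "explosion N' K'" "map_iso g N N'" "g ` heads N = heads N'"
  shows "map_iso g (phi0 N) (phi0 N')"
proof -
  interpret X: explosion N K by fact
  interpret Y: explosion N' K' by fact
  have g: "bij_betw g X.H Y.H" "\<And>x. x \<in> X.H \<Longrightarrow> g (rot N x) = rot N' (g x)"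
    "\<And>x. x \<in> X.H \<Longrightarrow> g (opp N x) = opp N' (g x)" "g X.r = Y.r"
    using assms(3) by (auto simp: map_iso_def)
  have inj: "inj_on g X.H" and im: "g ` X.H = Y.H" using g(1) by (auto simp: bij_betw_def)
  have nh: "g (X.nh x) = Y.nh (g x)" if "x \<in> X.H" for x
    by (rule first_head_transport[OF assms(3,4) X.heads_sub X.rot that X.ex_head[OF that]])
  have "g (X.pe x) = Y.pe (g x)" if x: "x \<in> X.H" for x
  proof -
    have "g ` X.grp (X.nh x) = Y.grp (Y.nh (g x))"
    proof
      show "g ` X.grp (X.nh x) \<subseteq> Y.grp (Y.nh (g x))"
        using nh x im by (auto simp: X.grp_def Y.grp_def) metis
      show "Y.grp (Y.nh (g x)) \<subseteq> g ` X.grp (X.nh x)"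
      proof
        fix z assume z: "z \<in> Y.grp (Y.nh (g x))"
        then obtain y where y: "y \<in> X.H" "z = g y" using im by (auto simp: Y.grp_def)
        then have "g (X.nh y) = g (X.nh x)" using z nh x by (simp add: Y.grp_def)
        then have "X.nh y = X.nh x"
          by (rule inj_onD[OF inj]) (use y x X.nh_in X.head_in in auto)
        then show "z \<in> g ` X.grp (X.nh x)" using y by (simp add: X.grp_def)
      qed
    qed
    moreover have "g (first_return (rot N) (X.grp (X.nh x)) x) =
        first_return (rot N') (g ` X.grp (X.nh x)) (g x)"
      by (rule transport_first_return[OF X.rot _ inj _ x]) (use g in \<open>auto simp: X.grp_def\<close>)
    ultimately show ?thesis by (simp add: X.pe_eq Y.pe_eq)
  qed
  then show ?thesis using g by (simp add: map_iso_def X.phi0_simps Y.phi0_simps)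
qed

lemma phi1_transport:
  assumes "planar_explosion N K" "planar_explosion N' K'" "map_iso g N N'" "g ` heads N = heads N'"
  shows "phi1 N = phi1 N'"
proof -
  interpret X: planar_explosion N K by fact
  interpret Y: planar_explosion N' K' by fact
  interpret phi0_iso N K N' K' g
    by unfold_locales (rule phi0_transport[OF X.explosion_axioms Y.explosion_axioms assms(3,4)])
  have "orbit (rot N) h = orbit (rot N) h' \<longleftrightarrow> orbit (rot N') (g h) = orbit (rot N') (g h')"
    if h: "h \<in> X.D" "h' \<in> X.D" for h h'
  proof -
    have t: "g ` orbit (rot N) y = orbit (rot N') (g y)" if "y \<in> X.H" for y
      by (rule transport_orbit[OF X.rot X.fin _ that]) (use assms(3) in \<open>auto simp: map_iso_def\<close>)
    have sub: "orbit (rot N) y \<subseteq> X.H" if "y \<in> X.H" for y by (rule permutes_orbit_subset[OF X.rot that])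
    have "h \<in> X.H" "h' \<in> X.H" using h X.head_in by auto
    then show ?thesis
      using t[of h] t[of h'] inj_on_image_eq_iff[OF g_inj sub sub] by metis
  qed
  then show ?thesis using phi1_eq_iff by blast
qed

section \<open>The exploded tree-rooted map\<close>

context tree_map
begin

lemma delta_simps:
  "half_edges (delta M) = half_edges M" "rot (delta M) = rot M" "opp (delta M) = opp M"
  "root_he (delta M) = root_he M" "vertices (delta M) = vertices M" "faces (delta M) = faces M"
  "edges (delta M) = edges M"
  by (simp_all add: delta_def vertices_def vertex_of_def faces_def edges_def)

text \<open>A new vertex hangs from one whose head comes later in the tour of the spanning tree. The
  root has tour time 0 but is the ancestor of all, so it is placed above the maximum.\<close>

definition key where
  "key h = (if h = root_he M then Suc (Max (T.time ` half_edges M)) else T.time h)"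

text \<open>Iterates \<open>tail_step\<close> along a run of tails around a vertex; the head that
  ends the run may be included.\<close>

lemma tails_time:
  assumes "t \<in> half_edges M" "\<And>j. j < i \<Longrightarrow> (rot M ^^ j) t \<notin> heads (delta M)" "(rot M ^^ i) t \<noteq> root_he M"
  shows "T.time t \<le> T.time ((rot M ^^ i) t)"
    "0 < i \<Longrightarrow> t \<in> tree M \<Longrightarrow> T.time (opp M t) < T.time ((rot M ^^ i) t)"
proof -
  have "T.time t \<le> T.time ((rot M ^^ i) t) \<and>
    (0 < i \<longrightarrow> t \<in> tree M \<longrightarrow> T.time (opp M t) < T.time ((rot M ^^ i) t))"
    using assms(2,3)
  proof (induction i)
    case (Suc i)
    let ?x = "(rot M ^^ i) t"
    have x: "?x \<in> half_edges M" "?x \<notin> heads (delta M)" "rot M ?x \<noteq> root_he M"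
      using permutes_funpow_in[OF M(3) assms(1)] Suc.prems by auto
    then have "?x \<noteq> root_he M" using heads_delta by auto
    then have IH: "T.time t \<le> T.time ?x" "0 < i \<Longrightarrow> t \<in> tree M \<Longrightarrow> T.time (opp M t) < T.time ?x"
      using Suc.IH Suc.prems by auto
    have "T.time ?x < T.time (rot M ?x)" by (rule tail_step(1)[OF x])
    moreover have "t \<in> tree M \<Longrightarrow> T.time (opp M t) < T.time (rot M ?x)"
      using IH(2) tail_step[OF x] by (cases "i = 0") auto
    ultimately show ?case using IH by simp
  qed simp
  then show "T.time t \<le> T.time ((rot M ^^ i) t)"
    "0 < i \<Longrightarrow> t \<in> tree M \<Longrightarrow> T.time (opp M t) < T.time ((rot M ^^ i) t)" by auto
qed

text \<open>Outside the tree \<open>h\<close> precedes its tail \<open>t\<close> by orientation, and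
  times grow from \<open>t\<close> to the next head. For a tree edge \<open>h\<close> is later than
  \<open>t\<close>, but the tour passes from \<open>h\<close> to the half-edge after
  \<open>t\<close>, so the next head is later still.\<close>

sublocale E: planar_explosion "delta M" key
proof unfold_locales
  fix h assume h: "h \<in> heads (delta M)" "h \<noteq> root_he (delta M)"
  then have hH: "h \<in> half_edges M" and hr: "h \<noteq> root_he M" using heads_sub by (auto simp: delta_simps)
  define t where "t = opp M h"
  have t: "t \<in> half_edges M" "t \<notin> heads (delta M)" "opp M t = h"
    using hH M(5,8) opp_heads[OF hH hr] h by (auto simp: t_def)
  define k where "k = (LEAST k. (rot M ^^ k) t \<in> heads (delta M))"
  have fh: "first_head (delta M) t = (rot M ^^ k) t" by (simp add: first_head_def delta_simps k_def)
  obtain y where y: "y \<in> vx t" "y \<in> heads (delta M)" using vertex_has_head[OF t(1)] by blast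
  then obtain i where "(rot M ^^ i) t = y" using permutes_orbit_funpow[OF M(3,1)] by blast
  then have "\<exists>k. (rot M ^^ k) t \<in> heads (delta M)" using y by blast
  then have kD: "(rot M ^^ k) t \<in> heads (delta M)" unfolding k_def by (rule LeastI_ex)
  have tails: "(rot M ^^ j) t \<notin> heads (delta M)" if "j < k" for j
    using not_less_Least that unfolding k_def by blast
  have k0: "0 < k" using kD t(2) by (cases k) auto
  have "key h < key ((rot M ^^ k) t)"
  proof (cases "(rot M ^^ k) t = root_he M")
    case True
    have "T.time h \<le> Max (T.time ` half_edges M)" using hH M(1) by simp
    then show ?thesis using True hr by (simp add: key_def)
  next
    case False
    have "T.time h < T.time ((rot M ^^ k) t)"
    proof (cases "h \<in> tree M")
      case True
      then show ?thesis using tails_time(2)[OF t(1) tails False k0] opp_tree[of h] t by (simp add: t_def)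
    next
      case nt: False
      then have "T.time h < T.time t" using h(1) hr Desc_iff by (auto simp: heads_delta t_def)
      then show ?thesis using tails_time(1)[OF t(1) tails False] by simp
    qed
    then show ?thesis using False hr by (simp add: key_def)
  qed
  then show "key h < key (first_head (delta M) (opp (delta M) h))"
    by (simp add: delta_simps(3) fh flip: t_def)
qed (use M heads_sub opp_heads vertex_has_head in \<open>auto simp: delta_simps heads_delta\<close>)

text \<open>The two rules of orientation are opposite: in the tree the head is the half met later,
  outside it the half met earlier.\<close>

lemma tree_iff:
  assumes "x \<in> half_edges M" "x \<noteq> root_he M"
  shows "x \<in> tree M \<longleftrightarrow> (x \<in> heads (delta M) \<longleftrightarrow> T.time (opp M x) < T.time x)"
proof -
  have "T.time x \<noteq> T.time (opp M x)" using T.time_inj[of x "opp M x"] assms M(8)[of x] opp_neq[of x] by simp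
  then show ?thesis using assms Desc_iff[of x] by (auto simp: heads_delta)
qed

end

locale tree_map_pair = X: tree_map M + Y: tree_map M'
  for M :: "'h tree_rmap" and M' :: "'k tree_rmap" +
  fixes g :: "'h \<Rightarrow> 'k"
begin

lemma delta_iso:
  assumes "tree_rooted_iso g M M'"
  shows "map_iso g (delta M) (delta M')" "g ` heads (delta M) = heads (delta M')"
proof -
  let ?H = "half_edges M" and ?H' = "half_edges M'"
  have g: "bij_betw g ?H ?H'" "\<And>x. x \<in> ?H \<Longrightarrow> g (rot M x) = rot M' (g x)"
    "\<And>x. x \<in> ?H \<Longrightarrow> g (opp M x) = opp M' (g x)" "g (root_he M) = root_he M'" "g ` tree M = tree M'"
    using assms by (auto simp: tree_rooted_iso_def map_iso_def)
  have inj: "inj_on g ?H" and im: "g ` ?H = ?H'" using g(1) by (auto simp: bij_betw_def)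
  show "map_iso g (delta M) (delta M')" using g by (simp add: map_iso_def X.delta_simps Y.delta_simps)
  have tree: "g x \<in> tree M' \<longleftrightarrow> x \<in> tree M" if "x \<in> ?H" for x
    using inj_on_image_mem_iff[OF inj that X.tree_sub] g(5) by simp
  have root: "g x = root_he M' \<longleftrightarrow> x = root_he M" if "x \<in> ?H" for x
    using inj_on_eq_iff[OF inj that X.M(2)] g(4) by simp
  have flip: "g (X.flip x) = Y.flip (g x)" if "x \<in> ?H" for x
    using that tree g(3) by (simp add: tree_flip_def)
  have time: "Y.T.time (g x) = X.T.time x" if "x \<in> ?H" for x
    by (rule full_cycle_transport[OF X.T.full_cycle_axioms Y.T.full_cycle_axioms inj _ g(4) that])
      (use flip g(2) X.flip_in in \<open>simp add: X.tour_eq Y.tour_eq\<close>)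
  have heads: "g x \<in> heads (delta M') \<longleftrightarrow> x \<in> heads (delta M)" if x: "x \<in> ?H" for x
  proof -
    have gx: "g x \<in> ?H'" using im x by blast
    have ox: "opp M x \<in> ?H" using X.M(8) x by simp
    have t: "Y.T.time (opp M' (g x)) = X.T.time (opp M x)" using time[OF ox] g(3)[OF x] by simp
    show ?thesis
      unfolding X.heads_delta Y.heads_delta using x gx root[OF x] tree[OF x] time[OF x] t
      by (simp add: X.Desc_iff Y.Desc_iff)
  qed
  show "g ` heads (delta M) = heads (delta M')"
  proof
    show "g ` heads (delta M) \<subseteq> heads (delta M')" using heads X.heads_sub by blast
    show "heads (delta M') \<subseteq> g ` heads (delta M)"
    proof
      fix y assume y: "y \<in> heads (delta M')"
      then obtain x where "x \<in> ?H" "y = g x" using im Y.heads_sub by blast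
      then show "y \<in> g ` heads (delta M)" using heads y by blast
    qed
  qed
qed

text \<open>The orientation determines the tree: the tour follows an edge at its tail iff it has not
  met the head before.\<close>

lemma tree_rooted_isoI:
  assumes iso: "map_iso g (delta M) (delta M')" and hd: "g ` heads (delta M) = heads (delta M')"
  shows "tree_rooted_iso g M M'"
proof -
  let ?H = "half_edges M" and ?H' = "half_edges M'"
  have g: "bij_betw g ?H ?H'" "\<And>x. x \<in> ?H \<Longrightarrow> g (rot M x) = rot M' (g x)"
    "\<And>x. x \<in> ?H \<Longrightarrow> g (opp M x) = opp M' (g x)" "g (root_he M) = root_he M'"
    using iso by (auto simp: map_iso_def X.delta_simps Y.delta_simps)
  have inj: "inj_on g ?H" and im: "g ` ?H = ?H'" using g(1) by (auto simp: bij_betw_def)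
  have root: "g x = root_he M' \<longleftrightarrow> x = root_he M" if "x \<in> ?H" for x
    using inj_on_eq_iff[OF inj that X.M(2)] g(4) by simp
  have heads: "g x \<in> heads (delta M') \<longleftrightarrow> x \<in> heads (delta M)" if "x \<in> ?H" for x
    using inj_on_image_mem_iff[OF inj that X.heads_sub] hd by simp
  \<comment> \<open>Both parts need a common induction on time: membership of \<open>y\<close> in
    the tree decides where the tour goes next, and by \<open>tree_iff\<close> membership of
    \<open>x\<close> depends on the heads and on whether \<open>opp M x\<close> has been met
    before.\<close>
  have main: "Y.T.time (g x) = X.T.time x \<and> (g x \<in> tree M' \<longleftrightarrow> x \<in> tree M)" if "x \<in> ?H" for x
    using that
  proof (induction "X.T.time x" arbitrary: x rule: less_induct)
    case less
    note x = less.prems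
    have gx: "g x \<in> ?H'" using im x by blast
    show ?case
    proof (cases "x = root_he M")
      case True
      then show ?thesis using g(4) X.root_notin_tree Y.root_notin_tree by simp
    next
      case False
      obtain y where y: "x = X.tour y" by (metis permutes_surj[OF X.tour_permutes] surjD)
      have yH: "y \<in> ?H" using x y permutes_in_image[OF X.tour_permutes] by simp
      have ty: "X.T.time x = Suc (X.T.time y)" using X.T.time_step[OF yH] False y by simp
      have IHy: "Y.T.time (g y) = X.T.time y" "g y \<in> tree M' \<longleftrightarrow> y \<in> tree M"
        using less.hyps[OF _ yH] ty by auto
      have "g (X.flip y) = Y.flip (g y)" using IHy g(3)[OF yH] by (simp add: tree_flip_def)
      then have "g x = Y.tour (g y)" using g(2)[of "X.flip y"] X.flip_in yH y by (simp add: X.tour_eq Y.tour_eq)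
      moreover have "g y \<in> ?H'" using im yH by blast
      ultimately have time: "Y.T.time (g x) = X.T.time x"
        using Y.T.time_step[of "g y"] root[OF x] False IHy ty by simp
      have ox: "opp M x \<in> ?H" using X.M(8) x by simp
      have "Y.T.time (opp M' (g x)) < Y.T.time (g x) \<longleftrightarrow> X.T.time (opp M x) < X.T.time x"
      proof
        assume "X.T.time (opp M x) < X.T.time x"
        then show "Y.T.time (opp M' (g x)) < Y.T.time (g x)"
          using less.hyps[OF _ ox] g(3)[OF x] time by simp
      next
        assume lt: "Y.T.time (opp M' (g x)) < Y.T.time (g x)"
        \<comment> \<open>The half-edge of \<open>M\<close> visited at this same earlier time
          corresponds to \<open>opp M' (g x)\<close> by induction, so it is
          \<open>opp M x\<close>.\<close>
        define m where "m = Y.T.time (opp M' (g x))"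
        define z where "z = (X.tour ^^ m) (root_he M)"
        have zH: "z \<in> ?H" unfolding z_def by (rule permutes_funpow_in[OF X.tour_permutes X.M(2)])
        have tz: "X.T.time z = m" unfolding z_def by (rule X.T.time_funpow[OF _ x]) (use lt time m_def in simp)
        then have "Y.T.time (g z) = m" using less.hyps[OF _ zH] lt time m_def by simp
        then have "g z = opp M' (g x)"
          using Y.T.time_inj[of "g z" "opp M' (g x)"] im zH Y.M(8) gx m_def by blast
        then have "g z = g (opp M x)" using g(3)[OF x] by simp
        then have "z = opp M x" using inj zH ox by (simp add: inj_on_eq_iff)
        then show "X.T.time (opp M x) < X.T.time x" using tz lt time m_def by simp
      qed
      then show ?thesis
        using time X.tree_iff[OF x False] Y.tree_iff[OF gx] root[OF x] False heads[OF x] by simp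
    qed
  qed
  have "g ` tree M = tree M'"
  proof
    show "g ` tree M \<subseteq> tree M'" using main X.tree_sub by blast
    show "tree M' \<subseteq> g ` tree M"
    proof
      fix y assume y: "y \<in> tree M'"
      then obtain x where "x \<in> ?H" "y = g x" using im Y.tree_sub by blast
      then show "y \<in> g ` tree M" using main y by blast
    qed
  qed
  then show ?thesis using g by (simp add: tree_rooted_iso_def map_iso_def)
qed

theorem phi_injective:
  assumes "map_iso g (phi0 (delta M)) (phi0 (delta M'))" "phi1 (delta M) = phi1 (delta M')"
  shows "tree_rooted_iso g M M'"
proof -
  interpret I: phi0_iso "delta M" X.key "delta M'" Y.key g
    by unfold_locales (rule assms(1))
  show ?thesis by (rule tree_rooted_isoI[OF I.glue_iso[OF assms(2)] I.g_heads])
qed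

theorem phi_well_defined:
  assumes "tree_rooted_iso g M M'"
  shows "map_iso g (phi0 (delta M)) (phi0 (delta M'))" "phi1 (delta M) = phi1 (delta M')"
  using phi0_transport[OF X.E.explosion_axioms Y.E.explosion_axioms delta_iso[OF assms]]
    phi1_transport[OF X.E.planar_explosion_axioms Y.E.planar_explosion_axioms delta_iso[OF assms]]
  by auto

end

section \<open>Counting walks\<close>

text \<open>Walks of \<open>n\<close> unit steps from \<open>x\<close> to 0; the values are integers
  because the reflection principle subtracts them.\<close>

fun free_walks :: "nat \<Rightarrow> int \<Rightarrow> int" where
  "free_walks 0 x = (if x = 0 then 1 else 0)"
| "free_walks (Suc n) x = free_walks n (x + 1) + free_walks n (x - 1)"

lemma free_walks_neg: "free_walks n (- x) = free_walks n x"
proof (induction n arbitrary: x)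
  case (Suc n)
  then show ?case using Suc[of "x - 1"] Suc[of "x + 1"] by simp
qed simp

lemma free_walks_far: "int n < x \<Longrightarrow> free_walks n x = 0"
  by (induction n arbitrary: x) auto

text \<open>A walk from \<open>2 k - n\<close> to 0 has exactly \<open>k\<close> steps down. The
  recursion is Pascal's rule; for \<open>k = 0\<close> one of the two neighbours is too far from
  0.\<close>

lemma free_walks_binomial: "free_walks n (2 * int k - int n) = int (n choose k)"
proof (induction n arbitrary: k)
  case (Suc n)
  show ?case
  proof (cases k)
    case 0
    have "- 2 - int n = - (int n + 2)" by simp
    then have "free_walks n (- 2 - int n) = free_walks n (int n + 2)" using free_walks_neg by metis
    then show ?thesis using 0 Suc[of 0] free_walks_far[of n "int n + 2"] by simp
  next
    case (Suc l)
    then show ?thesis using Suc.IH[of k] Suc.IH[of l] by (simp add: algebra_simps)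
  qed
qed (auto simp: binomial_eq_0)

lemma card_Cons_Un:
  assumes "a \<noteq> b" "finite X" "finite Y"
  shows "card ((#) a ` X \<union> (if P then (#) b ` Y else {})) = card X + (if P then card Y else 0)"
proof -
  have inj: "inj_on ((#) c) A" for c :: 'a and A by (simp add: inj_on_def)
  have "(#) a ` X \<inter> (if P then (#) b ` Y else {}) = {}" using assms by auto
  then show ?thesis using assms by (simp add: card_Un_disjoint card_image[OF inj])
qed

fun dyck :: "int \<Rightarrow> bool list \<Rightarrow> bool" where
  "dyck h [] \<longleftrightarrow> h = 0"
| "dyck h (b # w) \<longleftrightarrow> 0 \<le> (if b then h + 1 else h - 1) \<and> dyck (if b then h + 1 else h - 1) w"

definition dyck_words :: "nat \<Rightarrow> int \<Rightarrow> bool list set" where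
  "dyck_words n h = {w. length w = n \<and> dyck h w}"

lemma finite_dyck_words: "finite (dyck_words n h)"
  by (rule finite_subset[OF _ finite_lists_length_eq[of UNIV n]]) (auto simp: dyck_words_def)

lemma dyck_words_Suc:
  "0 \<le> h \<Longrightarrow> dyck_words (Suc n) h =
    (#) True ` dyck_words n (h + 1) \<union> (if 1 \<le> h then (#) False ` dyck_words n (h - 1) else {})"
  by (auto simp: dyck_words_def length_Suc_conv split: if_splits)

text \<open>Reflection at height -1: the walks that touch it correspond to walks from
  \<open>- 2 - h\<close>, as many as from \<open>h + 2\<close> by symmetry. For \<open>h = 0\<close>
  the missing step down is harmless, since the difference vanishes at height -1.\<close>

lemma card_dyck_words: "0 \<le> h \<Longrightarrow> int (card (dyck_words n h)) = free_walks n h - free_walks n (h + 2)"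
proof (induction n arbitrary: h)
  case 0
  have "dyck_words 0 h = (if h = 0 then {[]} else {})" by (auto simp: dyck_words_def)
  then show ?case using 0 by simp
next
  case (Suc n)
  have "card (dyck_words (Suc n) h) = card (dyck_words n (h + 1)) + (if 1 \<le> h then card (dyck_words n (h - 1)) else 0)"
    unfolding dyck_words_Suc[OF Suc.prems]
    by (simp add: finite_dyck_words card_Cons_Un)
  then show ?case
    using Suc.IH[of "h + 1"] Suc.IH[of "h - 1"] Suc.prems free_walks_neg[of n 1]
    by (cases "h = 0") (simp_all add: algebra_simps)
qed

text \<open>Letters \<open>(t, b)\<close>: the component moves in direction \<open>b\<close>, the first one if \<open>t\<close>.\<close>

fun quadrant :: "int \<Rightarrow> int \<Rightarrow> (bool \<times> bool) list \<Rightarrow> bool" where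
  "quadrant p q [] \<longleftrightarrow> p = 0 \<and> q = 0"
| "quadrant p q ((t, b) # w) \<longleftrightarrow>
     (if t then 0 \<le> (if b then p + 1 else p - 1) \<and> quadrant (if b then p + 1 else p - 1) q w
      else 0 \<le> (if b then q + 1 else q - 1) \<and> quadrant p (if b then q + 1 else q - 1) w)"

definition quadrant_walks :: "nat \<Rightarrow> int \<Rightarrow> int \<Rightarrow> (bool \<times> bool) list set" where
  "quadrant_walks n p q = {w. length w = n \<and> quadrant p q w}"

lemma finite_quadrant_walks: "finite (quadrant_walks n p q)"
  by (rule finite_subset[OF _ finite_lists_length_eq[of UNIV n]]) (auto simp: quadrant_walks_def)

lemma quadrant_walks_Suc:
  "0 \<le> p \<Longrightarrow> 0 \<le> q \<Longrightarrow> quadrant_walks (Suc n) p q =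
    ((#) (True, True) ` quadrant_walks n (p + 1) q \<union>
     (if 1 \<le> p then (#) (True, False) ` quadrant_walks n (p - 1) q else {})) \<union>
    ((#) (False, True) ` quadrant_walks n p (q + 1) \<union>
     (if 1 \<le> q then (#) (False, False) ` quadrant_walks n p (q - 1) else {}))"
  by (auto simp: quadrant_walks_def length_Suc_conv split: if_splits)

text \<open>In the coordinates \<open>x + y\<close> and \<open>x - y\<close> a planar walk is a pair of independent walks; the
  four terms of \<open>card_quadrant_walks\<close> come from reflecting at the lines \<open>p = -1\<close> and \<open>q = -1\<close>.\<close>

definition free_plane_walks :: "nat \<Rightarrow> int \<Rightarrow> int \<Rightarrow> int" where
  "free_plane_walks n x y = free_walks n (x + y) * free_walks n (x - y)"

lemma free_plane_walks_Suc:
  "free_plane_walks (Suc n) x y = free_plane_walks n (x + 1) y + free_plane_walks n (x - 1) y +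
     free_plane_walks n x (y + 1) + free_plane_walks n x (y - 1)"
proof -
  have e: "x + 1 + y = x + y + 1" "x + (y + 1) = x + y + 1" "x - 1 + y = x + y - 1" "x + (y - 1) = x + y - 1"
    "x + 1 - y = x - y + 1" "x - (y - 1) = x - y + 1" "x - 1 - y = x - y - 1" "x - (y + 1) = x - y - 1"
    by simp_all
  define a b c d where "a = free_walks n (x + y + 1)" "b = free_walks n (x + y - 1)"
    "c = free_walks n (x - y + 1)" "d = free_walks n (x - y - 1)"
  then show ?thesis
    unfolding free_plane_walks_def e free_walks.simps(2) a_b_c_d_def[symmetric] by (simp add: algebra_simps)
qed

lemma free_plane_walks_neg:
  "free_plane_walks n (- x) y = free_plane_walks n x y" "free_plane_walks n x (- y) = free_plane_walks n x y"
  unfolding free_plane_walks_def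
  using free_walks_neg[of n "x + y"] free_walks_neg[of n "x - y"] by (simp_all add: algebra_simps)

lemma card_quadrant_walks:
  "0 \<le> p \<Longrightarrow> 0 \<le> q \<Longrightarrow> int (card (quadrant_walks n p q)) =
     free_plane_walks n p q - free_plane_walks n (p + 2) q - free_plane_walks n p (q + 2)
       + free_plane_walks n (p + 2) (q + 2)"
proof (induction n arbitrary: p q)
  case 0
  have "quadrant_walks 0 p q = (if p = 0 \<and> q = 0 then {[]} else {})" by (auto simp: quadrant_walks_def)
  then show ?case using 0 by (auto simp: free_plane_walks_def)
next
  case (Suc n)
  have "card (quadrant_walks (Suc n) p q) =
     (card (quadrant_walks n (p + 1) q) + (if 1 \<le> p then card (quadrant_walks n (p - 1) q) else 0)) +
     (card (quadrant_walks n p (q + 1)) + (if 1 \<le> q then card (quadrant_walks n p (q - 1)) else 0))"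
    unfolding quadrant_walks_Suc[OF Suc.prems]
    by (subst card_Un_disjoint) (auto simp: finite_quadrant_walks card_Cons_Un)
  \<comment> \<open>At \<open>p = 0\<close> the right-hand side is the formula at -1, on the
    reflecting line, where it cancels by symmetry.\<close>
  moreover have "int (if 1 \<le> p then card (quadrant_walks n (p - 1) q) else 0) =
      free_plane_walks n (p - 1) q - free_plane_walks n (p + 1) q - free_plane_walks n (p - 1) (q + 2)
       + free_plane_walks n (p + 1) (q + 2)"
    using Suc.IH[of "p - 1" q] Suc.prems free_plane_walks_neg(1)[of n 1] by (cases "p = 0") (auto simp: algebra_simps)
  moreover have "int (if 1 \<le> q then card (quadrant_walks n p (q - 1)) else 0) =
      free_plane_walks n p (q - 1) - free_plane_walks n (p + 2) (q - 1) - free_plane_walks n p (q + 1)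
       + free_plane_walks n (p + 2) (q + 1)"
    using Suc.IH[of p "q - 1"] Suc.prems free_plane_walks_neg(2)[of n _ 1] by (cases "q = 0") (auto simp: algebra_simps)
  moreover have e: "x + 1 + 2 = x + 2 + (1::int)" "x + 2 - 1 = x + (1::int)" for x by simp_all
  ultimately show ?case
    using Suc.IH[of "p + 1" q] Suc.IH[of p "q + 1"] Suc.prems
    unfolding free_plane_walks_Suc by (simp only: of_nat_add e)
qed

lemma central_binomials:
  fixes n :: nat
  defines "B \<equiv> real (2 * n choose n)"
  shows "real (2 * n choose (n + 1)) = real n * B / (real n + 1)"
    and "real (2 * n choose (n + 2)) = real n * (real n - 1) * B / ((real n + 1) * (real n + 2))"
    and "real (2 * (n + 1) choose (n + 1)) = 2 * (2 * real n + 1) * B / (real n + 1)"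
proof -
  have step: "(k + 1) * (m choose (k + 1)) = (m - k) * (m choose k)" for m k :: nat
    using binomial_absorb_comp[of m k] Suc_times_binomial_add binomial_absorption[of k m] by simp
  have 1: "(real n + 1) * real (2 * n choose (n + 1)) = real n * B"
    using arg_cong[OF step[of n "2 * n"], of real] by (simp add: B_def algebra_simps)
  then show b2: "real (2 * n choose (n + 1)) = real n * B / (real n + 1)" by (simp add: field_simps)
  have "(real n + 2) * real (2 * n choose (n + 2)) = (real n - 1) * real (2 * n choose (n + 1))"
  proof (cases "n = 0")
    case False
    have "real ((n + 1 + 1) * (2 * n choose (n + 1 + 1))) = real ((2 * n - (n + 1)) * (2 * n choose (n + 1)))"
      using step[of "n + 1" "2 * n"] by simp
    moreover have "real (2 * n - (n + 1)) = real n - 1" using False by (simp add: of_nat_diff)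
    moreover have "real (n + 1 + 1) = real n + 2" "n + 1 + 1 = n + 2" by simp_all
    ultimately show ?thesis by (simp only: of_nat_mult)
  qed simp
  then have "real (2 * n choose (n + 2)) * (real n + 2) = (real n - 1) * (real n * B / (real n + 1))"
    unfolding b2 by (simp add: mult.commute)
  then have "real (2 * n choose (n + 2)) = (real n - 1) * (real n * B / (real n + 1)) / (real n + 2)"
    by (rule eq_divide_imp[rotated]) linarith
  then show "real (2 * n choose (n + 2)) = real n * (real n - 1) * B / ((real n + 1) * (real n + 2))"
    by (simp add: mult_ac)
  have "2 * (n + 1) choose (n + 1) = (2 * n + 1 choose n) + (2 * n + 1 choose (n + 1))"
    by (simp add: numeral_2_eq_2)
  also have "2 * n + 1 choose n = 2 * n + 1 choose (n + 1)"
    using binomial_symmetric[of n "2 * n + 1"] by simp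
  finally have "real (2 * (n + 1) choose (n + 1)) = 2 * real (2 * n + 1 choose (n + 1))" by simp
  also have "(2 * n + 1 choose (n + 1)) = (2 * n choose n) + (2 * n choose (n + 1))" by simp
  finally have "real (2 * (n + 1) choose (n + 1)) = 2 * (B + real n * B / (real n + 1))"
    using b2 by (simp add: B_def)
  also have "\<dots> = 2 * (2 * real n + 1) * B / (real n + 1)" by (simp add: field_simps)
  finally show "real (2 * (n + 1) choose (n + 1)) = 2 * (2 * real n + 1) * B / (real n + 1)" .
qed

lemma free_walks_central: "free_walks (2 * n) 0 = int (2 * n choose n)"
  "free_walks (2 * n) 2 = int (2 * n choose (n + 1))" "free_walks (2 * n) 4 = int (2 * n choose (n + 2))"
  using free_walks_binomial[of "2 * n" n] free_walks_binomial[of "2 * n" "n + 1"]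
    free_walks_binomial[of "2 * n" "n + 2"] by simp_all

lemma card_dyck_words_catalan: "real (card (dyck_words (2 * n) 0)) = catalan n"
proof -
  have "real (card (dyck_words (2 * n) 0)) = real_of_int (int (card (dyck_words (2 * n) 0)))" by simp
  also have "\<dots> = real (2 * n choose n) - real (2 * n choose (n + 1))"
    unfolding card_dyck_words[OF order_refl] by (simp add: free_walks_central)
  finally show ?thesis unfolding central_binomials(1) catalan_def by (simp add: field_simps)
qed

lemma card_quadrant_walks_catalan: "real (card (quadrant_walks (2 * n) 0 0)) = catalan n * catalan (n + 1)"
proof -
  define B where "B = real (2 * n choose n)"
  have m2: "free_walks (2 * n) (- 2) = free_walks (2 * n) 2" by (rule free_walks_neg)
  have "real (card (quadrant_walks (2 * n) 0 0)) = real_of_int (int (card (quadrant_walks (2 * n) 0 0)))" by simp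
  \<comment> \<open>With f(x) for \<open>free_walks (2 * n) x\<close>, the reflected terms at the
    origin are f(0)^2, twice -f(2)^2, and f(4) f(0).\<close>
  also have "\<dots> = B * B - 2 * real (2 * n choose (n + 1)) ^ 2 + real (2 * n choose (n + 2)) * B"
    unfolding card_quadrant_walks[OF order_refl order_refl]
    by (simp add: free_plane_walks_def m2 free_walks_central B_def power2_eq_square)
  also have "\<dots> = B / (real n + 1) * (2 * (2 * real n + 1) * B / (real n + 1) / (real n + 2))"
    unfolding central_binomials(1,2) B_def[symmetric]
  proof -
    have "real n + 1 \<noteq> 0" "real n + 2 \<noteq> 0" by linarith+
    then show "B * B - 2 * (real n * B / (real n + 1))\<^sup>2 +
      real n * (real n - 1) * B / ((real n + 1) * (real n + 2)) * B =
      B / (real n + 1) * (2 * (2 * real n + 1) * B / (real n + 1) / (real n + 2))"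
      by (simp add: divide_simps power2_eq_square) (simp add: algebra_simps)
  qed
  also have "\<dots> = catalan n * catalan (n + 1)"
    unfolding catalan_def central_binomials(3) B_def by (simp add: field_simps)
  finally show ?thesis .
qed

section \<open>Arc diagrams\<close>

text \<open>A point may close one arc and open another, as in the chains of
  \<open>partition_arcs\<close>; matchings add the disjointness of \<open>Domain\<close> and
  \<open>Range\<close>.\<close>

definition arc_diagram :: "(nat \<times> nat) set \<Rightarrow> bool" where
  "arc_diagram E \<longleftrightarrow> finite E \<and> (\<forall>i j. (i, j) \<in> E \<longrightarrow> i < j) \<and>
     (\<forall>i j k. (i, j) \<in> E \<longrightarrow> (i, k) \<in> E \<longrightarrow> j = k) \<and> (\<forall>i j k. (i, k) \<in> E \<longrightarrow> (j, k) \<in> E \<longrightarrow> i = j) \<and>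
     (\<forall>i j k l. (i, j) \<in> E \<longrightarrow> (k, l) \<in> E \<longrightarrow> \<not> (i < k \<and> k < j \<and> j < l))"

lemma arc_diagramD:
  assumes "arc_diagram E"
  shows "finite E" "\<And>i j. (i, j) \<in> E \<Longrightarrow> i < j"
    "\<And>i j k. (i, j) \<in> E \<Longrightarrow> (i, k) \<in> E \<Longrightarrow> j = k"
    "\<And>i j k. (i, k) \<in> E \<Longrightarrow> (j, k) \<in> E \<Longrightarrow> i = j"
    "\<And>i j k l. (i, j) \<in> E \<Longrightarrow> (k, l) \<in> E \<Longrightarrow> i < k \<Longrightarrow> k < j \<Longrightarrow> j < l \<Longrightarrow> False"
  using assms unfolding arc_diagram_def by blast+

text \<open>Take the first closing point \<open>j\<close> at which the diagrams differ, with arcs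
  from \<open>i < i'\<close>. In the diagram of the longer arc \<open>i'\<close> opens an arc as
  well: ending before \<open>j\<close> it would belong to both diagrams, ending after
  \<open>j\<close> it would cross.\<close>

lemma arc_diagram_unique:
  assumes E: "arc_diagram E" and F: "arc_diagram F"
    and dom: "Domain E = Domain F" and ran: "Range E = Range F"
  shows "E = F"
proof (rule ccontr)
  assume "E \<noteq> F"
  define bad where "bad j \<longleftrightarrow> (\<exists>i. (i, j) \<in> E \<union> F \<and> (i, j) \<notin> E \<inter> F)" for j
  have "\<exists>j. bad j" using \<open>E \<noteq> F\<close> unfolding bad_def by auto
  then have j: "bad (LEAST j. bad j)" by (rule LeastI_ex)
  define j where "j = (LEAST j. bad j)"
  have least: "\<not> bad l" if "l < j" for l using not_less_Least[of l bad] that by (simp add: j_def)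
  have key: False
    if X: "arc_diagram X" and Y: "arc_diagram Y" and D: "Domain X = Domain Y"
      and XY: "X \<union> Y = E \<union> F" "X \<inter> Y = E \<inter> F"
      and ij: "(i, j) \<in> X" "(i', j) \<in> Y" "i < i'" for X Y i i'
  proof -
    have "i' \<in> Domain X" using ij D by blast
    then obtain l where l: "(i', l) \<in> X" by blast
    have "l \<noteq> j" using arc_diagramD(4)[OF X] ij l by blast
    moreover have False if "l < j"
    proof -
      have "(i', l) \<in> E \<union> F" using l XY by blast
      then have "(i', l) \<in> E \<inter> F" using least[OF that] unfolding bad_def by blast
      then have "(i', l) \<in> Y" using XY by blast
      then show False using arc_diagramD(3)[OF Y] ij that by blast
    qed
    moreover have False if "j < l"
      using arc_diagramD(5)[OF X ij(1) l ij(3) _ that] arc_diagramD(2)[OF Y ij(2)] by blast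
    ultimately show False by (meson linorder_neqE_nat)
  qed
  obtain i where i: "(i, j) \<in> E \<union> F" "(i, j) \<notin> E \<inter> F" using j unfolding j_def bad_def by blast
  have "j \<in> Range E" "j \<in> Range F" using i ran by auto
  then obtain a b where ab: "(a, j) \<in> E" "(b, j) \<in> F" by blast
  have "a \<noteq> b" using i ab arc_diagramD(4)[OF E] arc_diagramD(4)[OF F] by blast
  then show False
    using key[OF E F dom refl refl ab] key[OF F E dom[symmetric] Un_commute Int_commute ab(2,1)]
    by (meson linorder_neqE_nat)
qed

text \<open>Sending a closing point to its opening point is injective and moves strictly to the
  left.\<close>

lemma arc_diagram_card:
  assumes E: "arc_diagram E"
  shows "card (Range E \<inter> {..k}) \<le> card (Domain E \<inter> {..<k})" "card (Range E) = card E" "card (Domain E) = card E"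
proof -
  define s where "s j = (THE i. (i, j) \<in> E)" for j
  have s: "s j = i" if "(i, j) \<in> E" for i j
    unfolding s_def using that arc_diagramD(4)[OF E] by (intro the_equality) auto
  show "card (Range E \<inter> {..k}) \<le> card (Domain E \<inter> {..<k})"
  proof (rule card_inj_on_le)
    show "inj_on s (Range E \<inter> {..k})"
    proof (rule inj_onI)
      fix x y assume *: "x \<in> Range E \<inter> {..k}" "y \<in> Range E \<inter> {..k}" "s x = s y"
      then obtain a b where "(a, x) \<in> E" "(b, y) \<in> E" by blast
      then show "x = y" using s * arc_diagramD(3)[OF E] by metis
    qed
    show "s ` (Range E \<inter> {..k}) \<subseteq> Domain E \<inter> {..<k}"
    proof clarify
      fix j i assume "j \<le> k" "(i, j) \<in> E"
      then show "s j \<in> Domain E \<inter> {..<k}" using s arc_diagramD(2)[OF E] by fastforce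
    qed
    show "finite (Domain E \<inter> {..<k})" by simp
  qed
  have "inj_on snd E" by (rule inj_onI) (auto dest: arc_diagramD(4)[OF E])
  then show "card (Range E) = card E" using card_image[of snd E] by (simp add: Range_snd)
  have "inj_on fst E" by (rule inj_onI) (auto dest: arc_diagramD(3)[OF E])
  then show "card (Domain E) = card E" using card_image[of fst E] by (simp add: Domain_fst)
qed

lemma card_Int_lessThan_Suc:
  "card (A \<inter> {..<Suc k}) = card (A \<inter> {..<k}) + (if k \<in> A then 1 else 0)"
proof -
  have "A \<inter> {..<Suc k} = (if k \<in> A then insert k (A \<inter> {..<k}) else A \<inter> {..<k})"
    by (auto simp: less_Suc_eq)
  then show ?thesis by simp
qed

text \<open>Match the leftmost closing point with the last opening point before it.\<close>

lemma arc_diagram_exists: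
  assumes "finite A" "finite B" "A \<inter> B = {}"
    and "\<And>k. card (B \<inter> {..<k}) \<le> card (A \<inter> {..<k})" "card A = card B"
  obtains E where "arc_diagram E" "Domain E = A" "Range E = B"
proof -
  have "\<exists>E. arc_diagram E \<and> Domain E = A \<and> Range E = B"
    using assms
  proof (induction "card B" arbitrary: A B)
    case 0
    then show ?case by (intro exI[of _ "{}"]) (auto simp: arc_diagram_def)
  next
    case (Suc m)
    then have "B \<noteq> {}" by auto
    define j where "j = Min B"
    have j: "j \<in> B" "\<And>l. l \<in> B \<Longrightarrow> j \<le> l" using Suc.prems(2) \<open>B \<noteq> {}\<close> by (auto simp: j_def)
    have "B \<inter> {..<Suc j} = {j}" using j by force
    then have "A \<inter> {..<Suc j} \<noteq> {}" using Suc.prems(4)[of "Suc j"] by auto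
    then have ne: "A \<inter> {..<j} \<noteq> {}" using Suc.prems(3) j(1) by (auto simp: less_Suc_eq)
    define i where "i = Max (A \<inter> {..<j})"
    have "i \<in> A \<inter> {..<j}" unfolding i_def using ne by (intro Max_in) auto
    then have i: "i \<in> A" "i < j" by auto
    have imax: "k \<le> i" if "k \<in> A" "k < j" for k unfolding i_def using that by (intro Max_ge) auto
    have "\<exists>E. arc_diagram E \<and> Domain E = A - {i} \<and> Range E = B - {j}"
    proof (rule Suc.hyps(1))
      show "m = card (B - {j})" using Suc.hyps(2) j Suc.prems(2) by simp
      show "card (A - {i}) = card (B - {j})" using Suc.prems i j by simp
      show "(A - {i}) \<inter> (B - {j}) = {}" using Suc.prems by blast
      fix k
      show "card ((B - {j}) \<inter> {..<k}) \<le> card ((A - {i}) \<inter> {..<k})"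
      proof (cases "j < k")
        case True
        have "(B - {j}) \<inter> {..<k} = (B \<inter> {..<k}) - {j}" "(A - {i}) \<inter> {..<k} = (A \<inter> {..<k}) - {i}" by auto
        then show ?thesis using Suc.prems(4)[of k] i j True by simp
      next
        case False
        then have "(B - {j}) \<inter> {..<k} = {}" using j by force
        then show ?thesis by simp
      qed
    qed (use Suc.prems in auto)
    then obtain E where E: "arc_diagram E" "Domain E = A - {i}" "Range E = B - {j}" by blast
    have in_E: "k \<in> A \<and> k \<noteq> i \<and> l \<in> B \<and> l \<noteq> j" if "(k, l) \<in> E" for k l using that E by blast
    have "arc_diagram (insert (i, j) E)"
      unfolding arc_diagram_def
    proof (intro conjI allI impI)
      show "finite (insert (i, j) E)" using arc_diagramD(1)[OF E(1)] by simp
      fix a b c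
      show "(a, b) \<in> insert (i, j) E \<Longrightarrow> a < b" using i arc_diagramD(2)[OF E(1)] by blast
      show "(a, b) \<in> insert (i, j) E \<Longrightarrow> (a, c) \<in> insert (i, j) E \<Longrightarrow> b = c"
        using in_E arc_diagramD(3)[OF E(1)] by blast
      show "(a, c) \<in> insert (i, j) E \<Longrightarrow> (b, c) \<in> insert (i, j) E \<Longrightarrow> a = b"
        using in_E arc_diagramD(4)[OF E(1)] by blast
    next
      fix a b c d
      assume 1: "(a, b) \<in> insert (i, j) E" and 2: "(c, d) \<in> insert (i, j) E"
      show "\<not> (a < c \<and> c < b \<and> b < d)"
      proof
        assume lt: "a < c \<and> c < b \<and> b < d"
        consider "(a, b) = (i, j)" "(c, d) \<in> E" | "(c, d) = (i, j)" "(a, b) \<in> E"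
          | "(a, b) \<in> E" "(c, d) \<in> E" using 1 2 lt by blast
        then show False
        proof cases
          case 1
          then show False using in_E[OF 1(2)] imax[of c] lt by simp
        next
          case 2
          then show False using in_E[OF 2(2)] j(2)[of b] lt by simp
        next
          case 3
          then show False using arc_diagramD(5)[OF E(1)] lt by blast
        qed
      qed
    qed
    moreover have "Domain (insert (i, j) E) = A" "Range (insert (i, j) E) = B" using E i j by auto
    ultimately show ?case by blast
  qed
  then show thesis using that by blast
qed

text \<open>\<open>h\<close> is the height profile of the word, so that Dyck words can be recognised
  from a formula for their heights.\<close>

lemma dyck_map:
  assumes "\<And>k. k < N \<Longrightarrow> h (Suc k) = h k + (if P k then 1 else - 1)" "\<And>k. k \<le> N \<Longrightarrow> 0 \<le> h k" "h N = 0"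
  shows "k \<le> N \<Longrightarrow> dyck (h k) (map P [k..<N])"
proof (induction "N - k" arbitrary: k)
  case 0
  then show ?case using assms(3) by simp
next
  case (Suc d)
  then have k: "k < N" by simp
  have "dyck (h (Suc k)) (map P [Suc k..<N])" using Suc by simp
  then show ?case using assms(1)[OF k] assms(2)[of "Suc k"] k by (auto simp: upt_conv_Cons)
qed

section \<open>Plane trees are determined by Dyck words\<close>

locale plane_tree_map =
  fixes A :: "('h, 'z) rmap_scheme"
  assumes tree: "plane_tree A"
begin

lemma planar: "planar_map A" using tree by (simp add: plane_tree_def)

lemmas M = planar_mapD[OF planar]

abbreviation "H \<equiv> half_edges A"
abbreviation "r \<equiv> root_he A"
abbreviation "a \<equiv> opp A"

definition face where "face x = rot A (a x)"

lemma face_comp: "face = rot A \<circ> a" by (auto simp: face_def)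

lemma face_permutes: "face permutes H"
  unfolding face_comp by (rule permutes_compose[OF M(4,3)])

sublocale T: full_cycle_perm H face r a
proof unfold_locales
  obtain F where F: "faces A = {F}" using tree card_1_singletonE by (auto simp: plane_tree_def)
  have o: "orbit face x = F" if "x \<in> H" for x using F that by (auto simp: M(11) orbits_def face_comp)
  show "H \<subseteq> orbit face r"
    using o permutes_orbit_self[OF face_permutes M(1)] M(2) by blast
qed (use M face_permutes in auto)

lemma face_opp: "face \<circ> a = rot A" by (auto simp: face_def M(5))

lemma time_opp_neq: "x \<in> H \<Longrightarrow> x \<noteq> r \<Longrightarrow> T.time (a x) \<noteq> T.time x"
  using T.time_inj[of "a x" x] M(6,8) by simp

lemma card_Desc: "card (orbits a H) + card T.Desc = card H" "card T.Desc = card (edges A)"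
proof -
  have swap: "a x \<in> T.Desc \<longleftrightarrow> x \<notin> T.Desc" if "x \<in> H - {r}" for x
    using that time_opp_neq[of x] M(5,8) by (auto simp: T.Desc_def)
  have r: "r \<notin> T.Desc" using M(7) by (simp add: T.Desc_def)
  have ar: "a x \<noteq> r" if "x \<noteq> r" for x using that M(5)[of x] M(7) by metis
  have sub: "T.Desc \<subseteq> H - {r}" using r T.Desc_H by blast
  show "card (orbits a H) + card T.Desc = card H"
  proof (rule card_orbits_involution)
    show "a y \<notin> T.Desc" if "y \<in> T.Desc" for y using that swap[of y] sub by blast
    show "a x = x \<or> a x \<in> T.Desc" if "x \<in> H - T.Desc" for x using that swap[of x] M(7) by auto
  qed (use M(1,5,8) sub in auto)
  show "card T.Desc = card (edges A)"
    unfolding edges_def by (rule card_pairs_involution(1)[symmetric]) (use M swap sub ar in auto)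
qed

text \<open>With one face Euler's relation gives one vertex more than edges, and \<open>a\<close>
  has one orbit per edge besides the root; the vertices are the orbits of
  \<open>face \<circ> a\<close>.\<close>

sublocale T: genus_zero H face r a
proof unfold_locales
  have "card (faces A) = 1" using tree by (simp add: plane_tree_def)
  then show "card (orbits (face \<circ> a) H) + card (orbits a H) = Suc (card H)"
    using card_Desc M(9,13) by (simp add: face_opp M(10))
qed

definition arcs where "arcs = {(T.time x, T.time (a x)) | x. x \<in> H \<and> T.time x < T.time (a x)}"

lemma arc_diagram_arcs: "arc_diagram arcs"
proof -
  have e: "x = y" if "x \<in> H" "y \<in> H" "T.time x = T.time y" for x y using that T.time_inj by blast
  have ae: "a x = a y \<Longrightarrow> x = y" for x y using M(5) by metis
  have D: "a x \<in> T.Desc" if "x \<in> H" "T.time x < T.time (a x)" for x using that M(5,8) by (simp add: T.Desc_def)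
  show ?thesis
    unfolding arc_diagram_def
  proof (intro conjI allI impI)
    show "finite arcs" unfolding arcs_def using M(1) by simp
    fix i j k
    show "(i, j) \<in> arcs \<Longrightarrow> i < j" by (auto simp: arcs_def)
    show "(i, j) \<in> arcs \<Longrightarrow> (i, k) \<in> arcs \<Longrightarrow> j = k" unfolding arcs_def using e by blast
    show "(i, k) \<in> arcs \<Longrightarrow> (j, k) \<in> arcs \<Longrightarrow> i = j" unfolding arcs_def using e ae M(8) by blast
  next
    fix i j k l assume "(i, j) \<in> arcs" "(k, l) \<in> arcs"
    then obtain x y where x: "x \<in> H" "i = T.time x" "j = T.time (a x)" "i < j"
      and y: "y \<in> H" "k = T.time y" "l = T.time (a y)" "k < l" unfolding arcs_def by auto
    show "\<not> (i < k \<and> k < j \<and> j < l)"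
      using T.noncrossing_arcs[OF D[OF x(1)] D[OF y(1)]] x y M(5) by auto
  qed
qed

lemma time_image: "T.time ` H = {..2 * card (edges A)}"
  unfolding T.time_image M(13) by auto

lemma Field_arcs: "Domain arcs \<union> Range arcs = {1..2 * card (edges A)}" "Domain arcs \<inter> Range arcs = {}"
proof -
  have ar: "a x \<noteq> r" if "x \<noteq> r" for x using that M(5)[of x] M(7) by metis
  have D: "T.time x \<in> Domain arcs \<longleftrightarrow> T.time x < T.time (a x)" if "x \<in> H" for x
    unfolding arcs_def using that T.time_inj by blast
  have R: "T.time x \<in> Range arcs \<longleftrightarrow> T.time (a x) < T.time x" if x: "x \<in> H" for x
  proof
    assume "T.time x \<in> Range arcs"
    then obtain y where "y \<in> H" "T.time x = T.time (a y)" "T.time y < T.time (a y)" unfolding arcs_def by blast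
    then show "T.time (a x) < T.time x" using T.time_inj[of x "a y"] x M(5,8) by auto
  next
    assume "T.time (a x) < T.time x"
    then have "(T.time (a x), T.time x) \<in> arcs" unfolding arcs_def using x M(5,8) by force
    then show "T.time x \<in> Range arcs" by blast
  qed
  have sub: "Domain arcs \<union> Range arcs \<subseteq> T.time ` H" unfolding arcs_def using M(8) by blast
  have key: "k \<in> Domain arcs \<union> Range arcs \<longleftrightarrow> k \<noteq> 0" if k: "k \<in> T.time ` H" for k
  proof -
    obtain x where x: "x \<in> H" "k = T.time x" using k by blast
    show ?thesis
    proof (cases "x = r")
      case True
      then show ?thesis using D[OF x(1)] R[OF x(1)] x M(7) by simp
    next
      case False
      then show ?thesis using D[OF x(1)] R[OF x(1)] x time_opp_neq[OF x(1)] T.time_eq_0[OF x(1)] by auto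
    qed
  qed
  show "Domain arcs \<union> Range arcs = {1..2 * card (edges A)}"
    using key sub unfolding time_image by (auto simp: Suc_le_eq) blast+
  have "\<not> (k \<in> Domain arcs \<and> k \<in> Range arcs)" if "k \<in> T.time ` H" for k using that D R by force
  then show "Domain arcs \<inter> Range arcs = {}" using sub by blast
qed

text \<open>Time 0 belongs to the root, which lies on no edge; hence the shift by
  \<open>Suc\<close>.\<close>

definition word where "word = map (\<lambda>k. Suc k \<in> Domain arcs) [0..<2 * card (edges A)]"

lemma word_dyck: "word \<in> dyck_words (2 * card (edges A)) 0"
proof -
  \<comment> \<open>The number of arcs that are open after time \<open>k\<close>.\<close>
  define h where "h k = int (card (Domain arcs \<inter> {..<Suc k})) - int (card (Range arcs \<inter> {..<Suc k}))" for k
  have "dyck (h 0) (map (\<lambda>k. Suc k \<in> Domain arcs) [0..<2 * card (edges A)])"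
  proof (rule dyck_map)
    fix k assume "k < 2 * card (edges A)"
    then have "Suc k \<in> Domain arcs \<longleftrightarrow> Suc k \<notin> Range arcs" using Field_arcs by auto
    then show "h (Suc k) = h k + (if Suc k \<in> Domain arcs then 1 else - 1)"
      by (simp add: h_def card_Int_lessThan_Suc[of _ "Suc k"])
  next
    fix k
    have "card (Range arcs \<inter> {..<Suc k}) \<le> card (Domain arcs \<inter> {..<k})"
      using arc_diagram_card(1)[OF arc_diagram_arcs, of k] by (simp add: lessThan_Suc_atMost)
    also have "\<dots> \<le> card (Domain arcs \<inter> {..<Suc k})" by (simp add: card_Int_lessThan_Suc[of _ k])
    finally show "0 \<le> h k" by (simp add: h_def)
  next
    have "Domain arcs \<subseteq> {1..2 * card (edges A)}" "Range arcs \<subseteq> {1..2 * card (edges A)}"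
      using Field_arcs(1) by blast+
    then have "Domain arcs \<inter> {..<Suc (2 * card (edges A))} = Domain arcs"
      "Range arcs \<inter> {..<Suc (2 * card (edges A))} = Range arcs" by force+
    then show "h (2 * card (edges A)) = 0" using arc_diagram_card(2,3)[OF arc_diagram_arcs] by (simp add: h_def)
  qed simp
  moreover have "h 0 = 0"
  proof -
    have "Domain arcs \<subseteq> {1..2 * card (edges A)}" "Range arcs \<subseteq> {1..2 * card (edges A)}"
      using Field_arcs(1) by blast+
    then have "Domain arcs \<inter> {..<Suc 0} = {}" "Range arcs \<inter> {..<Suc 0} = {}" by force+
    then show ?thesis by (simp only: h_def)
  qed
  ultimately show ?thesis by (simp add: dyck_words_def word_def)
qed

end

text \<open>The word tells the opening times, and these determine the arcs. Half-edges are matched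
  by contour time: the arcs give \<open>opp\<close>, the succession of times gives
  \<open>face\<close>, and \<open>rot\<close> is \<open>face\<close> after
  \<open>opp\<close>.\<close>

lemma plane_tree_word_iso:
  assumes "plane_tree A" "plane_tree B" "card (edges A) = card (edges B)"
    and w: "plane_tree_map.word A = plane_tree_map.word B"
  shows "\<exists>g. map_iso g A B"
proof -
  interpret X: plane_tree_map A by unfold_locales fact
  interpret Y: plane_tree_map B by unfold_locales fact
  have d: "Domain X.arcs = Domain Y.arcs"
  proof -
    have "Suc k \<in> Domain X.arcs \<longleftrightarrow> Suc k \<in> Domain Y.arcs" if "k < 2 * card (edges A)" for k
      using w that unfolding X.word_def Y.word_def assms(3) by (auto dest!: map_eq_conv[THEN iffD1])
    moreover have "k - 1 < 2 * card (edges A) \<and> k = Suc (k - 1)" if "k \<in> Domain X.arcs \<union> Domain Y.arcs" for k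
    proof -
      have "k \<in> {1..2 * card (edges A)}" using that X.Field_arcs(1) Y.Field_arcs(1) assms(3) by auto
      then show ?thesis by auto
    qed
    ultimately show ?thesis by (metis UnCI equalityI subsetI)
  qed
  moreover have "Range X.arcs = Range Y.arcs"
  proof -
    have "Range X.arcs = {1..2 * card (edges A)} - Domain X.arcs" using X.Field_arcs by blast
    also have "\<dots> = Range Y.arcs" using Y.Field_arcs d assms(3) by auto
    finally show ?thesis .
  qed
  ultimately have E: "X.arcs = Y.arcs" by (rule arc_diagram_unique[OF X.arc_diagram_arcs Y.arc_diagram_arcs])
  define g where "g x = inv_into Y.H Y.T.time (X.T.time x)" for x
  have g: "g x \<in> Y.H" "Y.T.time (g x) = X.T.time x" if "x \<in> X.H" for x
  proof -
    have "X.T.time x \<in> Y.T.time ` Y.H" using that X.time_image Y.time_image assms(3) by (metis imageI)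
    then show "g x \<in> Y.H" "Y.T.time (g x) = X.T.time x" unfolding g_def
      by (rule inv_into_into, rule f_inv_into_f)
  qed
  have bij: "bij_betw g X.H Y.H"
  proof (rule bij_betw_imageI)
    show inj: "inj_on g X.H"
      by (rule inj_onI) (metis g(2) X.T.time_inj)
    have "card (g ` X.H) = card Y.H" using card_image[OF inj] X.M(13) Y.M(13) assms(3) by simp
    then show "g ` X.H = Y.H" using g(1) by (intro card_subset_eq[OF Y.M(1)]) auto
  qed
  have opp: "g (opp A x) = opp B (g x)" if x: "x \<in> X.H" for x
  proof -
    have ax: "opp A x \<in> X.H" using X.M(8) x by simp
    have arcX: "(X.T.time u, X.T.time (opp A u)) \<in> X.arcs" if "u \<in> X.H" "X.T.time u < X.T.time (opp A u)" for u
      using that by (auto simp: X.arcs_def)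
    have part: "Y.T.time (opp B (g u)) = X.T.time (opp A u) \<and> Y.T.time (opp B (g (opp A u))) = X.T.time u"
      if u: "u \<in> X.H" and lt: "X.T.time u < X.T.time (opp A u)" for u
    proof -
      have au: "opp A u \<in> X.H" using X.M(8) u by simp
      have "(X.T.time u, X.T.time (opp A u)) \<in> Y.arcs" using arcX[OF u lt] E by simp
      then obtain z where z: "z \<in> Y.H" "X.T.time u = Y.T.time z" "X.T.time (opp A u) = Y.T.time (opp B z)"
        unfolding Y.arcs_def by blast
      have "z = g u" using Y.T.time_inj[OF z(1) g(1)[OF u]] g(2)[OF u] z(2) by simp
      moreover have "opp B z = g (opp A u)"
        using Y.T.time_inj[of "opp B z" "g (opp A u)"] g[OF au] z Y.M(8) by simp
      then have "opp B (g (opp A u)) = z" using Y.M(5) by metis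
      ultimately show ?thesis using z by simp
    qed
    have "Y.T.time (opp B (g x)) = X.T.time (opp A x)"
    proof (cases "x = X.r")
      case True
      then have "Y.T.time (g x) = 0" using g(2)[OF x] by simp
      then have "g x = Y.r" using Y.T.time_eq_0[OF g(1)[OF x]] by simp
      then show ?thesis using True X.M(7) Y.M(7) by simp
    next
      case False
      then consider "X.T.time x < X.T.time (opp A x)" | "X.T.time (opp A x) < X.T.time x"
        using X.time_opp_neq[OF x] by linarith
      then show ?thesis
      proof cases
        case 1
        then show ?thesis using part[OF x] by simp
      next
        case 2
        then show ?thesis using part[OF ax] X.M(5) by simp
      qed
    qed
    then show ?thesis
      using Y.T.time_inj[of "opp B (g x)" "g (opp A x)"] g[OF x] g[OF ax] Y.M(8) by simp
  qed
  have root: "g X.r = Y.r"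
    using Y.T.time_eq_0[OF g(1)[OF X.M(2)]] g(2)[OF X.M(2)] by simp
  have face: "g (X.face x) = Y.face (g x)" if x: "x \<in> X.H" for x
  proof -
    have fx: "X.face x \<in> X.H" and fy: "Y.face (g x) \<in> Y.H" using X.T.c_in Y.T.c_in x g(1) by auto
    have "X.T.time (X.face x) = Y.T.time (Y.face (g x))"
      using X.T.time_c[OF x] Y.T.time_c[OF g(1)[OF x]] g(2)[OF x] X.M(13) Y.M(13) assms(3) by simp
    then show ?thesis using Y.T.time_inj[OF g(1)[OF fx] fy] g(2)[OF fx] by simp
  qed
  have "g (rot A x) = rot B (g x)" if x: "x \<in> X.H" for x
    using face[of "opp A x"] opp[OF x] X.M(5,8) Y.M(5) x by (simp add: X.face_def Y.face_def)
  then show ?thesis using bij opp root by (auto simp: map_iso_def)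
qed

section \<open>Non-crossing partitions are determined by Dyck words\<close>

text \<open>Arcs join consecutive points of a block.\<close>

definition partition_arcs :: "(nat \<times> nat) set \<Rightarrow> (nat \<times> nat) set" where
  "partition_arcs R = {(i, j). i < j \<and> (i, j) \<in> R \<and> (\<forall>k. i < k \<longrightarrow> k < j \<longrightarrow> (i, k) \<notin> R)}"

locale nc_partition =
  fixes m :: nat and R :: "(nat \<times> nat) set"
  assumes nc: "R \<in> noncrossing_partitions m"
begin

lemma equiv: "equiv {..<m} R"
  and noncrossing: "(a, c) \<in> R \<Longrightarrow> (b, d) \<in> R \<Longrightarrow> a < b \<Longrightarrow> b < c \<Longrightarrow> c < d \<Longrightarrow> (a, b) \<in> R"
proof -
  show e: "equiv {..<m} R" using nc by (auto simp: noncrossing_partitions_def noncrossing_partition_def)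
  have "R \<subseteq> {..<m} \<times> {..<m}" using e by (rule equivE) (auto simp: refl_on_def)
  then show "(a, c) \<in> R \<Longrightarrow> (b, d) \<in> R \<Longrightarrow> a < b \<Longrightarrow> b < c \<Longrightarrow> c < d \<Longrightarrow> (a, b) \<in> R"
    using nc unfolding noncrossing_partitions_def noncrossing_partition_def by blast
qed

lemma R_sub: "(i, j) \<in> R \<Longrightarrow> i < m \<and> j < m"
  using equiv by (rule equivE) (auto simp: refl_on_def)
lemma R_refl: "i < m \<Longrightarrow> (i, i) \<in> R" using equiv by (auto simp: equiv_def refl_on_def)
lemma R_sym: "(i, j) \<in> R \<Longrightarrow> (j, i) \<in> R" using equiv by (auto simp: equiv_def dest: symD)
lemma R_trans: "(i, j) \<in> R \<Longrightarrow> (j, k) \<in> R \<Longrightarrow> (i, k) \<in> R" using equiv by (auto simp: equiv_def dest: transD)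

abbreviation "E \<equiv> partition_arcs R"

lemma arcs_sub: "E \<subseteq> {..<m} \<times> {..<m}" unfolding partition_arcs_def using R_sub by auto

lemma arc_diagram_E: "arc_diagram E"
  unfolding arc_diagram_def
proof (intro conjI allI impI)
  show "finite E" by (rule finite_subset[OF arcs_sub]) simp
  fix i j k
  show "(i, j) \<in> E \<Longrightarrow> i < j" by (simp add: partition_arcs_def)
  show "(i, j) \<in> E \<Longrightarrow> (i, k) \<in> E \<Longrightarrow> j = k"
    unfolding partition_arcs_def by auto (meson linorder_neqE_nat)
  show "i = j" if "(i, k) \<in> E" "(j, k) \<in> E"
  proof -
    have "(i, j) \<in> R" using that R_sym R_trans unfolding partition_arcs_def by blast
    then show ?thesis using that R_sym unfolding partition_arcs_def by auto (meson linorder_neqE_nat)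
  qed
next
  fix i j k l assume *: "(i, j) \<in> E" "(k, l) \<in> E"
  show "\<not> (i < k \<and> k < j \<and> j < l)"
    using noncrossing[of i j k l] * unfolding partition_arcs_def by auto
qed

lemma R_chain: "(i, j) \<in> R \<Longrightarrow> i \<le> j \<Longrightarrow> (i, j) \<in> E\<^sup>*"
proof (induction "j - i" arbitrary: i rule: less_induct)
  case less
  show ?case
  proof (cases "i = j")
    case False
    define k where "k = (LEAST k. i < k \<and> (i, k) \<in> R)"
    have "i < j \<and> (i, j) \<in> R" using less.prems False by simp
    then have k: "i < k \<and> (i, k) \<in> R" "k \<le> j" unfolding k_def by (rule LeastI, intro Least_le)
    have "(i, k) \<in> E" unfolding partition_arcs_def
      using k not_less_Least[of _ "\<lambda>k. i < k \<and> (i, k) \<in> R"] by (auto simp: k_def[symmetric])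
    have "(k, j) \<in> R" using k less.prems R_sym R_trans by blast
    moreover have "j - k < j - i" using k by linarith
    ultimately have "(k, j) \<in> E\<^sup>*" using less.hyps[of k] k(2) by blast
    with \<open>(i, k) \<in> E\<close> have "(i, j) \<in> E\<^sup>*" by (rule converse_rtrancl_into_rtrancl)
    then show ?thesis .
  qed simp
qed

lemma R_eq: "R = {(i, j). i < m \<and> j < m \<and> ((i, j) \<in> E\<^sup>* \<or> (j, i) \<in> E\<^sup>*)}"
proof -
  have "(i, j) \<in> R" if "(i, j) \<in> E\<^sup>*" "i < m" for i j
    using that by induct (auto simp: R_refl partition_arcs_def intro: R_trans)
  then have "(i, j) \<in> R \<longleftrightarrow> i < m \<and> j < m \<and> ((i, j) \<in> E\<^sup>* \<or> (j, i) \<in> E\<^sup>*)" for i j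
    using R_chain[of i j] R_chain[of j i] R_sub[of i j] R_sym[of i j] R_sym[of j i] nat_le_linear[of i j]
    by blast
  then show ?thesis by auto
qed

text \<open>Two letters per point, \<open>True\<close> being up: a singleton reads up down, the
  first point of a larger block up up, an inner point down up, the last one down down.\<close>

definition letter where "letter k = (if even k then k div 2 \<notin> Range E else k div 2 \<in> Domain E)"

definition word where "word = map letter [0..<2 * m]"

lemma word_dyck: "word \<in> dyck_words (2 * m) 0"
proof -
  define d where "d i = int (card (Domain E \<inter> {..<i})) - int (card (Range E \<inter> {..<i}))" for i
  \<comment> \<open>Twice the number of open arcs before a point, changed by one between its two
    letters; at a closing point an arc is open by \<open>d_ge\<close>, so the height stays
    nonnegative.\<close>
  define h where "h k = 2 * d (k div 2) + (if even k then 0 else if k div 2 \<in> Range E then - 1 else 1)" for k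
  have d_Suc: "d (Suc i) = d i + (if i \<in> Domain E then 1 else 0) - (if i \<in> Range E then 1 else 0)" for i
    by (simp add: d_def card_Int_lessThan_Suc)
  have d_ge: "(if i \<in> Range E then 1 else 0) \<le> d i" for i
  proof -
    have "card (Range E \<inter> {..i}) = card (Range E \<inter> {..<i}) + (if i \<in> Range E then 1 else 0)"
      using card_Int_lessThan_Suc[of "Range E" i] by (simp add: lessThan_Suc_atMost)
    then show ?thesis using arc_diagram_card(1)[OF arc_diagram_E, of i]
      by (cases "i \<in> Range E") (simp_all add: d_def)
  qed
  have "dyck (h 0) (map letter [0..<2 * m])"
  proof (rule dyck_map)
    fix k
    show "h (Suc k) = h k + (if letter k then 1 else - 1)"
    proof (cases "even k")
      case True
      then have "Suc k div 2 = k div 2" by simp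
      then show ?thesis using True by (simp add: h_def letter_def)
    next
      case False
      then have "Suc k div 2 = Suc (k div 2)" by presburger
      then show ?thesis using False by (simp add: h_def letter_def d_Suc)
    qed
    show "0 \<le> h k" using d_ge[of "k div 2"] by (simp add: h_def split: if_splits)
  next
    have "Domain E \<inter> {..<m} = Domain E" "Range E \<inter> {..<m} = Range E" using arcs_sub by auto
    then show "h (2 * m) = 0" using arc_diagram_card(2,3)[OF arc_diagram_E] by (simp add: h_def d_def)
  qed simp
  moreover have "h 0 = 0" by (simp add: h_def d_def)
  ultimately show ?thesis by (simp add: dyck_words_def word_def)
qed

end

lemma card_noncrossing_partitions_le:
  "finite (noncrossing_partitions m)" "card (noncrossing_partitions m) \<le> card (dyck_words (2 * m) 0)"
proof -
  have inj: "inj_on (nc_partition.word m) (noncrossing_partitions m)"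
  proof (rule inj_onI)
    fix R R' assume *: "R \<in> noncrossing_partitions m" "R' \<in> noncrossing_partitions m"
      and w: "nc_partition.word m R = nc_partition.word m R'"
    interpret X: nc_partition m R by unfold_locales fact
    interpret Y: nc_partition m R' by unfold_locales fact
    have l: "X.letter k = Y.letter k" if "k < 2 * m" for k
      using w that unfolding X.word_def Y.word_def by (auto dest!: map_eq_conv[THEN iffD1])
    have r: "i \<in> Range X.E \<longleftrightarrow> i \<in> Range Y.E" and d: "i \<in> Domain X.E \<longleftrightarrow> i \<in> Domain Y.E" if "i < m" for i
      using l[of "2 * i"] l[of "2 * i + 1"] that by (auto simp: X.letter_def Y.letter_def)
    have "X.E = Y.E"
    proof (rule arc_diagram_unique[OF X.arc_diagram_E Y.arc_diagram_E])
      show "Domain X.E = Domain Y.E" using d X.arcs_sub Y.arcs_sub by blast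
      show "Range X.E = Range Y.E" using r X.arcs_sub Y.arcs_sub by blast
    qed
    then show "R = R'" using X.R_eq Y.R_eq by simp
  qed
  have sub: "nc_partition.word m ` noncrossing_partitions m \<subseteq> dyck_words (2 * m) 0"
    using nc_partition.word_dyck nc_partition.intro by blast
  show "finite (noncrossing_partitions m)"
    by (rule finite_imageD[OF finite_subset[OF sub finite_dyck_words] inj])
  show "card (noncrossing_partitions m) \<le> card (dyck_words (2 * m) 0)"
    by (rule card_inj_on_le[OF inj sub finite_dyck_words])
qed

section \<open>Tree-rooted maps from shuffles of arc diagrams\<close>

definition partner :: "(nat \<times> nat) set \<Rightarrow> nat \<Rightarrow> nat" where
  "partner E x = (if \<exists>y. (x, y) \<in> E \<or> (y, x) \<in> E then THE y. (x, y) \<in> E \<or> (y, x) \<in> E else x)"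

locale matching =
  fixes E :: "(nat \<times> nat) set" and N :: nat
  assumes arc: "arc_diagram E" and disj: "Domain E \<inter> Range E = {}" and sub: "Field E \<subseteq> {..<N}"
begin

lemma partner_arc: "(i, j) \<in> E \<Longrightarrow> partner E i = j" "(i, j) \<in> E \<Longrightarrow> partner E j = i"
proof -
  assume ij: "(i, j) \<in> E"
  have "(THE y. (i, y) \<in> E \<or> (y, i) \<in> E) = j"
    by (rule the_equality) (use ij disj arc_diagramD(3)[OF arc] in blast)+
  then show "partner E i = j" using ij by (auto simp: partner_def)
  have "(THE y. (j, y) \<in> E \<or> (y, j) \<in> E) = i"
    by (rule the_equality) (use ij disj arc_diagramD(4)[OF arc] in blast)+
  then show "partner E j = i" using ij by (auto simp: partner_def)
qed

lemma partner_notin: "x \<notin> Field E \<Longrightarrow> partner E x = x"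
  by (auto simp: partner_def Field_def)

lemma FieldE:
  assumes "x \<in> Field E"
  obtains "(x, partner E x) \<in> E" | "(partner E x, x) \<in> E"
proof -
  consider y where "(x, y) \<in> E" | y where "(y, x) \<in> E" using assms by (auto simp: Field_def)
  then show thesis
  proof cases
    case (1 y)
    then show thesis using that(1) partner_arc(1)[OF 1] by simp
  next
    case (2 y)
    then show thesis using that(2) partner_arc(2)[OF 2] by simp
  qed
qed

lemma partner_partner: "partner E (partner E x) = x"
proof (cases "x \<in> Field E")
  case True
  then show ?thesis
  proof (cases rule: FieldE)
    case 1
    then show ?thesis by (rule partner_arc(2))
  next
    case 2
    then show ?thesis by (rule partner_arc(1))
  qed
qed (simp add: partner_notin)

lemma partner_Field: "partner E x \<in> Field E \<longleftrightarrow> x \<in> Field E"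
proof -
  have "partner E x \<in> Field E" if "x \<in> Field E" for x
    using that by (cases rule: FieldE) (auto simp: Field_def)
  then show ?thesis using partner_partner[of x] by metis
qed

lemma partner_neq: "x \<in> Field E \<Longrightarrow> partner E x \<noteq> x"
  by (erule FieldE) (auto dest: arc_diagramD(2)[OF arc])

lemma partner_permutes: "partner E permutes {..N}"
proof (rule bij_imp_permutes)
  have "partner E x \<in> {..N}" if "x \<in> {..N}" for x
    using that partner_Field[of x] partner_notin[of x] sub by (cases "x \<in> Field E") auto
  then show "bij_betw (partner E) {..N} {..N}"
    by (intro bij_betw_byWitness[of _ "partner E"]) (use partner_partner in auto)
  show "partner E x = x" if "x \<notin> {..N}" for x using that sub by (intro partner_notin) auto
qed

lemma card_Field: "card (Field E) = 2 * card E"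
  unfolding Field_def
  using card_Un_disjoint[OF _ _ disj] arc_diagram_card(2,3)[OF arc] arc_diagramD(1)[OF arc]
  by (simp add: finite_Domain finite_Range)

end

definition cyclic_succ :: "nat \<Rightarrow> nat \<Rightarrow> nat" where
  "cyclic_succ N x = (if x < N then Suc x else if x = N then 0 else x)"

text \<open>Starting at \<open>N\<close> puts the root first and leaves the smaller numbers in their
  usual order.\<close>

lemma full_cycle_cyclic_succ: "full_cycle {..N} (cyclic_succ N) N"
proof
  show "cyclic_succ N permutes {..N}"
  proof (rule bij_imp_permutes)
    show "bij_betw (cyclic_succ N) {..N} {..N}"
      by (rule bij_betw_byWitness[of _ "\<lambda>x. if x = 0 then N else x - 1"]) (auto simp: cyclic_succ_def)
  qed (auto simp: cyclic_succ_def)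
  have "(cyclic_succ N ^^ Suc k) N = k" if "k \<le> N" for k
    using that by (induction k) (auto simp: cyclic_succ_def)
  then show "{..N} \<subseteq> orbit (cyclic_succ N) N" unfolding orbit_altdef by (metis (mono_tags, lifting) atMost_iff mem_Collect_eq subsetI zero_less_Suc)
qed auto

text \<open>The upper bound is the orbit inequality, since \<open>partner E\<close> has
  \<open>Suc N - card E\<close> orbits. For the lower bound, the interval \<open>{i<..j}\<close> of
  an arc is invariant, so the closing points and \<open>N\<close> are maxima of their orbits, which
  are therefore distinct.\<close>

lemma (in matching) card_orbits_partner:
  "card (orbits (cyclic_succ N \<circ> partner E) {..N}) = Suc (card E)"
proof (rule antisym)
  interpret C: full_cycle "{..N}" "cyclic_succ N" N by (rule full_cycle_cyclic_succ)
  interpret C: full_cycle_perm "{..N}" "cyclic_succ N" N "partner E"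
    by unfold_locales (rule partner_permutes)
  have "card (orbits (partner E) {..N}) + card (Range E) = card {..N}"
  proof (rule card_orbits_involution)
    show "x \<in> {..N} \<Longrightarrow> partner E x \<in> {..N} \<and> partner E (partner E x) = x" for x
      using C.s_in partner_partner by simp
    show "Range E \<subseteq> {..N}" using sub by (auto simp: Field_def)
    show "partner E y \<notin> Range E" if "y \<in> Range E" for y
      using that partner_arc(2) disj by blast
    show "partner E x = x \<or> partner E x \<in> Range E" if "x \<in> {..N} - Range E" for x
      using that partner_arc(1) partner_notin[of x] unfolding Field_def by blast
  qed simp
  then show "card (orbits (cyclic_succ N \<circ> partner E) {..N}) \<le> Suc (card E)"
    using C.card_orbits_genus arc_diagram_card(2)[OF arc] by simp
  let ?p = "cyclic_succ N \<circ> partner E"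
  have inv: "orbit ?p j \<subseteq> {i<..j}" if ij: "(i, j) \<in> E" for i j
  proof (rule permutes_orbit_closed[OF C.cs_perm])
    have lt: "i < j" "j < N" using arc_diagramD(2)[OF arc ij] ij sub by (auto simp: Field_def)
    then show "j \<in> {i<..j}" by simp
    show "?p ` {i<..j} \<subseteq> {i<..j}"
    proof clarify
      fix x assume x: "x \<in> {i<..j}"
      have "i \<le> partner E x \<and> partner E x < j"
      proof (cases "x = j")
        case True
        then show ?thesis using partner_arc(2)[OF ij] lt by simp
      next
        case False
        then have xj: "x < j" using x by simp
        show ?thesis
        proof (cases "x \<in> Field E")
          case False
          then show ?thesis using partner_notin x xj by simp
        next
          case True
          then show ?thesis
          proof (cases rule: FieldE)
            case 1
            have "partner E x \<noteq> j" using arc_diagramD(4)[OF arc] 1 ij x by force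
            then show ?thesis using arc_diagramD(5)[OF arc ij 1] arc_diagramD(2)[OF arc 1] x xj
              by (meson greaterThanAtMost_iff leI less_le_trans linorder_neqE_nat order_less_imp_le)
          next
            case 2
            have "\<not> partner E x < i" using arc_diagramD(5)[OF arc 2 ij] x xj by auto
            then show ?thesis using arc_diagramD(2)[OF arc 2] xj by auto
          qed
        qed
      qed
      then show "?p x \<in> {i<..j}" using lt by (auto simp: cyclic_succ_def)
    qed
  qed simp
  have self: "x \<in> orbit ?p x" for x by (rule permutes_orbit_self[OF C.cs_perm]) simp
  have RN: "Range E \<subseteq> {..<N}" using sub by (auto simp: Field_def)
  have inj: "inj_on (orbit ?p) (insert N (Range E))"
  proof (rule inj_onI)
    fix x y assume xy: "x \<in> insert N (Range E)" "y \<in> insert N (Range E)" and eq: "orbit ?p x = orbit ?p y"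
    have "v \<le> u" if u: "u \<in> insert N (Range E)" "v \<in> insert N (Range E)" "orbit ?p u = orbit ?p v" for u v
    proof (cases "u = N")
      case True
      then show ?thesis using u RN by auto
    next
      case False
      then obtain i where "(i, u) \<in> E" using u by blast
      then show ?thesis using inv self[of v] u(3) by fastforce
    qed
    then show "x = y" using xy eq by (metis order_antisym)
  qed
  have "card (insert N (Range E)) \<le> card (orbits ?p {..N})"
    by (rule card_inj_on_le[OF inj]) (use RN in \<open>auto simp: orbits_def\<close>)
  moreover have "N \<notin> Range E" "finite (Range E)" using RN finite_subset[OF RN] by auto
  ultimately show "Suc (card E) \<le> card (orbits ?p {..N})"
    using arc_diagram_card(2)[OF arc] by simp
qed

text \<open>The numbers below \<open>2 * n\<close> are the half-edges in the order of the tour; arcs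
  of \<open>E\<close> are tree edges, arcs of \<open>F\<close> the others. The rotation is chosen to
  make the tour \<open>cyclic_succ\<close>; then \<open>rot \<circ> opp\<close> is
  \<open>cyclic_succ \<circ> partner F\<close>, so \<open>E\<close> governs the vertices and
  \<open>F\<close> the faces.\<close>

definition shuffle_map :: "nat \<Rightarrow> (nat \<times> nat) set \<Rightarrow> (nat \<times> nat) set \<Rightarrow> nat tree_rmap" where
  "shuffle_map n E F =
     \<lparr>half_edges = {..2 * n}, rot = cyclic_succ (2 * n) \<circ> partner E, opp = partner E \<circ> partner F,
      root_he = 2 * n, tree = Field E\<rparr>"

locale shuffle = E: matching E "2 * n" + F: matching F "2 * n" for n E F +
  assumes disjEF: "Field E \<inter> Field F = {}" and allEF: "Field E \<union> Field F = {..<2 * n}"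
begin

abbreviation "M \<equiv> shuffle_map n E F"
abbreviation "c \<equiv> cyclic_succ (2 * n)"
abbreviation "a \<equiv> partner E \<circ> partner F"
abbreviation "H \<equiv> {..2 * n}"

sublocale C: full_cycle H c "2 * n" by (rule full_cycle_cyclic_succ)

lemma a_E: "x \<in> Field E \<Longrightarrow> a x = partner E x"
proof -
  assume "x \<in> Field E"
  then have "x \<notin> Field F" using disjEF by blast
  then show "a x = partner E x" by (simp add: F.partner_notin)
qed

lemma a_F: "x \<in> Field F \<Longrightarrow> a x = partner F x"
proof -
  assume "x \<in> Field F"
  then have "partner F x \<notin> Field E" using disjEF F.partner_Field[of x] by blast
  then show "a x = partner F x" by (simp add: E.partner_notin)
qed

lemma a_root: "a (2 * n) = 2 * n"
proof -
  have "2 * n \<notin> Field E" "2 * n \<notin> Field F" using allEF by auto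
  then show ?thesis using E.partner_notin F.partner_notin by simp
qed

lemma Field_cases: "x \<in> H \<Longrightarrow> x \<noteq> 2 * n \<Longrightarrow> x \<in> Field E \<or> x \<in> Field F"
proof -
  assume "x \<in> H" "x \<noteq> 2 * n"
  then have "x \<in> {..<2 * n}" by simp
  then show "x \<in> Field E \<or> x \<in> Field F" unfolding allEF[symmetric] by blast
qed

lemma a_a: "x \<in> H \<Longrightarrow> a (a x) = x"
proof (cases "x = 2 * n")
  case True
  then show ?thesis using a_root by simp
next
  case False
  assume "x \<in> H"
  then consider "x \<in> Field E" | "x \<in> Field F" using Field_cases False by blast
  then show ?thesis
  proof cases
    case 1
    then show ?thesis using a_E[of x] a_E[of "partner E x"] E.partner_Field E.partner_partner by simp
  next
    case 2
    then show ?thesis using a_F[of x] a_F[of "partner F x"] F.partner_Field F.partner_partner by simp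
  qed
qed

lemma a_fix: "x \<in> H \<Longrightarrow> a x = x \<longleftrightarrow> x = 2 * n"
  using Field_cases[of x] a_root a_E[of x] a_F[of x] E.partner_neq[of x] F.partner_neq[of x] by metis

lemma a_permutes: "a permutes H" by (rule permutes_compose[OF F.partner_permutes E.partner_permutes])

lemma rot_permutes: "(c \<circ> partner E) permutes H" by (rule permutes_compose[OF E.partner_permutes C.perm])

lemma M_simps: "half_edges M = H" "rot M = c \<circ> partner E" "opp M = a" "root_he M = 2 * n" "tree M = Field E"
  by (simp_all add: shuffle_map_def)

lemma flip_eq: "tree_flip M (tree M) = partner E"
  using a_E E.partner_notin by (auto simp: tree_flip_def M_simps)

lemma tour_eq: "tour_step M (tree M) x = c x"
  using flip_eq[THEN fun_cong, of x] E.partner_partner by (simp add: tour_step_def tree_flip_def M_simps)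

sublocale C: full_cycle_perm H c "2 * n" "partner E"
  by unfold_locales (rule E.partner_permutes)

lemma card_arcs: "card E + card F = n"
proof -
  have "card (Field E \<union> Field F) = card (Field E) + card (Field F)"
    by (rule card_Un_disjoint) (use disjEF finite_subset[OF E.sub] finite_subset[OF F.sub] in auto)
  then show ?thesis using allEF E.card_Field F.card_Field by simp
qed

lemma card_edges_M: "card (edges M) = n"
proof -
  have ar: "a x \<noteq> 2 * n" if "x \<in> H" "x \<noteq> 2 * n" for x using a_a[OF that(1)] a_root that by metis
  have "card (H - {2 * n}) = 2 * card ((\<lambda>x. {x, a x}) ` (H - {2 * n}))"
    by (rule card_pairs_free_involution)
      (use a_a a_fix ar permutes_in_image[OF a_permutes] in \<open>auto simp del: comp_apply\<close>)
  then show ?thesis by (simp add: edges_def M_simps)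
qed

lemma step_graph:
  assumes "x \<in> H"
  shows "(x, c x) \<in> ({(u, rot M u) | u. u \<in> half_edges M} \<union> {(u, opp M u) | u. u \<in> half_edges M})\<^sup>*"
    (is "_ \<in> ?R\<^sup>*")
proof -
  have "(x, partner E x) \<in> ?R\<^sup>*"
  proof (cases "x \<in> Field E")
    case True
    have "(x, a x) \<in> ?R" using assms by (auto simp: M_simps)
    then show ?thesis using a_E[OF True] by auto
  qed (simp add: E.partner_notin)
  moreover have "rot M (partner E x) = c x" using E.partner_partner by (simp add: M_simps)
  then have "(partner E x, c x) \<in> ?R" using C.s_in[of x] assms by (force simp: M_simps(1))
  ultimately show ?thesis by (rule rtrancl_into_rtrancl)
qed

lemma vertices_M: "vertices M = orbits (c \<circ> partner E) H"
  by (auto simp: vertices_def vertex_of_def orbits_def M_simps)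

text \<open>One vertex more than arcs of \<open>E\<close> and one face more than arcs of
  \<open>F\<close> make \<open>n + 2\<close> in all.\<close>

lemma planar_M: "planar_map M"
proof -
  have "rot M \<circ> opp M = c \<circ> partner F" using E.partner_partner by (auto simp: M_simps)
  then have "card (faces M) = Suc (card F)"
    using F.card_orbits_partner by (simp add: faces_def orbits_def M_simps)
  moreover have "card (vertices M) = Suc (card E)" using E.card_orbits_partner by (simp add: vertices_M)
  moreover have "connected_map M"
    by (rule connected_mapI[where c = c and r = "2 * n"])
      (use C.perm C.full step_graph in \<open>simp_all add: M_simps(1)\<close>)
  ultimately show ?thesis
    unfolding planar_map_def card_edges_M
    using a_permutes rot_permutes a_a a_fix card_arcs by (simp add: M_simps del: comp_apply)
qed

abbreviation "core \<equiv> insert (2 * n) (Field E)"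

lemma core_sub: "core \<subseteq> H" using E.sub by auto

text \<open>A vertex that avoids the root contains a descent, and \<open>partner E\<close> moves
  only points of \<open>Field E\<close>.\<close>

lemma core_meets: "Q \<in> vertices M \<Longrightarrow> Q \<inter> core \<noteq> {}"
proof (cases "2 * n \<in> Q")
  case False
  assume "Q \<in> vertices M"
  then obtain x where x: "x \<in> Q" "x \<in> C.Desc"
    using C.orbit_has_descent[of Q] False unfolding vertices_M by blast
  have "x \<in> Field E"
  proof (rule ccontr)
    assume "x \<notin> Field E"
    then show False using x E.partner_notin[of x] by (simp add: C.Desc_def)
  qed
  then show ?thesis using x by blast
qed blast

lemma plane_submap: "plane_tree (submap M (tree M))"
proof -
  let ?N = "submap M (tree M)"
  let ?c = "first_return c core"
  have N: "half_edges ?N = core" "root_he ?N = 2 * n" "rot ?N = first_return (c \<circ> partner E) core"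
    by (simp_all add: submap_def M_simps)
  have opp: "opp ?N = partner E"
    using a_E E.partner_notin by (auto simp: submap_def M_simps)
  \<comment> \<open>The face permutation of the submap is the tour \<open>c\<close> restricted to
    \<open>core\<close>; induced by a full cycle, it has a single orbit.\<close>
  have eq: "(rot ?N \<circ> opp ?N) x = ?c x" if "x \<in> core" for x
  proof -
    have "?c x = first_return (c \<circ> partner E) core (partner E x)"
    proof (rule first_return_comp[OF rot_permutes])
      show "c z = (c \<circ> partner E) (partner E z)" for z by (simp add: E.partner_partner)
      show "partner E x \<in> core"
        using that E.partner_Field[of x] E.partner_notin[of x] by auto
      show "partner E z = z" if "z \<notin> core" for z using that E.partner_notin by simp
    qed (use that in simp_all)
    then show ?thesis by (simp add: N opp)
  qed
  have cperm: "?c permutes core" by (rule first_return_permutes[OF C.perm C.fin core_sub])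
  have oc: "orbit ?c x = core" if "x \<in> core" for x
    using orbit_first_return[OF C.perm C.fin that] C.orbit_root[of x] that core_sub by blast
  have o: "orbit (rot ?N \<circ> opp ?N) x = core" if "x \<in> core" for x
  proof -
    have "orbit ?c x = orbit (rot ?N \<circ> opp ?N) x"
      by (rule orbit_cong0[OF that]) (use eq cperm permutes_in_image[OF cperm] in auto)
    then show ?thesis using oc[OF that] by simp
  qed
  have "faces ?N = (\<lambda>x. core) ` core"
    unfolding faces_def N(1) by (rule image_cong[OF refl o])
  then have "faces ?N = {core}" by blast
  moreover have "card (vertices ?N) = Suc (card E)"
  proof -
    have "vertices ?N = orbits (first_return (c \<circ> partner E) core) core"
      unfolding vertices_def vertex_of_def orbits_def N ..
    then show ?thesis
      using card_orbits_first_return[OF rot_permutes C.fin core_sub] core_meets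
        E.card_orbits_partner by (simp add: vertices_M)
  qed
  moreover have "card (edges ?N) = card E"
  proof -
    have "core - {2 * n} = Field E" using E.sub by auto
    then have "edges ?N = (\<lambda>x. {x, partner E x}) ` Field E" unfolding edges_def N opp by simp
    moreover have "card (Field E) = 2 * card ((\<lambda>x. {x, partner E x}) ` Field E)"
      by (rule card_pairs_free_involution)
        (use E.sub finite_subset E.partner_Field E.partner_partner E.partner_neq in auto)
    ultimately show ?thesis using E.card_Field by simp
  qed
  moreover have "connected_map ?N"
  proof (rule connected_mapI[where c = ?c and r = "2 * n"])
    show "?c permutes half_edges ?N" "finite (half_edges ?N)" "2 * n \<in> half_edges ?N"
      using cperm finite_subset[OF core_sub] by (simp_all add: N)
    show "half_edges ?N \<subseteq> orbit ?c (2 * n)" using oc[of "2 * n"] by (simp add: N)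
    fix x assume "x \<in> half_edges ?N"
    then have x: "x \<in> core" by (simp add: N)
    let ?R = "{(u, rot ?N u) | u. u \<in> half_edges ?N} \<union> {(u, opp ?N u) | u. u \<in> half_edges ?N}"
    have px: "partner E x \<in> core" using x E.partner_Field[of x] E.partner_notin[of x] by auto
    have "(x, opp ?N x) \<in> ?R" "(opp ?N x, rot ?N (opp ?N x)) \<in> ?R"
      using x px unfolding N(1) opp by blast+
    then have "(x, rot ?N (opp ?N x)) \<in> ?R\<^sup>*" by (meson r_into_rtrancl rtrancl_into_rtrancl)
    then show "(x, ?c x) \<in> ?R\<^sup>*" using eq[OF x] by simp
  qed
  moreover have "rot ?N permutes core"
    unfolding N by (rule first_return_permutes[OF rot_permutes C.fin core_sub])
  moreover have "partner E permutes core"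
  proof (rule bij_imp_permutes)
    show "bij_betw (partner E) core core"
      by (rule bij_betw_byWitness[of _ "partner E"])
        (use E.partner_partner E.partner_Field E.partner_notin in auto)
  qed (simp add: E.partner_notin)
  moreover have "2 * n \<notin> Field E" using E.sub by auto
  ultimately show ?thesis
    unfolding plane_tree_def planar_map_def
    using finite_subset[OF core_sub] E.partner_partner E.partner_neq E.partner_notin
    by (auto simp: N(1,2) opp)
qed

theorem tree_rooted_M: "tree_rooted_map M"
proof -
  have "opp M ` tree M = tree M"
  proof -
    have "opp M ` tree M = partner E ` Field E"
      unfolding M_simps by (rule image_cong) (use a_E in auto)
    also have "\<dots> = Field E"
      using E.partner_Field E.partner_partner by (metis (no_types, lifting) image_eqI equalityI image_subsetI subsetI)
    finally show ?thesis by (simp add: M_simps)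
  qed
  moreover have "tree M \<subseteq> half_edges M - {root_he M}" using E.sub by (auto simp: M_simps)
  moreover have "\<forall>v\<in>vertices M. v \<inter> insert (root_he M) (tree M) \<noteq> {}"
    using core_meets by (simp add: M_simps)
  ultimately show ?thesis
    unfolding tree_rooted_map_def spanning_tree_def using planar_M plane_submap by blast
qed

end

text \<open>An isomorphism respects the trees, hence the flips, hence the tour \<open>c\<close>. As
  it fixes the root \<open>2 * n\<close>, it is the identity on half-edges, and arcs are recovered
  from partners with the smaller end first.\<close>

lemma shuffle_map_inj:
  assumes "shuffle n E F" "shuffle n E' F'" "tree_rooted_iso g (shuffle_map n E F) (shuffle_map n E' F')"
  shows "E = E'" "F = F'"
proof -
  interpret X: shuffle n E F by fact
  interpret Y: shuffle n E' F' by fact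
  have g: "\<And>x. x \<in> X.H \<Longrightarrow> g (X.c (partner E x)) = Y.c (partner E' (g x))"
    "\<And>x. x \<in> X.H \<Longrightarrow> g (X.a x) = Y.a (g x)" "g (2 * n) = 2 * n" "g ` Field E = Field E'"
    "bij_betw g X.H Y.H"
    using assms(3) by (auto simp: tree_rooted_iso_def map_iso_def X.M_simps Y.M_simps)
  have inj: "inj_on g X.H" using g(5) by (simp add: bij_betw_def)
  have EH: "Field E \<subseteq> X.H" using X.core_sub by blast
  have tree: "g x \<in> Field E' \<longleftrightarrow> x \<in> Field E" if "x \<in> X.H" for x
    unfolding g(4)[symmetric] by (rule inj_on_image_mem_iff[OF inj that EH])
  have flip: "g (partner E x) = partner E' (g x)" if x: "x \<in> X.H" for x
    using tree[OF x] g(2)[OF x] X.a_E[of x] Y.a_E[of "g x"] X.E.partner_notin Y.E.partner_notin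
    by (cases "x \<in> Field E") auto
  have step: "g (X.c x) = X.c (g x)" if x: "x \<in> X.H" for x
  proof -
    have "g (X.c (partner E (partner E x))) = X.c (partner E' (g (partner E x)))"
      by (rule g(1)) (use X.C.s_in x in simp)
    then show ?thesis using flip[OF x] X.E.partner_partner Y.E.partner_partner by simp
  qed
  have id: "g ((X.c ^^ k) (2 * n)) = (X.c ^^ k) (2 * n)" for k
  proof (induction k)
    case (Suc k)
    have "(X.c ^^ k) (2 * n) \<in> X.H" by (rule permutes_funpow_in[OF X.C.perm]) simp
    then show ?case using step Suc by simp
  qed (simp add: g(3))
  have gid: "g x = x" if "x \<in> X.H" for x using id[of "X.C.time x"] X.C.funpow_time[OF that] by simp
  have pE: "partner E x = partner E' x" if "x \<in> X.H" for x
    using flip[OF that] gid[OF that] gid[of "partner E x"] X.C.s_in[of x] that by simp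
  have pa: "X.a x = Y.a x" if "x \<in> X.H" for x
    using g(2)[OF that] gid[OF that] gid[of "X.a x"] permutes_in_image[OF X.a_permutes, of x] that
    by (simp del: comp_apply)
  have FE: "Field E = Field E'"
  proof -
    have "g ` Field E = Field E" using gid X.core_sub by (force simp: image_iff)
    then show ?thesis using g(4) by simp
  qed
  then have FF: "Field F = Field F'" using X.disjEF X.allEF Y.disjEF Y.allEF by blast
  have pF: "partner F x = partner F' x" if "x \<in> Field F" for x
    using pa[of x] X.a_F[OF that] Y.a_F[of x] that FF X.F.sub by force
  have eq: "A = B" if A: "matching A (2 * n)" and B: "matching B (2 * n)" and AB: "Field A = Field B"
    and p: "\<And>x. x \<in> Field A \<Longrightarrow> partner A x = partner B x" for A B
  proof -
    have sub: "A \<subseteq> B" if A: "matching A (2 * n)" and B: "matching B (2 * n)" and AB: "Field A = Field B"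
      and p: "\<And>x. x \<in> Field A \<Longrightarrow> partner A x = partner B x" for A B
    proof clarify
      fix i j assume ij: "(i, j) \<in> A"
      interpret A: matching A "2 * n" by fact
      interpret B: matching B "2 * n" by fact
      have iF: "i \<in> Field A" "i \<in> Field B" using ij AB by (auto simp: Field_def)
      have e: "partner B i = j" using p[OF iF(1)] A.partner_arc(1)[OF ij] by simp
      show "(i, j) \<in> B" using iF(2)
      proof (cases rule: B.FieldE)
        case 1
        then show ?thesis using e by simp
      next
        case 2
        then show ?thesis
          using e arc_diagramD(2)[OF B.arc, of j i] arc_diagramD(2)[OF A.arc ij] by simp
      qed
    qed
    have "A \<subseteq> B" by (rule sub[OF A B AB p])
    moreover have "B \<subseteq> A" by (rule sub[OF B A AB[symmetric]]) (use p AB in simp)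
    ultimately show ?thesis by (rule equalityI)
  qed
  show "E = E'"
  proof (rule eq[OF X.E.matching_axioms Y.E.matching_axioms FE])
    show "partner E x = partner E' x" if "x \<in> Field E" for x
      using pE[of x] that X.core_sub by blast
  qed
  show "F = F'" by (rule eq[OF X.F.matching_axioms Y.F.matching_axioms FF pF])
qed

text \<open>The coordinates after \<open>k\<close> steps, nonnegative and finally 0, written as
  letter counts: these are the ballot conditions of \<open>arc_diagram_exists\<close>.\<close>

lemma quadrant_prefix:
  assumes "quadrant p q w" "0 \<le> p" "0 \<le> q" "k \<le> length w"
  defines "cnt \<equiv> \<lambda>l. int (length (filter ((=) l) (take k w)))"
  shows "cnt (True, False) \<le> p + cnt (True, True) \<and> cnt (False, False) \<le> q + cnt (False, True) \<and>
    (k = length w \<longrightarrow> cnt (True, False) = p + cnt (True, True) \<and> cnt (False, False) = q + cnt (False, True))"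
  unfolding cnt_def using assms(1-4)
proof (induction p q w arbitrary: k rule: quadrant.induct)
  case (2 p q t b w)
  show ?case
  proof (cases k)
    case (Suc l)
    then have l: "l \<le> length w" using 2 by simp
    show ?thesis
    proof (cases t)
      case True
      have "quadrant (if b then p + 1 else p - 1) q w" "0 \<le> (if b then p + 1 else p - 1)"
        using "2.prems" True by auto
      from "2.IH"(1)[OF True this "2.prems"(3) l] show ?thesis using Suc True by (cases b) auto
    next
      case False
      have "quadrant p (if b then q + 1 else q - 1) w" "0 \<le> (if b then q + 1 else q - 1)"
        using "2.prems" False by auto
      from "2.IH"(2)[OF False this(1) "2.prems"(2) this(2) l] show ?thesis using Suc False by (cases b) auto
    qed
  qed (use 2 in auto)
qed simp

text \<open>The first component of a letter assigns the position to \<open>E\<close> or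
  \<open>F\<close>, the second makes it an opening or a closing point.\<close>

lemma quadrant_walk_shuffle:
  assumes w: "w \<in> quadrant_walks (2 * n) 0 0"
  shows "\<exists>E F. shuffle n E F \<and>
    w = map (\<lambda>k. (k \<in> Field E, k \<in> Domain E \<union> Domain F)) [0..<2 * n]"
proof -
  have len: "length w = 2 * n" and q: "quadrant 0 0 w" using w by (auto simp: quadrant_walks_def)
  define L where "L l = {k. k < 2 * n \<and> w ! k = l}" for l
  have finL: "finite (L l)" for l by (simp add: L_def)
  have cnt: "card (L l \<inter> {..<k}) = length (filter ((=) l) (take k w))" if "k \<le> 2 * n" for l k
  proof -
    have "L l \<inter> {..<k} = {i. i < length (take k w) \<and> l = take k w ! i}"
      using that len by (auto simp: L_def)
    then show ?thesis by (simp add: length_filter_conv_card)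
  qed
  \<comment> \<open>Positions beyond the word carry no letter, so the ballot condition for all
    \<open>k\<close> reduces to prefixes.\<close>
  have cut: "L l \<inter> {..<k} = L l \<inter> {..<min k (2 * n)}" for l k by (auto simp: L_def)
  have all: "L l = L l \<inter> {..<2 * n}" for l by (auto simp: L_def)
  have ex: "\<exists>E. arc_diagram E \<and> Domain E = L (t, True) \<and> Range E = L (t, False)" for t
  proof -
    have "card (L (t, False) \<inter> {..<k}) \<le> card (L (t, True) \<inter> {..<k})" for k
    proof -
      have "min k (2 * n) \<le> length w" using len by simp
      from quadrant_prefix[OF q order_refl order_refl this] show ?thesis
        unfolding cut[of _ k] using cnt[of "min k (2 * n)"] by (cases t) auto
    qed
    moreover have "card (L (t, True)) = card (L (t, False))"
    proof -
      have "card (L (t, True) \<inter> {..<2 * n}) = card (L (t, False) \<inter> {..<2 * n})"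
        using quadrant_prefix[OF q order_refl order_refl order_refl] cnt[of "2 * n"] len by (cases t) auto
      then show ?thesis using all by metis
    qed
    moreover have "L (t, True) \<inter> L (t, False) = {}" by (auto simp: L_def)
    ultimately show ?thesis using arc_diagram_exists[OF finL finL] by metis
  qed
  obtain E where E: "arc_diagram E" "Domain E = L (True, True)" "Range E = L (True, False)" using ex by blast
  obtain F where F: "arc_diagram F" "Domain F = L (False, True)" "Range F = L (False, False)" using ex by blast
  have "shuffle n E F"
  proof unfold_locales
    show "Field E \<union> Field F = {..<2 * n}"
    proof
      show "{..<2 * n} \<subseteq> Field E \<union> Field F"
      proof
        fix k assume "k \<in> {..<2 * n}"
        then have k: "k \<in> L (w ! k)" by (simp add: L_def)
        obtain t b where "w ! k = (t, b)" by (cases "w ! k")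
        then show "k \<in> Field E \<union> Field F" using k unfolding Field_def E F by (cases t; cases b) auto
      qed
    qed (auto simp: Field_def E F L_def)
  qed (use E F in \<open>auto simp: Field_def L_def\<close>)
  moreover have "w = map (\<lambda>k. (k \<in> Field E, k \<in> Domain E \<union> Domain F)) [0..<2 * n]"
  proof (rule nth_equalityI)
    fix k assume "k < length w"
    then have k: "k < 2 * n" using len by simp
    obtain t b where tb: "w ! k = (t, b)" by (cases "w ! k")
    then have "k \<in> Field E \<longleftrightarrow> t" "k \<in> Domain E \<union> Domain F \<longleftrightarrow> b"
      using k unfolding Field_def E F L_def by auto
    then show "w ! k = map (\<lambda>k. (k \<in> Field E, k \<in> Domain E \<union> Domain F)) [0..<2 * n] ! k"
      using tb k by simp
  qed (simp add: len)
  ultimately show ?thesis by blast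
qed

section \<open>The bijection\<close>

lemma map_iso_sym:
  assumes "map_iso f M N" "\<And>x. x \<in> half_edges M \<Longrightarrow> rot M x \<in> half_edges M \<and> opp M x \<in> half_edges M"
    "root_he M \<in> half_edges M"
  shows "map_iso (inv_into (half_edges M) f) N M"
proof -
  let ?g = "inv_into (half_edges M) f"
  have f: "bij_betw f (half_edges M) (half_edges N)"
    "\<And>x. x \<in> half_edges M \<Longrightarrow> f (rot M x) = rot N (f x) \<and> f (opp M x) = opp N (f x)"
    "f (root_he M) = root_he N" using assms(1) by (auto simp: map_iso_def)
  have gf: "?g (f x) = x" if "x \<in> half_edges M" for x
    using f(1) that by (simp add: bij_betw_inv_into_left)
  have "?g (rot N y) = rot M (?g y) \<and> ?g (opp N y) = opp M (?g y)" if y: "y \<in> half_edges N" for y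
  proof -
    obtain x where x: "x \<in> half_edges M" "y = f x" using f(1) y by (auto simp: bij_betw_def)
    have "rot N y = f (rot M x)" "opp N y = f (opp M x)" using f(2) x by auto
    then show ?thesis using gf assms(2) x by simp
  qed
  moreover have "?g (root_he N) = root_he M" using gf[OF assms(3)] f(3) by simp
  ultimately show ?thesis using bij_betw_inv_into[OF f(1)] by (simp add: map_iso_def)
qed

lemma map_iso_trans: "map_iso f M N \<Longrightarrow> map_iso g N P \<Longrightarrow> map_iso (g \<circ> f) M P"
  unfolding map_iso_def using bij_betw_trans by (auto simp: bij_betw_apply)

lemma map_iso_id: "map_iso id M M"
  by (simp add: map_iso_def)

lemma equiv_map_equiv: "equiv {M. planar_map M} map_equiv"
proof (rule equivI)
  show "map_equiv \<subseteq> {M. planar_map M} \<times> {M. planar_map M}" by (auto simp: map_equiv_def)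
  show "refl_on {M. planar_map M} map_equiv"
    unfolding refl_on_def map_equiv_def using map_iso_id by auto
  show "sym map_equiv"
  proof (rule symI)
    fix M N assume MN: "(M, N) \<in> map_equiv"
    then obtain f where f: "planar_map M" "planar_map N" "map_iso f M N" by (auto simp: map_equiv_def)
    have "map_iso (inv_into (half_edges M) f) N M"
      by (rule map_iso_sym[OF f(3)])
        (use planar_mapD[OF f(1)] permutes_in_image[OF planar_mapD(3)[OF f(1)]] in auto)
    then show "(N, M) \<in> map_equiv" using f by (auto simp: map_equiv_def)
  qed
  show "trans map_equiv"
    by (rule transI) (auto simp: map_equiv_def intro: map_iso_trans)
qed

lemma equiv_tree_rooted_equiv: "equiv {M. tree_rooted_map M} tree_rooted_equiv"
proof (rule equivI)
  show "tree_rooted_equiv \<subseteq> {M. tree_rooted_map M} \<times> {M. tree_rooted_map M}"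
    by (auto simp: tree_rooted_equiv_def)
  have "tree_rooted_iso id M M" for M :: "nat tree_rmap" by (simp add: tree_rooted_iso_def map_iso_id)
  then show "refl_on {M. tree_rooted_map M} tree_rooted_equiv"
    unfolding refl_on_def tree_rooted_equiv_def by auto
  show "sym tree_rooted_equiv"
  proof (rule symI)
    fix M N assume MN: "(M, N) \<in> tree_rooted_equiv"
    then obtain f where f: "tree_rooted_map M" "tree_rooted_map N" "map_iso f M N" "f ` tree M = tree N"
      by (auto simp: tree_rooted_equiv_def tree_rooted_iso_def)
    have p: "planar_map M" using f(1) by (simp add: tree_rooted_map_def)
    let ?g = "inv_into (half_edges M) f"
    have "map_iso ?g N M"
      by (rule map_iso_sym[OF f(3)])
        (use planar_mapD[OF p] permutes_in_image[OF planar_mapD(3)[OF p]] in auto)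
    moreover have "?g ` tree N = tree M"
    proof -
      have "inj_on f (half_edges M)" using f(3) by (simp add: map_iso_def bij_betw_def)
      moreover have "tree M \<subseteq> half_edges M" using f(1) by (auto simp: tree_rooted_map_def spanning_tree_def)
      ultimately show ?thesis unfolding f(4)[symmetric] by (rule inv_into_image_cancel)
    qed
    ultimately show "(N, M) \<in> tree_rooted_equiv" using f by (auto simp: tree_rooted_equiv_def tree_rooted_iso_def)
  qed
  show "trans tree_rooted_equiv"
  proof (rule transI)
    fix M N P assume "(M, N) \<in> tree_rooted_equiv" "(N, P) \<in> tree_rooted_equiv"
    then obtain f g where *: "tree_rooted_map M" "tree_rooted_map P" "map_iso f M N" "map_iso g N P"
      "f ` tree M = tree N" "g ` tree N = tree P"
      by (auto simp: tree_rooted_equiv_def tree_rooted_iso_def)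
    have "(g \<circ> f) ` tree M = tree P" using *(5,6) by (metis image_comp)
    then have "tree_rooted_iso (g \<circ> f) M P"
      unfolding tree_rooted_iso_def using map_iso_trans[OF *(3,4)] by blast
    then show "(M, P) \<in> tree_rooted_equiv"
      unfolding tree_rooted_equiv_def using *(1,2) by blast
  qed
qed

lemma map_equivI:
  fixes A B :: "nat rmap"
  shows "plane_tree A \<Longrightarrow> plane_tree B \<Longrightarrow> map_iso g A B \<Longrightarrow> (A, B) \<in> map_equiv"
  by (auto simp: map_equiv_def plane_tree_def)

text \<open>The representative picked by \<open>SOME\<close> is isomorphic to \<open>M\<close>, and
  by \<open>phi_well_defined\<close> it yields an isomorphic tree and the same partition.\<close>

lemma Phi_class:
  assumes "tree_rooted_map M"
  shows "Phi (tree_rooted_equiv `` {M}) = (map_equiv `` {phi0 (delta M)}, phi1 (delta M))"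
proof -
  let ?X = "tree_rooted_equiv `` {M}"
  have "M \<in> ?X" using assms equiv_class_self[OF equiv_tree_rooted_equiv] by simp
  then have "(SOME N. N \<in> ?X) \<in> ?X" by (rule someI)
  moreover define N where "N = (SOME N. N \<in> ?X)"
  ultimately obtain f where f: "tree_rooted_map N" "tree_rooted_iso f M N" by (auto simp: tree_rooted_equiv_def)
  interpret tree_map_pair M N f by unfold_locales (use assms f in auto)
  have "(phi0 (delta M), phi0 (delta N)) \<in> map_equiv"
    by (rule map_equivI[OF X.E.plane_tree_phi0 Y.E.plane_tree_phi0 phi_well_defined(1)[OF f(2)]])
  then have "map_equiv `` {phi0 (delta M)} = map_equiv `` {phi0 (delta N)}"
    by (rule equiv_class_eq[OF equiv_map_equiv])
  then show ?thesis
    unfolding Phi_def Let_def N_def[symmetric] using phi_well_defined(2)[OF f(2)] by simp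
qed

lemma Phi_into:
  "Phi ` tree_rooted_maps n \<subseteq> plane_trees n \<times> noncrossing_partitions (n + 1)"
proof
  fix z assume "z \<in> Phi ` tree_rooted_maps n"
  then obtain M where tr: "tree_rooted_map M" "map_size M = n" "z = Phi (tree_rooted_equiv `` {M})"
    by (auto simp: tree_rooted_maps_def quotient_def)
  interpret tree_map M by unfold_locales fact
  have "plane_tree (phi0 (delta M)) \<and> map_size (phi0 (delta M)) = n"
    using E.plane_tree_phi0 E.edges_phi0 tr(2) by (simp add: map_size_def delta_simps)
  moreover have "phi1 (delta M) \<in> noncrossing_partitions (n + 1)"
    using E.phi1_noncrossing tr(2) by (simp add: map_size_def delta_simps)
  ultimately show "z \<in> plane_trees n \<times> noncrossing_partitions (n + 1)"
    unfolding tr(3) Phi_class[OF tr(1)] by (auto simp: plane_trees_def intro: quotientI)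
qed

lemma inj_Phi: "inj_on Phi (tree_rooted_maps n)"
proof (rule inj_onI)
  fix X Y assume "X \<in> tree_rooted_maps n" "Y \<in> tree_rooted_maps n" and eq: "Phi X = Phi Y"
  then obtain M N where M: "tree_rooted_map M" "X = tree_rooted_equiv `` {M}"
    and N: "tree_rooted_map N" "Y = tree_rooted_equiv `` {N}"
    by (auto simp: tree_rooted_maps_def quotient_def)
  interpret X: tree_map M by unfold_locales fact
  interpret Y: tree_map N by unfold_locales fact
  have *: "map_equiv `` {phi0 (delta M)} = map_equiv `` {phi0 (delta N)}" "phi1 (delta M) = phi1 (delta N)"
    using eq unfolding M(2) N(2) Phi_class[OF M(1)] Phi_class[OF N(1)] by auto
  have "(phi0 (delta M), phi0 (delta N)) \<in> map_equiv"
    by (rule eq_equiv_class[OF *(1) equiv_map_equiv])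
      (use Y.E.plane_tree_phi0 in \<open>simp add: plane_tree_def\<close>)
  then obtain g where g: "map_iso g (phi0 (delta M)) (phi0 (delta N))" by (auto simp: map_equiv_def)
  interpret tree_map_pair M N g by unfold_locales
  have "(M, N) \<in> tree_rooted_equiv"
    using phi_injective[OF g *(2)] M N by (auto simp: tree_rooted_equiv_def)
  then show "X = Y" unfolding M(2) N(2) by (rule equiv_class_eq[OF equiv_tree_rooted_equiv])
qed

section \<open>Comparison of cardinalities\<close>

lemma card_plane_trees_le:
  "finite (plane_trees n)" "card (plane_trees n) \<le> card (dyck_words (2 * n) 0)"
proof -
  define rep where "rep X = (SOME A. plane_tree A \<and> map_size A = n \<and> X = map_equiv `` {A})" for X
  have rep: "plane_tree (rep X) \<and> map_size (rep X) = n \<and> X = map_equiv `` {rep X}" if X: "X \<in> plane_trees n" for X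
  proof -
    obtain A where "plane_tree A \<and> map_size A = n \<and> X = map_equiv `` {A}"
      using X by (auto simp: plane_trees_def quotient_def)
    then show ?thesis unfolding rep_def by (rule someI)
  qed
  let ?f = "\<lambda>X. plane_tree_map.word (rep X)"
  have inj: "inj_on ?f (plane_trees n)"
  proof (rule inj_onI)
    fix X Y assume "X \<in> plane_trees n" "Y \<in> plane_trees n" and w: "?f X = ?f Y"
    then have X: "plane_tree (rep X)" "map_size (rep X) = n" "X = map_equiv `` {rep X}"
      and Y: "plane_tree (rep Y)" "map_size (rep Y) = n" "Y = map_equiv `` {rep Y}" using rep by auto
    obtain g where "map_iso g (rep X) (rep Y)"
      using plane_tree_word_iso[OF X(1) Y(1) _ w] X(2) Y(2) by (auto simp: map_size_def)
    then have "(rep X, rep Y) \<in> map_equiv" by (rule map_equivI[OF X(1) Y(1)])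
    then have "map_equiv `` {rep X} = map_equiv `` {rep Y}" by (rule equiv_class_eq[OF equiv_map_equiv])
    then show "X = Y" using X(3) Y(3) by simp
  qed
  have sub: "?f ` plane_trees n \<subseteq> dyck_words (2 * n) 0"
  proof clarify
    fix X assume "X \<in> plane_trees n"
    then have X: "plane_tree (rep X)" "map_size (rep X) = n" using rep by auto
    then show "?f X \<in> dyck_words (2 * n) 0"
      using plane_tree_map.word_dyck[OF plane_tree_map.intro] by (auto simp: map_size_def)
  qed
  show "finite (plane_trees n)" by (rule finite_imageD[OF finite_subset[OF sub finite_dyck_words] inj])
  show "card (plane_trees n) \<le> card (dyck_words (2 * n) 0)"
    by (rule card_inj_on_le[OF inj sub finite_dyck_words])
qed

text \<open>The walk is read off from \<open>E\<close> and \<open>F\<close>, and these from the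
  class of their shuffle map, so distinct walks give distinct classes. Finiteness is assumed because
  \<open>card\<close> of an infinite set is 0.\<close>

lemma card_tree_rooted_maps_ge:
  assumes "finite (tree_rooted_maps n)"
  shows "card (quadrant_walks (2 * n) 0 0) \<le> card (tree_rooted_maps n)"
proof -
  define P where "P w z \<longleftrightarrow> (case z of (E, F) \<Rightarrow> shuffle n E F \<and>
    w = map (\<lambda>k. (k \<in> Field E, k \<in> Domain E \<union> Domain F)) [0..<2 * n])" for w z
  define z where "z w = (SOME z. P w z)" for w
  have z: "P w (z w)" if w: "w \<in> quadrant_walks (2 * n) 0 0" for w
    unfolding z_def by (rule someI_ex) (use quadrant_walk_shuffle[OF w] in \<open>auto simp: P_def\<close>)
  define f where "f w = tree_rooted_equiv `` {shuffle_map n (fst (z w)) (snd (z w))}" for w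
  have sh: "shuffle n (fst (z w)) (snd (z w))" if "w \<in> quadrant_walks (2 * n) 0 0" for w
    using z[OF that] by (auto simp: P_def split: prod.splits)
  show ?thesis
  proof (rule card_inj_on_le[OF _ _ assms])
    show "inj_on f (quadrant_walks (2 * n) 0 0)"
    proof (rule inj_onI)
      fix v w assume v: "v \<in> quadrant_walks (2 * n) 0 0" and w: "w \<in> quadrant_walks (2 * n) 0 0" and e: "f v = f w"
      have "(shuffle_map n (fst (z v)) (snd (z v)), shuffle_map n (fst (z w)) (snd (z w))) \<in> tree_rooted_equiv"
        by (rule eq_equiv_class[OF e[unfolded f_def] equiv_tree_rooted_equiv])
          (use shuffle.tree_rooted_M[OF sh[OF w]] in simp)
      then obtain g where "tree_rooted_iso g (shuffle_map n (fst (z v)) (snd (z v)))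
          (shuffle_map n (fst (z w)) (snd (z w)))" by (auto simp: tree_rooted_equiv_def)
      then have "z v = z w" using shuffle_map_inj[OF sh[OF v] sh[OF w]] by (simp add: prod_eq_iff)
      then show "v = w" using z[OF v] z[OF w] by (auto simp: P_def split: prod.splits)
    qed
    show "f ` quadrant_walks (2 * n) 0 0 \<subseteq> tree_rooted_maps n"
    proof clarify
      fix w assume "w \<in> quadrant_walks (2 * n) 0 0"
      note s = sh[OF this]
      show "f w \<in> tree_rooted_maps n"
        unfolding f_def tree_rooted_maps_def
        by (rule quotientI) (use shuffle.tree_rooted_M[OF s] shuffle.card_edges_M[OF s] in \<open>simp add: map_size_def\<close>)
    qed
  qed
qed

theorem theorem1:
  fixes n :: nat
  shows "(\<forall>M. tree_rooted_map M \<and> map_size M = n \<longrightarrow>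
            Phi (tree_rooted_equiv `` {M}) = (map_equiv `` {phi0 (delta M)}, phi1 (delta M))) \<and>
         bij_betw Phi (tree_rooted_maps n) (plane_trees n \<times> noncrossing_partitions (n + 1)) \<and>
         real (card (tree_rooted_maps n)) = catalan n * catalan (n + 1)"
proof (intro conjI allI impI)
  fix M :: "nat tree_rmap"
  assume "tree_rooted_map M \<and> map_size M = n"
  then show "Phi (tree_rooted_equiv `` {M}) = (map_equiv `` {phi0 (delta M)}, phi1 (delta M))"
    using Phi_class by blast
next
  let ?T = "tree_rooted_maps n" and ?P = "plane_trees n \<times> noncrossing_partitions (n + 1)"
  have finP: "finite ?P"
    using card_plane_trees_le(1) card_noncrossing_partitions_le(1) by blast
  \<comment> \<open>\<open>Phi\<close> embeds the classes in a finite set; only then is the lower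
    bound by walks available.\<close>
  have finT: "finite ?T"
    by (rule finite_imageD[OF finite_subset[OF Phi_into finP] inj_Phi])
  have "card ?T = card (Phi ` ?T)" using card_image[OF inj_Phi] by simp
  also have "\<dots> \<le> card ?P" by (rule card_mono[OF finP Phi_into])
  finally have 1: "card ?T \<le> card ?P" .
  have "card ?P \<le> card (dyck_words (2 * n) 0) * card (dyck_words (2 * (n + 1)) 0)"
    unfolding card_cartesian_product
    by (intro mult_mono card_plane_trees_le(2) card_noncrossing_partitions_le(2)) auto
  then have "real (card ?P) \<le> real (card (dyck_words (2 * n) 0) * card (dyck_words (2 * (n + 1)) 0))"
    by (rule of_nat_mono)
  then have 2: "real (card ?P) \<le> catalan n * catalan (n + 1)"
    by (simp only: of_nat_mult card_dyck_words_catalan)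
  \<comment> \<open>This closes the circle of inequalities from \<open>card ?T\<close> through
    \<open>card ?P\<close> and the Catalan product back to \<open>card ?T\<close>.\<close>
  have 3: "catalan n * catalan (n + 1) \<le> real (card ?T)"
    using card_tree_rooted_maps_ge[OF finT] card_quadrant_walks_catalan[of n] by linarith
  show "real (card ?T) = catalan n * catalan (n + 1)" using 1 2 3 by linarith
  have "card ?T = card ?P" using 1 2 3 by linarith
  then have "Phi ` ?T = ?P"
    by (intro card_subset_eq[OF finP Phi_into]) (simp add: card_image[OF inj_Phi])
  then show "bij_betw Phi ?T ?P" using inj_Phi by (simp add: bij_betw_def)
qed

end
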